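(* Let $n \ge 2$ and $p > 1$ with $n > p$. Let $A : \mathbb{R}^n \times \mathbb{R} \times \mathbb{R}^n \to \mathbb{R}^n$ be a Carathéodory function such that, for some constants $C_1 > 0$, $C_2 > 0$, $$(A(x,s,\zeta) - A(x,s,\xi))\cdot(\zeta - \xi) \ge 0, \qquad C_1 |\xi|^p \le \xi \cdot A(x,s,\xi), \qquad |A(x,s,\xi)| \le C_2 |\xi|^{p-1}$$ for almost all $x \in \mathbb{R}^n$ and all $s \in \mathbb{R}$, $\zeta, \xi \in \mathbb{R}^n$. Let $F : [0,\infty) \to [0,\infty)$ be a non-increasing function such that $$\int_0^\infty r^{n(p-1)/p} F(r)\,dr < \infty.$$ Then the equation $-\operatorname{div} A(x,u,\nabla u) = F(|x|)$ in $\mathbb{R}^n$ has a solution $u$ satisfying $\operatorname*{ess\,inf}_{\mathbb{R}^n} u = 0$.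
   Context: A Carathéodory function $A$ is one such that $x \mapsto A(x,s,\xi)$ is measurable for all $(s,\xi)$ and $(s,\xi)\mapsto A(x,s,\xi)$ is continuous for almost all $x$. For $g \in L_{1,loc}(\mathbb{R}^n)$, a solution of $-\operatorname{div} A(x,u,\nabla u) = g(x)$ in $\mathbb{R}^n$ is a function $u \in W^1_{p,loc}(\mathbb{R}^n)$ such that $$\int_{\mathbb{R}^n} A(x,u,\nabla u)\cdot\nabla\varphi\,dx = \int_{\mathbb{R}^n} g(x)\varphi\,dx$$ for all $\varphi \in C_0^\infty(\mathbb{R}^n)$. *)

theory Defs
  imports "HOL-Analysis.Analysis"
begin

definition partial_deriv :: "'n::finite \<Rightarrow> (real^'n \<Rightarrow> real) \<Rightarrow> real^'n \<Rightarrow> real" where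
  "partial_deriv i f x = frechet_derivative f (at x) (axis i 1)"

definition grad :: "(real^'n::finite \<Rightarrow> real) \<Rightarrow> real^'n \<Rightarrow> real^'n" where
  "grad f x = (\<chi> i. partial_deriv i f x)"

fun Ck :: "nat \<Rightarrow> (real^'n::finite \<Rightarrow> real) \<Rightarrow> bool" where
  "Ck 0 f = continuous_on UNIV f"
| "Ck (Suc k) f = ((\<forall>x. f differentiable (at x)) \<and> continuous_on UNIV f \<and>
                    (\<forall>i. Ck k (partial_deriv i f)))"

definition smooth_fun :: "(real^'n::finite \<Rightarrow> real) \<Rightarrow> bool" where
  "smooth_fun f = (\<forall>k. Ck k f)"

definition test_fun :: "(real^'n::finite \<Rightarrow> real) \<Rightarrow> bool" where
  "test_fun \<phi> = (smooth_fun \<phi> \<and> compact (closure {x. \<phi> x \<noteq> 0}))"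

definition Lp_loc :: "real \<Rightarrow> (real^'n::finite \<Rightarrow> real) \<Rightarrow> bool" where
  "Lp_loc p u = (u \<in> borel_measurable lebesgue \<and>
     (\<forall>K. compact K \<longrightarrow> (\<integral>\<^sup>+x\<in>K. ennreal (\<bar>u x\<bar> powr p) \<partial>lebesgue) < \<infinity>))"

definition Lp_loc_vec :: "real \<Rightarrow> (real^'n::finite \<Rightarrow> real^'n) \<Rightarrow> bool" where
  "Lp_loc_vec p G = (G \<in> borel_measurable lebesgue \<and>
     (\<forall>K. compact K \<longrightarrow> (\<integral>\<^sup>+x\<in>K. ennreal (norm (G x) powr p) \<partial>lebesgue) < \<infinity>))"

definition weak_gradient :: "(real^'n::finite \<Rightarrow> real) \<Rightarrow> (real^'n \<Rightarrow> real^'n) \<Rightarrow> bool" where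
  "weak_gradient u G = (\<forall>\<phi>. test_fun \<phi> \<longrightarrow> (\<forall>i.
      integrable lebesgue (\<lambda>x. u x * partial_deriv i \<phi> x) \<and>
      integrable lebesgue (\<lambda>x. G x $ i * \<phi> x) \<and>
      (\<integral>x. u x * partial_deriv i \<phi> x \<partial>lebesgue) = - (\<integral>x. G x $ i * \<phi> x \<partial>lebesgue)))"

definition W1p_loc_grad :: "real \<Rightarrow> (real^'n::finite \<Rightarrow> real) \<Rightarrow> (real^'n \<Rightarrow> real^'n) \<Rightarrow> bool" where
  "W1p_loc_grad p u G = (Lp_loc p u \<and> Lp_loc_vec p G \<and> weak_gradient u G)"

definition caratheodory :: "(real^'n::finite \<Rightarrow> real \<Rightarrow> real^'n \<Rightarrow> real^'n) \<Rightarrow> bool" where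
  "caratheodory A = ((\<forall>s \<xi>. (\<lambda>x. A x s \<xi>) \<in> borel_measurable lebesgue) \<and>
     (AE x in lebesgue. continuous_on UNIV (\<lambda>(s, \<xi>). A x s \<xi>)))"

definition is_solution :: "real \<Rightarrow> (real^'n::finite \<Rightarrow> real \<Rightarrow> real^'n \<Rightarrow> real^'n) \<Rightarrow>
    (real^'n \<Rightarrow> real) \<Rightarrow> (real^'n \<Rightarrow> real) \<Rightarrow> bool" where
  "is_solution p A g u = (\<exists>G. W1p_loc_grad p u G \<and>
     (\<forall>\<phi>. test_fun \<phi> \<longrightarrow>
        integrable lebesgue (\<lambda>x. A x (u x) (G x) \<bullet> grad \<phi> x) \<and>
        integrable lebesgue (\<lambda>x. g x * \<phi> x) \<and>
        (\<integral>x. A x (u x) (G x) \<bullet> grad \<phi> x \<partial>lebesgue) = (\<integral>x. g x * \<phi> x \<partial>lebesgue)))"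

definition ess_inf :: "(real^'n::finite \<Rightarrow> real) \<Rightarrow> ereal" where
  "ess_inf u = Sup {z. AE x in lebesgue. z \<le> ereal (u x)}"

end

theory Submission
  imports Defs "HOL-Library.Diagonal_Subsequence"
begin

text \<open>
  The data satisfy \<open>\<bar>x\<bar> F(\<bar>x\<bar>) \<in> L\<^sup>q\<close> with \<open>1/p + 1/q = 1\<close>, so Hardy's inequality makes \<open>F(\<bar>x\<bar>)\<close> a bounded functional
  for the energy \<open>\<integral>\<bar>\<nabla>u\<bar>\<^sup>p\<close>. Galerkin solutions \<open>v\<^sub>m\<close> over a countable dense family of test functions
  exist by Kuhn's lemma and have bounded energy; a multiple \<open>\<epsilon>c\<close> of the coefficient vector is added so that linear
  independence of the family plays no role. Along a subsequence \<open>v\<^sub>m \<rightarrow> u\<close> almost everywhere. No weak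
  compactness is used: midpoint combinations of the tails of \<open>v\<^sub>m\<close> have gradients that converge strongly in
  \<open>L\<^sup>p\<close> to some \<open>G = \<nabla>u\<close>. Since \<open>\<integral>A(x,v\<^sub>m,\<nabla>v\<^sub>m)\<cdot>\<nabla>w\<close> converges for each fixed test
  function \<open>w\<close>, Minty's argument identifies the equation for \<open>u\<close>. Testing with a smooth negative part gives
  \<open>u \<ge> 0\<close>, and Hardy's inequality on large balls excludes \<open>u \<ge> c > 0\<close> because \<open>p < n\<close>.
\<close>

section \<open>Functions with integrable powers\<close>

text \<open>The function \<open>u\<close> need not be \<open>p\<close>-integrable over the whole
  space; only its gradient is. So the argument runs without a normed function space for
  \<open>u\<close>: every approximation is a test function measured by its gradient energy, and
  Hardy's inequality turns gradient bounds into local bounds. The dependence of \<open>A\<close> on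
  \<open>s\<close> is handled through almost everywhere convergence, hence a compactness theorem for
  functions. The dependence on the gradient is monotone, possibly not strictly, so the gradients of
  the Galerkin solutions need not converge at all. Two sequences therefore run in parallel:
  \<open>v\<close>, which satisfies the approximate equation, and its midpoint combinations
  \<open>w\<close>, whose gradients converge but which satisfy no equation. Minty's inequality is
  the bridge, since after freezing both arguments of the flux it is affine in the function.
  Nonlinear functions of \<open>u\<close> are also tested through \<open>w\<close>, because
  composing a test function with \<open>eta\<close> gives a test function again.\<close>

definition Lp :: "real \<Rightarrow> 'a measure \<Rightarrow> ('a \<Rightarrow> 'b::euclidean_space) \<Rightarrow> bool" where
  "Lp p M f \<longleftrightarrow> f \<in> borel_measurable M \<and> integrable M (\<lambda>x. norm (f x) powr p)"

text \<open>The \<open>p\<close>-th power of the norm is kept without taking the root, because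
  integrals of convexity defects are then combinations of such numbers. The price is a factor
  \<open>2 powr p\<close> in place of the triangle inequality.\<close>

definition pint :: "real \<Rightarrow> 'a measure \<Rightarrow> ('a \<Rightarrow> 'b::euclidean_space) \<Rightarrow> real" where
  "pint p M f = (\<integral>x. norm (f x) powr p \<partial>M)"

lemma LpD: "Lp p M f \<Longrightarrow> f \<in> borel_measurable M" "Lp p M f \<Longrightarrow> integrable M (\<lambda>x. norm (f x) powr p)"
  by (auto simp: Lp_def)

lemma pint_nonneg [simp]: "pint p M f \<ge> 0"
  by (auto simp: pint_def intro!: integral_nonneg_AE)

lemma Lp_bound:
  assumes "Lp p M f" "g \<in> borel_measurable M" "AE x in M. norm (g x) \<le> norm (f x)" "p \<ge> 0"
  shows "Lp p M g" "pint p M g \<le> pint p M f"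
proof -
  have *: "AE x in M. norm (g x) powr p \<le> norm (f x) powr p"
    using assms(3) by eventually_elim (auto intro!: powr_mono2 assms)
  show L: "Lp p M g"
    unfolding Lp_def
  proof (intro conjI)
    show "integrable M (\<lambda>x. norm (g x) powr p)"
      by (rule Bochner_Integration.integrable_bound[OF LpD(2)[OF assms(1)]])
         (use * assms(2) in \<open>auto\<close>)
  qed fact
  show "pint p M g \<le> pint p M f"
    unfolding pint_def by (rule integral_mono_AE) (use * L assms(1) in \<open>auto simp: Lp_def\<close>)
qed

lemma norm_add_powr_le:
  fixes a b :: "'b::real_normed_vector"
  assumes "p \<ge> 0"
  shows "norm (a + b) powr p \<le> 2 powr p * (norm a powr p + norm b powr p)"
proof -
  have "norm (a + b) \<le> 2 * max (norm a) (norm b)"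
    using norm_triangle_ineq[of a b] by linarith
  then have "norm (a + b) powr p \<le> (2 * max (norm a) (norm b)) powr p"
    using assms by (intro powr_mono2) auto
  also have "\<dots> = 2 powr p * (max (norm a) (norm b) powr p)"
    by (subst powr_mult) auto
  also have "max (norm a) (norm b) powr p \<le> norm a powr p + norm b powr p"
    by (auto simp: max_def)
  finally show ?thesis by simp
qed

lemma Lp_add:
  assumes "Lp p M f" "Lp p M g" "p \<ge> 0"
  shows "Lp p M (\<lambda>x. f x + g x)" "pint p M (\<lambda>x. f x + g x) \<le> 2 powr p * (pint p M f + pint p M g)"
proof -
  note [measurable] = LpD(1)[OF assms(1)] LpD(1)[OF assms(2)]
  have i: "integrable M (\<lambda>x. 2 powr p * (norm (f x) powr p + norm (g x) powr p))"
    using assms by (auto simp: Lp_def)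
  show L: "Lp p M (\<lambda>x. f x + g x)"
    unfolding Lp_def
    by (intro conjI Bochner_Integration.integrable_bound[OF i])
       (use assms in \<open>auto intro!: always_eventually norm_add_powr_le\<close>)
  have "pint p M (\<lambda>x. f x + g x) \<le> (\<integral>x. 2 powr p * (norm (f x) powr p + norm (g x) powr p) \<partial>M)"
    unfolding pint_def by (rule integral_mono) (use L i norm_add_powr_le assms in \<open>auto simp: Lp_def\<close>)
  also have "\<dots> = 2 powr p * (pint p M f + pint p M g)"
    using assms by (simp add: pint_def Lp_def)
  finally show "pint p M (\<lambda>x. f x + g x) \<le> 2 powr p * (pint p M f + pint p M g)" .
qed

lemma Lp_scale:
  assumes "Lp p M f"
  shows "Lp p M (\<lambda>x. c *\<^sub>R f x)" "pint p M (\<lambda>x. c *\<^sub>R f x) = \<bar>c\<bar> powr p * pint p M f"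
  using assms by (auto simp: Lp_def pint_def powr_mult)

lemma Lp_uminus:
  assumes "Lp p M f"
  shows "Lp p M (\<lambda>x. - f x)" "pint p M (\<lambda>x. - f x) = pint p M f"
  using assms by (auto simp: Lp_def pint_def)

lemma Lp_diff:
  assumes "Lp p M f" "Lp p M g" "p \<ge> 0"
  shows "Lp p M (\<lambda>x. f x - g x)" "pint p M (\<lambda>x. f x - g x) \<le> 2 powr p * (pint p M f + pint p M g)"
  using Lp_add[OF assms(1) Lp_uminus(1)[OF assms(2)] assms(3)] Lp_uminus(2)[OF assms(2)] by auto

section \<open>Hoelder's inequality\<close>

lemma holder_real:
  fixes a b :: "'a \<Rightarrow> real"
  assumes pq: "p > 1" "q > 1" "1/p + 1/q = 1"
    and m[measurable]: "a \<in> borel_measurable M" "b \<in> borel_measurable M"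
    and nn: "\<And>x. a x \<ge> 0" "\<And>x. b x \<ge> 0"
    and i: "integrable M (\<lambda>x. a x powr p)" "integrable M (\<lambda>x. b x powr q)"
  shows "integrable M (\<lambda>x. a x * b x)"
    "(\<integral>x. a x * b x \<partial>M) \<le> (\<integral>x. a x powr p \<partial>M) powr (1/p) * (\<integral>x. b x powr q \<partial>M) powr (1/q)"
proof -
  have Y: "a x * b x \<le> a x powr p / p + b x powr q / q" for x
    by (rule Youngs_inequality) (use pq nn in auto)
  show int: "integrable M (\<lambda>x. a x * b x)"
    by (rule Bochner_Integration.integrable_bound[of _ "\<lambda>x. a x powr p / p + b x powr q / q"])
       (use i Y nn pq in \<open>auto simp: abs_mult intro!: always_eventually order.trans[OF Y]\<close>)
  define S where "S = (\<integral>x. a x powr p \<partial>M)"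
  define T where "T = (\<integral>x. b x powr q \<partial>M)"
  have S0: "S \<ge> 0" "T \<ge> 0" by (auto simp: S_def T_def)
  consider "S = 0" | "T = 0" | "S > 0" "T > 0" using S0 by linarith
  then show "(\<integral>x. a x * b x \<partial>M) \<le> (\<integral>x. a x powr p \<partial>M) powr (1/p) * (\<integral>x. b x powr q \<partial>M) powr (1/q)"
  proof cases
    case 1
    then have "AE x in M. a x powr p = 0"
      unfolding S_def using i by (subst (asm) integral_nonneg_eq_0_iff_AE) auto
    then have "AE x in M. a x * b x = 0" by eventually_elim auto
    then have "(\<integral>x. a x * b x \<partial>M) = 0"
      by (subst integral_cong_AE[of _ _ "\<lambda>_. 0"]) auto
    then show ?thesis by (simp)
  next
    case 2
    then have "AE x in M. b x powr q = 0"
      unfolding T_def using i by (subst (asm) integral_nonneg_eq_0_iff_AE) auto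
    then have "AE x in M. a x * b x = 0" by eventually_elim auto
    then have "(\<integral>x. a x * b x \<partial>M) = 0"
      by (subst integral_cong_AE[of _ _ "\<lambda>_. 0"]) auto
    then show ?thesis by (simp)
  next
    case 3
    \<comment> \<open>With \<open>s\<close> and \<open>t\<close> the two norms, Young's inequality
      for the normalised functions integrates to exactly \<open>1/p + 1/q = 1\<close>. The two
      preceding cases keep these divisors positive.\<close>
    define s where "s = S powr (1/p)"
    define t where "t = T powr (1/q)"
    have st: "s > 0" "t > 0" "s powr p = S" "t powr q = T"
      using 3 pq by (auto simp: s_def t_def powr_powr)
    have "(a x / s) * (b x / t) \<le> (a x / s) powr p / p + (b x / t) powr q / q" for x
      by (rule Youngs_inequality) (use pq nn st in auto)
    then have "a x * b x / (s * t) \<le> a x powr p / (S * p) + b x powr q / (T * q)" for x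
      using nn st by (simp add: powr_divide)
    then have "(\<integral>x. a x * b x / (s * t) \<partial>M) \<le> (\<integral>x. a x powr p / (S * p) + b x powr q / (T * q) \<partial>M)"
      by (intro integral_mono) (use int i in auto)
    also have "\<dots> = 1"
      using i 3 pq by (simp add: S_def[symmetric] T_def[symmetric])
    finally have "(\<integral>x. a x * b x \<partial>M) \<le> s * t"
      using st by (simp add: field_simps)
    then show ?thesis by (simp add: s_def t_def S_def T_def)
  qed
qed

lemma holder_inner:
  fixes f g :: "'a \<Rightarrow> 'b::euclidean_space"
  assumes pq: "p > 1" "q > 1" "1/p + 1/q = 1" and L: "Lp p M f" "Lp q M g"
  shows "integrable M (\<lambda>x. f x \<bullet> g x)"
    "integrable M (\<lambda>x. norm (f x) * norm (g x))"
    "\<bar>\<integral>x. f x \<bullet> g x \<partial>M\<bar> \<le> pint p M f powr (1/p) * pint q M g powr (1/q)"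
    "(\<integral>x. norm (f x) * norm (g x) \<partial>M) \<le> pint p M f powr (1/p) * pint q M g powr (1/q)"
proof -
  note [measurable] = LpD(1)[OF L(1)] LpD(1)[OF L(2)]
  have H: "integrable M (\<lambda>x. norm (f x) * norm (g x))"
    "(\<integral>x. norm (f x) * norm (g x) \<partial>M) \<le> pint p M f powr (1/p) * pint q M g powr (1/q)"
    using holder_real[OF pq, of "\<lambda>x. norm (f x)" M "\<lambda>x. norm (g x)"] LpD(2)[OF L(1)] LpD(2)[OF L(2)]
    by (auto simp: pint_def)
  show "integrable M (\<lambda>x. norm (f x) * norm (g x))" 
    "(\<integral>x. norm (f x) * norm (g x) \<partial>M) \<le> pint p M f powr (1/p) * pint q M g powr (1/q)" by fact+
  show i: "integrable M (\<lambda>x. f x \<bullet> g x)"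
    by (rule Bochner_Integration.integrable_bound[OF H(1)]) (auto simp: Cauchy_Schwarz_ineq2 intro!: always_eventually)
  have "\<bar>\<integral>x. f x \<bullet> g x \<partial>M\<bar> \<le> (\<integral>x. \<bar>f x \<bullet> g x\<bar> \<partial>M)"
    by (rule integral_abs_bound)
  also have "\<dots> \<le> (\<integral>x. norm (f x) * norm (g x) \<partial>M)"
    by (rule integral_mono) (use i H Cauchy_Schwarz_ineq2 in auto)
  finally show "\<bar>\<integral>x. f x \<bullet> g x \<partial>M\<bar> \<le> pint p M f powr (1/p) * pint q M g powr (1/q)"
    using H by linarith
qed

lemma holder_tendsto:
  fixes f :: "'a \<Rightarrow> 'b::euclidean_space"
  assumes pq: "p > 1" "q > 1" "1/p + 1/q = 1" and L: "Lp p M f" "\<And>k. Lp p M (F k)" "Lp q M g"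
    and lim: "(\<lambda>k. pint p M (\<lambda>x. F k x - f x)) \<longlonglongrightarrow> 0"
  shows "(\<lambda>k. \<integral>x. F k x \<bullet> g x \<partial>M) \<longlonglongrightarrow> (\<integral>x. f x \<bullet> g x \<partial>M)"
proof -
  have "(\<lambda>k. pint p M (\<lambda>x. F k x - f x) powr (1/p) * pint q M g powr (1/q)) \<longlonglongrightarrow> 0 powr (1/p) * pint q M g powr (1/q)"
    by (intro tendsto_mult tendsto_powr2 lim tendsto_const) (use pq in auto)
  then have lim0: "(\<lambda>k. pint p M (\<lambda>x. F k x - f x) powr (1/p) * pint q M g powr (1/q)) \<longlonglongrightarrow> 0"
    using pq by simp
  have "norm ((\<integral>x. F k x \<bullet> g x \<partial>M) - (\<integral>x. f x \<bullet> g x \<partial>M))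
     \<le> pint p M (\<lambda>x. F k x - f x) powr (1/p) * pint q M g powr (1/q)" for k
  proof -
    have "(\<integral>x. F k x \<bullet> g x \<partial>M) - (\<integral>x. f x \<bullet> g x \<partial>M) = (\<integral>x. (F k x - f x) \<bullet> g x \<partial>M)"
      using holder_inner(1)[OF pq L(2) L(3)] holder_inner(1)[OF pq L(1) L(3)]
      by (simp add: inner_diff_left)
    then show ?thesis
      using holder_inner(3)[OF pq Lp_diff(1)[OF L(2) L(1)] L(3)] pq by simp
  qed
  then have "(\<lambda>k. (\<integral>x. F k x \<bullet> g x \<partial>M) - (\<integral>x. f x \<bullet> g x \<partial>M)) \<longlonglongrightarrow> 0"
    by (intro Lim_null_comparison[OF always_eventually lim0] allI)
  then show ?thesis by (rule LIM_zero_cancel)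
qed

text \<open>A telescoping series in which the \<open>k\<close>-th increment is controlled only on
  \<open>B k\<close>. This is enough because a point lies in all but finitely many
  \<open>B k\<close>, so only finitely many increments at it escape control; the sum of the
  controlled ones has finite integral and is finite almost everywhere.\<close>

lemma AE_convergent_of_fast:
  fixes g :: "nat \<Rightarrow> 'a \<Rightarrow> 'b::euclidean_space"
  assumes m[measurable]: "\<And>k. g k \<in> borel_measurable M" "\<And>k. B k \<in> sets M"
    and ev: "\<And>x. x \<in> space M \<Longrightarrow> \<forall>\<^sub>F k in sequentially. x \<in> B k"
    and fast: "\<And>k. (\<integral>\<^sup>+x\<in>B k. ennreal (norm (g (Suc k) x - g k x)) \<partial>M) \<le> ennreal ((1/2)^k)"
  shows "AE x in M. convergent (\<lambda>k. g k x)"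
proof -
  have "(\<integral>\<^sup>+x. (\<Sum>k. ennreal (norm (g (Suc k) x - g k x)) * indicator (B k) x) \<partial>M)
      = (\<Sum>k. \<integral>\<^sup>+x\<in>B k. ennreal (norm (g (Suc k) x - g k x)) \<partial>M)"
    by (rule nn_integral_suminf) measurable
  also have "\<dots> \<le> (\<Sum>k. ennreal ((1/2)^k))"
    by (intro suminf_le fast) auto
  also have "\<dots> = ennreal (\<Sum>k. (1/2)^k)"
    by (rule suminf_ennreal2) (auto intro!: summable_geometric)
  also have "\<dots> < \<infinity>" by simp
  finally have "AE x in M. (\<Sum>k. ennreal (norm (g (Suc k) x - g k x)) * indicator (B k) x) \<noteq> \<infinity>"
    by (intro nn_integral_PInf_AE) auto
  then show ?thesis using AE_space
  proof eventually_elim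
    case (elim x)
    have eq: "ennreal (norm (g (Suc k) x - g k x)) * indicator (B k) x = ennreal (norm (g (Suc k) x - g k x) * indicat_real (B k) x)" for k
      by (auto split: split_indicator)
    from elim have "summable (\<lambda>k. norm (g (Suc k) x - g k x) * indicat_real (B k) x)"
      unfolding eq by (intro summable_suminf_not_top) auto
    moreover have "\<forall>\<^sub>F k in sequentially. norm (g (Suc k) x - g k x) * indicat_real (B k) x = norm (g (Suc k) x - g k x)"
      using ev[OF elim(2)] by eventually_elim auto
    ultimately have "summable (\<lambda>k. norm (g (Suc k) x - g k x))"
      by (subst (asm) summable_cong) auto
    then have "summable (\<lambda>k. g (Suc k) x - g k x)"
      by (rule summable_norm_cancel)
    then have "convergent (\<lambda>n. \<Sum>k<n. g (Suc k) x - g k x)"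
      by (simp add: summable_iff_convergent)
    then have "convergent (\<lambda>n. g n x - g 0 x)"
      by (subst (asm) sum_lessThan_telescope)
    from convergent_add[OF this convergent_const[of "g 0 x"]] show ?case by simp
  qed
qed

lemma AE_convergent_subseq_of_L1_loc_Cauchy:
  fixes g :: "nat \<Rightarrow> 'a \<Rightarrow> 'b::euclidean_space"
  assumes m: "\<And>k. g k \<in> borel_measurable M" "\<And>k. B k \<in> sets M"
    and ev: "\<And>x. x \<in> space M \<Longrightarrow> \<forall>\<^sub>F k in sequentially. x \<in> B k"
    and cau: "\<And>k e. e > 0 \<Longrightarrow> \<exists>N. \<forall>m\<ge>N. \<forall>l\<ge>N. (\<integral>\<^sup>+x\<in>B k. ennreal (norm (g m x - g l x)) \<partial>M) \<le> ennreal e"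
  obtains r where "strict_mono r" "AE x in M. convergent (\<lambda>k. g (r k) x)"
proof -
  have "\<exists>N. \<forall>m\<ge>N. \<forall>l\<ge>N. (\<integral>\<^sup>+x\<in>B k. ennreal (norm (g m x - g l x)) \<partial>M) \<le> ennreal ((1/2)^k)" for k
    by (rule cau) auto
  then obtain N where N: "\<And>k m l. m \<ge> N k \<Longrightarrow> l \<ge> N k \<Longrightarrow> (\<integral>\<^sup>+x\<in>B k. ennreal (norm (g m x - g l x)) \<partial>M) \<le> ennreal ((1/2)^k)"
    by metis
  \<comment> \<open>The sum dominates every single \<open>N k\<close>, and the added
    \<open>k\<close> makes the sequence strictly increasing even where \<open>N\<close>
    vanishes.\<close>
  define r where "r k = (\<Sum>i\<le>k. N i) + k" for k
  have r: "strict_mono r" by (rule strict_monoI_Suc) (auto simp: r_def)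
  have rN: "r k \<ge> N k" for k
    unfolding r_def by (rule trans_le_add1) (rule member_le_sum, auto)
  have "r (Suc k) \<ge> N k" for k using rN[of k] r by (meson lessI less_imp_le order.trans strict_mono_less)
  with rN have "AE x in M. convergent (\<lambda>k. g (r k) x)"
    by (intro AE_convergent_of_fast[of "\<lambda>k. g (r k)" M B] m ev N) auto
  with r that show ?thesis by blast
qed

lemma Lp_local_L1:
  fixes f :: "'a \<Rightarrow> 'b::euclidean_space"
  assumes p: "p > 1" "q > 1" "1/p + 1/q = 1" and L: "Lp p M f" and B: "B \<in> sets M" "emeasure M B < \<infinity>"
  shows "(\<integral>\<^sup>+x\<in>B. ennreal (norm (f x)) \<partial>M) \<le> ennreal (pint p M f powr (1/p) * measure M B powr (1/q))"
proof -
  note [measurable] = LpD(1)[OF L] B(1)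
  have ib: "integrable M (indicat_real B)" using B by auto
  have eq: "indicat_real B x powr q = indicat_real B x" for x by (auto split: split_indicator)
  note H = holder_real[OF p, of "\<lambda>x. norm (f x)" M "indicat_real B"]
  have "(\<integral>\<^sup>+x\<in>B. ennreal (norm (f x)) \<partial>M) = (\<integral>\<^sup>+x. ennreal (norm (f x) * indicat_real B x) \<partial>M)"
    by (intro nn_integral_cong) (auto split: split_indicator)
  also have "\<dots> = ennreal (\<integral>x. norm (f x) * indicat_real B x \<partial>M)"
    by (rule nn_integral_eq_integral) (use H ib eq LpD(2)[OF L] in auto)
  also have "\<dots> \<le> ennreal (pint p M f powr (1/p) * measure M B powr (1/q))"
    using H ib eq LpD(2)[OF L] B by (intro ennreal_leI) (auto simp: pint_def)
  finally show ?thesis .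
qed

text \<open>Fatou's lemma. The bound is asked only eventually, so that Cauchy estimates valid beyond
  some index pass to the limit directly.\<close>

lemma pint_fatou:
  fixes f :: "'a \<Rightarrow> 'b::euclidean_space"
  assumes L: "\<And>k. Lp p M (F k)" and m: "f \<in> borel_measurable M" and p: "p > 0"
    and lim: "AE x in M. (\<lambda>k. F k x) \<longlonglongrightarrow> f x" and ev: "\<forall>\<^sub>F k in sequentially. pint p M (F k) \<le> C"
  shows "Lp p M f" "pint p M f \<le> C"
proof -
  note [measurable] = LpD(1)[OF L] m
  have C: "C \<ge> 0" using ev by (metis (no_types, lifting) eventually_sequentially order.trans order_refl pint_nonneg)
  have "(\<integral>\<^sup>+x. ennreal (norm (f x) powr p) \<partial>M) = (\<integral>\<^sup>+x. liminf (\<lambda>k. ennreal (norm (F k x) powr p)) \<partial>M)"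
  proof (intro nn_integral_cong_AE, use lim in eventually_elim)
    case (elim x)
    have "(\<lambda>k. ennreal (norm (F k x) powr p)) \<longlonglongrightarrow> ennreal (norm (f x) powr p)"
      by (intro tendsto_ennrealI tendsto_powr2 tendsto_norm elim tendsto_const) (use p in auto)
    from lim_imp_Liminf[OF _ this] show ?case by simp
  qed
  also have "\<dots> \<le> liminf (\<lambda>k. \<integral>\<^sup>+x. ennreal (norm (F k x) powr p) \<partial>M)"
    by (rule nn_integral_liminf) measurable
  also have "\<dots> = liminf (\<lambda>k. ennreal (pint p M (F k)))"
    unfolding pint_def using LpD(2)[OF L] by (subst nn_integral_eq_integral) auto
  also have "\<dots> \<le> limsup (\<lambda>k. ennreal (pint p M (F k)))" by (rule Liminf_le_Limsup) auto
  also have "\<dots> \<le> ennreal C"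
    by (rule Limsup_bounded) (use ev in eventually_elim, auto intro: ennreal_leI)
  finally have le: "(\<integral>\<^sup>+x. ennreal (norm (f x) powr p) \<partial>M) \<le> ennreal C" .
  then show L: "Lp p M f"
    unfolding Lp_def by (intro conjI m integrableI_bounded) (auto intro: le_less_trans)
  have "ennreal (pint p M f) \<le> ennreal C"
    using le unfolding pint_def by (subst nn_integral_eq_integral[symmetric]) (use LpD(2)[OF L] in auto)
  then show "pint p M f \<le> C" using C by simp
qed

text \<open>Riesz-Fischer. Hoelder's inequality makes the sequence Cauchy in \<open>L^1\<close> on
  every ball, which yields an almost everywhere convergent subsequence; Fatou's lemma applied to
  \<open>f m x - f (r k) x\<close> as \<open>k\<close> grows then bounds the distance of the whole
  sequence to that limit.\<close>

lemma Lp_complete: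
  fixes f :: "nat \<Rightarrow> 'a::euclidean_space \<Rightarrow> 'b::euclidean_space"
  assumes p: "p > 1" and L: "\<And>k. Lp p lebesgue (f k)"
    and cau: "\<And>e. e > 0 \<Longrightarrow> \<exists>N. \<forall>m\<ge>N. \<forall>l\<ge>N. pint p lebesgue (\<lambda>x. f m x - f l x) \<le> e"
  obtains g r where "Lp p lebesgue g" "(\<lambda>k. pint p lebesgue (\<lambda>x. f k x - g x)) \<longlonglongrightarrow> 0"
    "strict_mono (r::nat\<Rightarrow>nat)" "AE x in lebesgue. (\<lambda>k. f (r k) x) \<longlonglongrightarrow> g x"
proof -
  let ?M = "lebesgue :: 'a measure"
  define q where "q = p / (p - 1)"
  have pq: "p > 1" "q > 1" "1/p + 1/q = 1" using p by (auto simp: q_def field_simps)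
  define B where "B k = cball (0::'a) (real k)" for k
  have Bfin: "emeasure ?M (B k) < \<infinity>" for k
    using emeasure_bounded_finite[OF bounded_cball[of 0 "real k"]] by (simp add: B_def)
  have Bev: "\<forall>\<^sub>F k in sequentially. x \<in> B k" for x
  proof -
    obtain n where "norm x \<le> real n" using real_arch_simple by blast
    then show ?thesis
      unfolding B_def eventually_sequentially by (intro exI[of _ n]) (auto intro: order.trans)
  qed
  note Ld = Lp_diff(1)[OF L L, of _ _ ] 
  obtain r where r: "strict_mono r" "AE x in ?M. convergent (\<lambda>k. f (r k) x)"
  proof (rule AE_convergent_subseq_of_L1_loc_Cauchy[of f ?M B])
    show "f k \<in> borel_measurable ?M" "B k \<in> sets ?M" for k
      using LpD(1)[OF L] by (auto simp: B_def)
    show "\<forall>\<^sub>F k in sequentially. x \<in> B k" for x by (rule Bev)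
    show "\<exists>N. \<forall>m\<ge>N. \<forall>l\<ge>N. (\<integral>\<^sup>+x\<in>B k. ennreal (norm (f m x - f l x)) \<partial>?M) \<le> ennreal e" if "e > 0" for k e
    proof -
      \<comment> \<open>The summand 1 keeps the divisor positive: the ball of radius 0 has measure
        0.\<close>
      define c where "c = measure ?M (B k) powr (1/q) + 1"
      have c: "c > 0" by (auto simp: c_def add_nonneg_pos)
      have "e / c > 0" using that c by simp
      then have "(e/c) powr p > 0" by (intro powr_gt_zero[THEN iffD2]) linarith
      from cau[OF this] obtain N where N: "\<forall>m\<ge>N. \<forall>l\<ge>N. pint p ?M (\<lambda>x. f m x - f l x) \<le> (e/c) powr p" ..
      have "(\<integral>\<^sup>+x\<in>B k. ennreal (norm (f m x - f l x)) \<partial>?M) \<le> ennreal e" if ml: "m \<ge> N" "l \<ge> N" for m l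
      proof -
        have "(\<integral>\<^sup>+x\<in>B k. ennreal (norm (f m x - f l x)) \<partial>?M) \<le> ennreal (pint p ?M (\<lambda>x. f m x - f l x) powr (1/p) * measure ?M (B k) powr (1/q))"
          by (rule Lp_local_L1[OF pq Lp_diff(1)[OF L L] _ Bfin]) (use p in \<open>simp_all add: B_def\<close>)
        also have "\<dots> \<le> ennreal (((e/c) powr p) powr (1/p) * c)"
        proof (rule ennreal_leI)
          have "pint p ?M (\<lambda>x. f m x - f l x) powr (1/p) \<le> ((e/c) powr p) powr (1/p)"
            by (rule powr_mono2) (use N ml p in simp_all)
          then show "pint p ?M (\<lambda>x. f m x - f l x) powr (1/p) * measure ?M (B k) powr (1/q) \<le> ((e/c) powr p) powr (1/p) * c"
            by (rule mult_mono) (simp_all add: c_def)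
        qed
        also have "((e/c) powr p) powr (1/p) * c = e"
          using \<open>e > 0\<close> c p by (simp add: powr_powr)
        finally show ?thesis .
      qed
      then show ?thesis by blast
    qed
  qed
  define g where "g x = lim (\<lambda>k. f (r k) x)" for x
  have gm: "g \<in> borel_measurable ?M"
    unfolding g_def by (rule borel_measurable_lim_metric) (use LpD(1)[OF L] in auto)
  have glim: "AE x in ?M. (\<lambda>k. f (r k) x) \<longlonglongrightarrow> g x"
    using r(2) unfolding g_def by eventually_elim (simp add: convergent_LIMSEQ_iff)
  have key: "Lp p ?M (\<lambda>x. f m x - g x) \<and> pint p ?M (\<lambda>x. f m x - g x) \<le> e"
    if N: "\<forall>m\<ge>N. \<forall>l\<ge>N. pint p ?M (\<lambda>x. f m x - f l x) \<le> e" and m: "m \<ge> N" for N m e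
  proof -
    have ev: "\<forall>\<^sub>F k in sequentially. pint p ?M (\<lambda>x. f m x - f (r k) x) \<le> e"
      using eventually_ge_at_top[of N]
    proof eventually_elim
      case (elim k)
      have "r k \<ge> N" using elim seq_suble[OF r(1), of k] by linarith
      with N m show ?case by simp
    qed
    have lim: "AE x in ?M. (\<lambda>k. f m x - f (r k) x) \<longlonglongrightarrow> f m x - g x"
      using glim by eventually_elim (intro tendsto_intros)
    show ?thesis
      using pint_fatou[of p ?M "\<lambda>k x. f m x - f (r k) x", OF Lp_diff(1)[OF L L] borel_measurable_diff[OF LpD(1)[OF L] gm] _ lim ev] p by simp
  qed
  from cau[OF zero_less_one] obtain N where N: "\<forall>m\<ge>N. \<forall>l\<ge>N. pint p ?M (\<lambda>x. f m x - f l x) \<le> 1" ..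
  have "Lp p ?M (\<lambda>x. f N x - (f N x - g x))"
    by (rule Lp_diff(1)[OF L conjunct1[OF key[OF N order_refl]]]) (use p in simp)
  then have Lg: "Lp p ?M g" by simp
  have "(\<lambda>k. pint p ?M (\<lambda>x. f k x - g x)) \<longlonglongrightarrow> 0"
  proof (rule LIMSEQ_I)
    fix e :: real assume "e > 0"
    from cau[OF half_gt_zero[OF this]] obtain N where N: "\<forall>m\<ge>N. \<forall>l\<ge>N. pint p ?M (\<lambda>x. f m x - f l x) \<le> e/2" ..
    have "norm (pint p ?M (\<lambda>x. f n x - g x) - 0) < e" if "n \<ge> N" for n
      using conjunct2[OF key[OF N that]] \<open>e > 0\<close> by simp
    then show "\<exists>N. \<forall>n\<ge>N. norm (pint p ?M (\<lambda>x. f n x - g x) - 0) < e" by (intro exI[of _ N] allI impI)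
  qed
  from that[OF Lg this r(1) glim] show ?thesis .
qed

section \<open>Strong convergence from uniform convexity\<close>

text \<open>The mean value theorem on the two halves of the interval gives increments with slopes
  \<open>p * z powr (p - 1)\<close>, and these are strictly larger on the right half because
  \<open>p > 1\<close>. Only continuity is used at the left end, so \<open>s = 0\<close> is
  allowed.\<close>

lemma powr_midpoint_less:
  fixes s t p :: real
  assumes "p > 1" "0 \<le> s" "s < t"
  shows "((s + t) / 2) powr p < (s powr p + t powr p) / 2"
proof -
  define m where "m = (s + t) / 2"
  have m: "s < m" "m < t" using assms by (auto simp: m_def)
  have D: "((\<lambda>x. x powr p) has_real_derivative p * x powr (p - 1)) (at x)" if "x > 0" for x
    using that by (auto intro!: derivative_eq_intros)
  have C: "continuous_on {a..b} (\<lambda>x. x powr p)" if "0 \<le> a" for a b :: real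
    using that assms by (intro continuous_on_powr' continuous_intros) auto
  have mv: "\<exists>z. a < z \<and> z < b \<and> b powr p - a powr p = (b - a) * (p * z powr (p - 1))" if "0 \<le> a" "a < b" for a b
  proof (rule mvt[OF that(2) C[OF that(1)]])
    show "((\<lambda>x. x powr p) has_derivative (\<lambda>h. h * (p * x powr (p - 1)))) (at x)" if "a < x" "x < b" for x
      using D[of x] that \<open>0 \<le> a\<close> by (simp add: has_field_derivative_def mult.commute[of _ "p * x powr (p - 1)"])
  qed blast
  obtain z where z: "s < z" "z < m" "m powr p - s powr p = (m - s) * (p * z powr (p - 1))"
    using mv[OF assms(2) m(1)] by blast
  have "0 \<le> m" using assms m by linarith
  then obtain y where y: "m < y" "y < t" "t powr p - m powr p = (t - m) * (p * y powr (p - 1))"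
    using mv[of m t] m by blast
  have "z powr (p - 1) < y powr (p - 1)"
    using z y assms by (intro powr_less_mono2) auto
  moreover have eq: "t - m = m - s" by (simp add: m_def field_simps)
  ultimately have "(m - s) * (p * z powr (p - 1)) < (t - m) * (p * y powr (p - 1))"
    unfolding eq using m assms by (intro mult_strict_left_mono) auto
  then show ?thesis using z(3) y(3) unfolding m_def[symmetric] by (simp add: field_simps)
qed

lemma powr_midpoint_le:
  fixes s t p :: real
  assumes "p > 1" "0 \<le> s" "0 \<le> t"
  shows "((s + t) / 2) powr p \<le> (s powr p + t powr p) / 2"
  using powr_midpoint_less[OF assms(1,2), of t] powr_midpoint_less[OF assms(1,3), of s]
  by (cases s t rule: linorder_cases) (auto simp: add.commute)

text \<open>The convexity defect of the \<open>p\<close>-th power of the norm at a midpoint.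
  Integrated, it is the energy lost by averaging two functions; it takes the place of Clarkson's
  inequalities.\<close>

definition midgap :: "real \<Rightarrow> 'b::euclidean_space \<Rightarrow> 'b \<Rightarrow> real" where
  "midgap p a b = (norm a powr p + norm b powr p) / 2 - norm ((1/2) *\<^sub>R (a + b)) powr p"

lemma norm_mid_le: "norm ((1/2) *\<^sub>R (a + b)) \<le> (norm a + norm b) / 2"
  using norm_triangle_ineq[of a b] by simp

lemma midgap_nonneg:
  assumes "p > 1" shows "midgap p a b \<ge> 0"
proof -
  have "norm ((1/2) *\<^sub>R (a + b)) powr p \<le> ((norm a + norm b) / 2) powr p"
    by (rule powr_mono2) (use assms norm_mid_le[of a b] in auto)
  also have "\<dots> \<le> (norm a powr p + norm b powr p) / 2"
    using powr_midpoint_le[OF assms] by auto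
  finally show ?thesis by (simp add: midgap_def)
qed

text \<open>A vanishing defect forces equality twice: strict convexity of the scalar power makes the
  norms equal, and equality in the triangle inequality then makes the vectors parallel.\<close>

lemma midgap_pos:
  assumes p: "p > 1" and ab: "a \<noteq> b" shows "midgap p a b > 0"
proof (rule ccontr)
  assume "\<not> ?thesis"
  then have 0: "midgap p a b = 0" using midgap_nonneg[OF p, of a b] by linarith
  have 1: "norm ((1/2) *\<^sub>R (a + b)) powr p \<le> ((norm a + norm b) / 2) powr p"
    by (rule powr_mono2) (use assms norm_mid_le[of a b] in auto)
  have eq: "norm a = norm b"
  proof (rule ccontr)
    assume "norm a \<noteq> norm b"
    then have "((norm a + norm b) / 2) powr p < (norm a powr p + norm b powr p) / 2"
      using powr_midpoint_less[OF p, of "norm a" "norm b"] powr_midpoint_less[OF p, of "norm b" "norm a"]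
      by (cases "norm a < norm b") (auto simp: add.commute)
    with 0 1 show False by (simp add: midgap_def)
  qed
  have "norm ((1/2) *\<^sub>R (a + b)) powr p = norm b powr p"
    using 0 eq by (simp add: midgap_def)
  then have "norm ((1/2) *\<^sub>R (a + b)) = norm b"
    using powr_less_mono2[of p "norm b" "norm ((1/2) *\<^sub>R (a + b))"] powr_less_mono2[of p "norm ((1/2) *\<^sub>R (a + b))" "norm b"] p
    by (cases "norm ((1/2) *\<^sub>R (a + b))" "norm b" rule: linorder_cases) simp_all
  then have "norm (a + b) = norm a + norm b" using eq by simp
  then have "norm a *\<^sub>R b = norm b *\<^sub>R a" by (simp add: norm_triangle_eq)
  then have "norm b = 0 \<or> a = b" using eq by auto
  with eq ab show False by auto
qed

text \<open>A compactness argument on normalised pairs, the same for all \<open>p > 1\<close>. The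
  error term with \<open>e\<close> is the price of covering small exponents: for
  \<open>p < 2\<close> and \<open>a\<close> close to \<open>b \<noteq> 0\<close> the defect is of
  second order in \<open>a - b\<close>, much smaller than
  \<open>norm (a - b) powr p\<close>.\<close>

lemma midgap_uniform:
  fixes p e :: real
  assumes p: "p > 1" and e: "e > 0"
  obtains C where "C \<ge> 0" "\<And>a b :: 'b::euclidean_space. norm (a - b) powr p \<le> e * (norm a powr p + norm b powr p) + C * midgap p a b"
proof -
  define h where "h z = midgap p (fst z) (snd z)" for z :: "'b \<times> 'b"
  define N where "N z = norm (fst z) powr p + norm (snd z) powr p" for z :: "'b \<times> 'b"
  \<comment> \<open>Both sides of the claim are homogeneous of degree \<open>p\<close>, so the sum
    of the powers may be normalised to 1. Pairs with \<open>norm (a - b) powr p < e\<close> satisfy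
    the claim through the \<open>e\<close> term alone; the remaining ones form a compact set away
    from the diagonal.\<close>
  define S where "S = {z :: 'b \<times> 'b. N z = 1 \<and> e \<le> norm (fst z - snd z) powr p}"
  have ch: "continuous_on UNIV h"
    unfolding h_def midgap_def using p by (intro continuous_intros continuous_on_powr') auto
  have cN: "continuous_on UNIV N"
    unfolding N_def using p by (intro continuous_intros continuous_on_powr') auto
  have cD: "continuous_on UNIV (\<lambda>z::'b \<times> 'b. norm (fst z - snd z) powr p)"
    using p by (intro continuous_intros continuous_on_powr') auto
  have "closed S"
    unfolding S_def by (intro closed_Collect_conj closed_Collect_eq closed_Collect_le cN cD continuous_intros)
  moreover have "bounded S"
  proof (rule bounded_subset[OF bounded_Times[OF bounded_cball bounded_cball]])
    show "S \<subseteq> cball 0 1 \<times> cball 0 1"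
    proof safe
      fix a b assume ab: "(a, b) \<in> S"
      then have s: "norm a powr p + norm b powr p = 1" by (simp add: S_def N_def)
      have 1: "norm c \<le> 1" if "norm c powr p \<le> 1" for c :: 'b
      proof (rule ccontr)
        assume "\<not> norm c \<le> 1"
        then have "1 powr p < norm c powr p" using p by (intro powr_less_mono2) auto
        with that show False by simp
      qed
      have "norm a powr p \<le> 1" "norm b powr p \<le> 1"
        using s powr_ge_zero[of "norm a" p] powr_ge_zero[of "norm b" p] by linarith+
      then show "a \<in> cball 0 1" "b \<in> cball 0 1" using 1 by auto
    qed
  qed
  ultimately have cS: "compact S" by (simp add: compact_eq_bounded_closed)
  have pos: "h z > 0" if "z \<in> S" for z
  proof -
    have "fst z \<noteq> snd z" using that e by (auto simp: S_def)
    then show ?thesis unfolding h_def by (rule midgap_pos[OF p])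
  qed
  have "\<exists>d>0. \<forall>z\<in>S. d \<le> h z"
  proof (cases "S = {}")
    case False
    then obtain z0 where "z0 \<in> S" "\<forall>z\<in>S. h z0 \<le> h z"
      using continuous_attains_inf[OF cS _ continuous_on_subset[OF ch]] by auto
    then show ?thesis using pos by blast
  qed (auto intro: exI[of _ 1])
  then obtain d where d: "d > 0" "\<And>z. z \<in> S \<Longrightarrow> d \<le> h z" by blast
  \<comment> \<open>On normalised pairs \<open>norm (a - b) powr p\<close> is at most
    \<open>2 powr p\<close>, and on \<open>S\<close> the defect is at least
    \<open>d\<close>.\<close>
  define C where "C = 2 powr p / d"
  have C0: "C \<ge> 0" using d by (simp add: C_def)
  have norm1: "norm (a - b) powr p \<le> e + C * midgap p a b" if s: "norm a powr p + norm b powr p = 1" for a b :: 'b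
  proof (cases "e \<le> norm (a - b) powr p")
    case False
    then show ?thesis using C0 midgap_nonneg[OF p, of a b] by (simp add: add_increasing2)
  next
    case True
    then have "(a, b) \<in> S" using s by (simp add: S_def N_def)
    from d(2)[OF this] have dh: "d \<le> midgap p a b" by (simp add: h_def)
    have "norm (a - b) powr p \<le> 2 powr p"
      using norm_add_powr_le[of p a "-b"] p s by simp
    also have "\<dots> = C * d" using d by (simp add: C_def)
    also have "\<dots> \<le> C * midgap p a b" by (rule mult_left_mono[OF dh C0])
    finally show ?thesis using e by linarith
  qed
  have "norm (a - b) powr p \<le> e * (norm a powr p + norm b powr p) + C * midgap p a b" for a b :: 'b
  proof (cases "norm a powr p + norm b powr p = 0")
    case True
    then have "norm a powr p = 0" "norm b powr p = 0"
      using powr_ge_zero[of "norm a" p] powr_ge_zero[of "norm b" p] by linarith+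
    then show ?thesis using C0 midgap_nonneg[OF p, of a b] by simp
  next
    case False
    define T where "T = norm a powr p + norm b powr p"
    have T: "T > 0" using False powr_ge_zero[of "norm a" p] powr_ge_zero[of "norm b" p] unfolding T_def by linarith
    \<comment> \<open>The factor that rescales the pair to sum of powers 1.\<close>
    define l where "l = T powr (-1/p)"
    have l: "l > 0" using T by (simp add: l_def)
    have "l powr p = T powr (-1/p * p)" by (simp only: l_def powr_powr)
    also have "\<dots> = 1 / T" using T p by (simp add: powr_minus_divide)
    finally have lp: "l powr p = 1 / T" .
    have sc: "norm (l *\<^sub>R c) powr p = norm c powr p / T" for c :: 'b
      using l lp by (simp add: powr_mult)
    have mg: "midgap p (l *\<^sub>R a) (l *\<^sub>R b) = midgap p a b / T"
    proof -
      have eq: "(1/2) *\<^sub>R (l *\<^sub>R a + l *\<^sub>R b) = l *\<^sub>R ((1/2) *\<^sub>R (a + b))" by (simp add: algebra_simps)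
      have "midgap p (l *\<^sub>R a) (l *\<^sub>R b) = (norm a powr p / T + norm b powr p / T) / 2 - norm ((1/2) *\<^sub>R (a + b)) powr p / T"
        by (simp only: midgap_def eq sc)
      also have "\<dots> = midgap p a b / T"
        unfolding midgap_def diff_divide_distrib add_divide_distrib by simp
      finally show ?thesis .
    qed
    have "norm (l *\<^sub>R a) powr p + norm (l *\<^sub>R b) powr p = 1"
      unfolding sc using T by (simp add: T_def[symmetric] add_divide_distrib[symmetric])
    from norm1[OF this] have "norm (l *\<^sub>R (a - b)) powr p \<le> e + C * (midgap p a b / T)"
      by (simp only: mg scaleR_diff_right)
    then have "norm (a - b) powr p / T \<le> e + C * (midgap p a b / T)" by (simp only: sc)
    then have "norm (a - b) powr p \<le> (e + C * (midgap p a b / T)) * T"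
      using T by (simp add: pos_divide_le_eq)
    also have "\<dots> = e * T + C * midgap p a b" using T by (simp add: field_simps)
    finally show ?thesis by (simp add: T_def)
  qed
  with C0 that show ?thesis by blast
qed

text \<open>
  Choosing almost minimisers of the \<open>p\<close>-energy over a decreasing chain of midpoint-convex sets
  gives strong convergence directly, which replaces weak compactness of \<open>L\<^sup>p\<close>.
\<close>

lemma Lp_Cauchy_of_midpoint_convex:
  fixes K :: "nat \<Rightarrow> ('a \<Rightarrow> 'b::euclidean_space) set"
  assumes p: "p > 1"
    and dec: "\<And>k l. k \<le> l \<Longrightarrow> K l \<subseteq> K k" and ne: "\<And>k. K k \<noteq> {}"
    and mid: "\<And>k f g. f \<in> K k \<Longrightarrow> g \<in> K k \<Longrightarrow> (\<lambda>x. (1/2) *\<^sub>R (f x + g x)) \<in> K k"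
    and L: "\<And>k f. f \<in> K k \<Longrightarrow> Lp p M f" and B: "\<And>k f. f \<in> K k \<Longrightarrow> pint p M f \<le> B"
  obtains f where "\<And>k. f k \<in> K k"
    "\<And>e. e > 0 \<Longrightarrow> \<exists>N. \<forall>m\<ge>N. \<forall>l\<ge>N. pint p M (\<lambda>x. f m x - f l x) \<le> e"
proof -
  \<comment> \<open>The infimal energies increase along the decreasing chain and stay below
    \<open>B\<close>, hence converge. This forces almost minimisers of different sets
    \<open>K k\<close> to be close.\<close>
  define d where "d k = Inf (pint p M ` K k)" for k
  have bb: "bdd_below (pint p M ` K k)" for k
    by (rule bdd_belowI[of _ 0]) auto
  have dle: "d k \<le> pint p M f" if "f \<in> K k" for k f
    unfolding d_def using that by (intro cInf_lower bb) auto
  have B0: "B \<ge> 0"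
    using ne[of 0] B[of _ 0] pint_nonneg[of p M] by (metis all_not_in_conv order.trans)
  have dmono: "incseq d"
    unfolding incseq_def d_def using ne by (intro allI impI cInf_superset_mono image_mono dec bb) auto
  have dB: "d k \<le> B" for k
    using ne[of k] dle[of _ k] B[of _ k] by (metis all_not_in_conv order.trans)
  obtain D where D: "d \<longlonglongrightarrow> D" "\<And>k. d k \<le> D"
    using incseq_convergent[OF dmono, of B] dB by metis
  have "\<exists>f\<in>K k. pint p M f < d k + 1 / (real k + 1)" for k
  proof -
    have "\<exists>y\<in>pint p M ` K k. y < d k + 1 / (real k + 1)"
      by (rule cInf_lessD) (use ne in \<open>auto simp: d_def[symmetric]\<close>)
    then show ?thesis by auto
  qed
  then obtain f where f: "\<And>k. f k \<in> K k" "\<And>k. pint p M (f k) < d k + 1 / (real k + 1)" by metis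
  have "\<exists>N. \<forall>m\<ge>N. \<forall>l\<ge>N. pint p M (\<lambda>x. f m x - f l x) \<le> e" if e: "e > 0" for e
  proof -
    \<comment> \<open>Chosen so that two energies, together at most \<open>2 * (B + 1)\<close>,
      contribute at most \<open>e / 2\<close> through the \<open>e1\<close> term.\<close>
    define e1 where "e1 = e / (4 * (B + 1))"
    have e1: "e1 > 0" using e B0 by (simp add: e1_def)
    obtain C where C: "C \<ge> 0" "\<And>a b :: 'b. norm (a - b) powr p \<le> e1 * (norm a powr p + norm b powr p) + C * midgap p a b"
      using midgap_uniform[OF p e1] by blast
    have "(\<lambda>N. C * (D + 1 / (real N + 1) - d N)) \<longlonglongrightarrow> C * (D + 0 - D)"
      by (intro tendsto_intros D LIMSEQ_inverse_real_of_nat[unfolded inverse_eq_divide of_nat_Suc add.commute[of 1]])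
    then have "(\<lambda>N. C * (D + 1 / (real N + 1) - d N)) \<longlonglongrightarrow> 0" by simp
    then have "\<forall>\<^sub>F N in sequentially. C * (D + 1 / (real N + 1) - d N) < e / 2"
      using e by (intro order_tendstoD(2)[where a = "e/2"]) auto
    then obtain N where N: "C * (D + 1 / (real N + 1) - d N) < e / 2"
      by (auto simp: eventually_sequentially)
    have "pint p M (\<lambda>x. f m x - f l x) \<le> e" if ml: "m \<ge> N" "l \<ge> N" for m l
    proof -
      define g where "g x = (1/2) *\<^sub>R (f m x + f l x)" for x
      have K: "f m \<in> K N" "f l \<in> K N" using f(1) dec ml by blast+
      \<comment> \<open>The decisive use of midpoint convexity: the average still belongs to
        \<open>K N\<close>, so its energy is at least \<open>d N\<close>, while the energies of
        \<open>f m\<close> and \<open>f l\<close> exceed \<open>D\<close> by at most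
        \<open>1 / (real N + 1)\<close>. The integrated defect is thus dominated by a null
        sequence.\<close>
      have gK: "g \<in> K N" unfolding g_def by (rule mid[OF K])
      note Lg = L[OF gK] and Lm = L[OF K(1)] and Ll = L[OF K(2)]
      have ub: "pint p M (f j) \<le> D + 1 / (real N + 1)" if "j \<ge> N" for j
      proof -
        have "1 / (real j + 1) \<le> 1 / (real N + 1)" using that by (simp add: frac_le)
        then show ?thesis using f(2)[of j] D(2)[of j] by linarith
      qed
      have i: "integrable M (\<lambda>x. midgap p (f m x) (f l x))"
        unfolding midgap_def g_def[symmetric] using LpD(2)[OF Lm] LpD(2)[OF Ll] LpD(2)[OF Lg] by simp
      have gap: "(\<integral>x. midgap p (f m x) (f l x) \<partial>M) = (pint p M (f m) + pint p M (f l)) / 2 - pint p M g"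
        unfolding midgap_def g_def[symmetric] pint_def using LpD(2)[OF Lm] LpD(2)[OF Ll] LpD(2)[OF Lg] by simp
      have "pint p M (\<lambda>x. f m x - f l x) \<le> (\<integral>x. e1 * (norm (f m x) powr p + norm (f l x) powr p) + C * midgap p (f m x) (f l x) \<partial>M)"
        unfolding pint_def
        by (rule integral_mono) (use LpD(2)[OF Lm] LpD(2)[OF Ll] LpD(2)[OF Lp_diff(1)[OF Lm Ll]] i p C(2) in simp_all)
      also have "\<dots> = e1 * (pint p M (f m) + pint p M (f l)) + C * ((pint p M (f m) + pint p M (f l)) / 2 - pint p M g)"
        using i LpD(2)[OF Lm] LpD(2)[OF Ll] by (simp add: gap pint_def)
      also have "\<dots> \<le> e1 * (2 * (B + 1)) + C * (D + 1 / (real N + 1) - d N)"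
      proof (intro add_mono mult_left_mono)
        show "pint p M (f m) + pint p M (f l) \<le> 2 * (B + 1)"
          using B[OF K(1)] B[OF K(2)] by simp
        show "(pint p M (f m) + pint p M (f l)) / 2 - pint p M g \<le> D + 1 / (real N + 1) - d N"
        proof -
          have *: "(a + b) / 2 - c \<le> X - y" if "a \<le> X" "b \<le> X" "y \<le> c" for a b c X y :: real
            using that by argo
          show ?thesis by (rule *[OF ub[OF ml(1)] ub[OF ml(2)] dle[OF gK]])
        qed
        show "0 \<le> e1" using e1 by simp
        show "0 \<le> C" by (rule C(1))
      qed
      also have "e1 * (2 * (B + 1)) = e / 2" using B0 by (simp add: e1_def field_simps)
      finally show ?thesis using N by argo
    qed
    then show ?thesis by (intro exI[of _ N] allI impI)
  qed
  from that[OF f(1) this] show ?thesis .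
qed

section \<open>Zeros of coercive vector fields\<close>

lemma diagonal_convergent_subseq:
  fixes X :: "nat \<Rightarrow> nat \<Rightarrow> real"
  assumes bd: "\<And>i. \<exists>B. \<forall>k. \<bar>X k i\<bar> \<le> B"
  obtains r where "strict_mono r" "\<And>i. convergent (\<lambda>k. X (r k) i)"
proof -
  interpret subseqs "\<lambda>i s. convergent (\<lambda>k. X (s k) i)"
  proof
    fix n and s :: "nat \<Rightarrow> nat" assume "strict_mono s"
    obtain B where "\<forall>k. \<bar>X k n\<bar> \<le> B" using bd by blast
    then have "bounded (range (\<lambda>k. X (s k) n))" by (auto simp: bounded_iff)
    then obtain l r' where "strict_mono r'" "((\<lambda>k. X (s k) n) \<circ> r') \<longlonglongrightarrow> l"
      using bounded_imp_convergent_subsequence by blast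
    then show "\<exists>r'. strict_mono r' \<and> convergent (\<lambda>k. X ((s \<circ> r') k) n)"
      by (intro exI[of _ r']) (auto simp: o_def convergent_def)
  qed
  have "convergent (\<lambda>k. X (diagseq k) i)" for i
  proof -
    \<comment> \<open>The diagonal sequence is a subsequence of the \<open>i\<close>-th extracted
      one only from index \<open>Suc i\<close> on, so convergence is first shown for the shifted
      sequence.\<close>
    have "convergent (\<lambda>k. X ((diagseq \<circ> (+) (Suc i)) k) i)"
    proof (rule diagseq_holds)
      fix r s :: "nat \<Rightarrow> nat" and n assume "strict_mono r" "convergent (\<lambda>k. X (s k) n)"
      from convergent_subseq_convergent[OF this(2,1)]
      show "convergent (\<lambda>k. X ((s \<circ> r) k) n)" by (simp add: o_def)
    qed
    then have "convergent (\<lambda>k. X (diagseq (k + Suc i)) i)" by (simp add: o_def add.commute)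
    then show ?thesis using convergent_ignore_initial_segment[of "\<lambda>k. X (diagseq k) i" "Suc i"] by simp
  qed
  with subseq_diagseq that show ?thesis by blast
qed

text \<open>
  The dimension \<open>m\<close> has to be a number here, not a type, so the fixed point theorems
  of the library do not apply and the lemma is derived from Kuhn's lemma.
\<close>

lemma zero_of_coercive_field:
  fixes P :: "(nat \<Rightarrow> real) \<Rightarrow> nat \<Rightarrow> real" and R :: real
  assumes R: "R > 0"
    and cont: "\<And>X c i. (\<And>i. i < m \<Longrightarrow> (\<lambda>k. X k i) \<longlonglongrightarrow> c i) \<Longrightarrow> (\<And>k i. i < m \<Longrightarrow> \<bar>X k i\<bar> \<le> R) \<Longrightarrow>
       i < m \<Longrightarrow> (\<lambda>k. P (X k) i) \<longlonglongrightarrow> P c i"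
    and coer: "\<And>c i. (\<And>i. i < m \<Longrightarrow> \<bar>c i\<bar> \<le> R) \<Longrightarrow> i < m \<Longrightarrow> \<bar>c i\<bar> = R \<Longrightarrow> 0 < (\<Sum>i<m. P c i * c i)"
  obtains c where "\<And>i. i < m \<Longrightarrow> \<bar>c i\<bar> \<le> R" "\<And>i. i < m \<Longrightarrow> P c i = 0"
proof -
  define pt where "pt N x i = - R + 2 * R * (real (x i) / real N)" for N :: nat and x :: "nat \<Rightarrow> nat" and i :: nat
  \<comment> \<open>The label records the sign of the \<open>i\<close>-th component at a grid point
    of the cube. On two opposite faces it is prescribed, as Kuhn's lemma demands; hence label 0
    tells that the component is negative only off the face \<open>x i = 0\<close>, and label 1 that
    it is nonnegative only off the face \<open>x i = N\<close>.\<close>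
  define lab where "lab N x i = (if x i = 0 then 0 else if x i = N then 1 else if P (pt N x) i < 0 then 0 else (1::nat))"
    for N :: nat and x :: "nat \<Rightarrow> nat" and i :: nat
  have "\<exists>q r s. \<forall>i<m. q i < Suc N \<and> (\<forall>j<m. q j \<le> r i j \<and> r i j \<le> q j + 1) \<and> (\<forall>j<m. q j \<le> s i j \<and> s i j \<le> q j + 1) \<and>
      lab (Suc N) (r i) i = 0 \<and> lab (Suc N) (s i) i = 1" for N
  proof -
    have l1: "\<forall>x. (\<forall>i<m. x i \<le> Suc N) \<longrightarrow> (\<forall>i<m. lab (Suc N) x i = 0 \<or> lab (Suc N) x i = 1)"
      and l2: "\<forall>x. (\<forall>i<m. x i \<le> Suc N) \<longrightarrow> (\<forall>i<m. x i = 0 \<longrightarrow> lab (Suc N) x i = 0)"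
      and l3: "\<forall>x. (\<forall>i<m. x i \<le> Suc N) \<longrightarrow> (\<forall>i<m. x i = Suc N \<longrightarrow> lab (Suc N) x i = 1)"
      by (simp_all add: lab_def)
    obtain q where q: "\<forall>i<m. q i < Suc N"
      "\<forall>i<m. \<exists>r s. (\<forall>j<m. q j \<le> r j \<and> r j \<le> q j + 1) \<and> (\<forall>j<m. q j \<le> s j \<and> s j \<le> q j + 1) \<and> lab (Suc N) r i \<noteq> lab (Suc N) s i"
      by (rule kuhn_lemma[OF zero_less_Suc l1 l2 l3])
    have "\<exists>r s. (\<forall>j<m. q j \<le> r j \<and> r j \<le> q j + 1) \<and> (\<forall>j<m. q j \<le> s j \<and> s j \<le> q j + 1) \<and>
        lab (Suc N) r i = 0 \<and> lab (Suc N) s i = 1" if "i < m" for i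
    proof -
      from q(2)[THEN spec, THEN mp, OF that] obtain r where
        "\<exists>s. (\<forall>j<m. q j \<le> r j \<and> r j \<le> q j + 1) \<and> (\<forall>j<m. q j \<le> s j \<and> s j \<le> q j + 1) \<and> lab (Suc N) r i \<noteq> lab (Suc N) s i" ..
      then obtain s where
        rs0: "(\<forall>j<m. q j \<le> r j \<and> r j \<le> q j + 1) \<and> (\<forall>j<m. q j \<le> s j \<and> s j \<le> q j + 1) \<and> lab (Suc N) r i \<noteq> lab (Suc N) s i" ..
      note rs = rs0[THEN conjunct1] rs0[THEN conjunct2, THEN conjunct1] rs0[THEN conjunct2, THEN conjunct2]
      have "lab (Suc N) x i = 0 \<or> lab (Suc N) x i = 1" for x by (simp add: lab_def)
      then consider "lab (Suc N) r i = 0" "lab (Suc N) s i = 1" | "lab (Suc N) s i = 0" "lab (Suc N) r i = 1"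
        using rs(3) by metis
      then show ?thesis
      proof cases
        case 1
        then show ?thesis using rs(1,2) by (intro exI[of _ r] exI[of _ s] conjI)
      next
        case 2
        then show ?thesis using rs(1,2) by (intro exI[of _ s] exI[of _ r] conjI)
      qed
    qed
    then have "\<forall>i. \<exists>r s. i < m \<longrightarrow> (\<forall>j<m. q j \<le> r j \<and> r j \<le> q j + 1) \<and> (\<forall>j<m. q j \<le> s j \<and> s j \<le> q j + 1) \<and>
        lab (Suc N) r i = 0 \<and> lab (Suc N) s i = 1" by simp
    from choice[OF this] obtain r where "\<forall>i. \<exists>s. i < m \<longrightarrow> (\<forall>j<m. q j \<le> r i j \<and> r i j \<le> q j + 1) \<and> (\<forall>j<m. q j \<le> s j \<and> s j \<le> q j + 1) \<and>
        lab (Suc N) (r i) i = 0 \<and> lab (Suc N) s i = 1" ..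
    from choice[OF this] obtain s where "\<forall>i. i < m \<longrightarrow> (\<forall>j<m. q j \<le> r i j \<and> r i j \<le> q j + 1) \<and> (\<forall>j<m. q j \<le> s i j \<and> s i j \<le> q j + 1) \<and>
        lab (Suc N) (r i) i = 0 \<and> lab (Suc N) (s i) i = 1" ..
    with q(1) show ?thesis by (intro exI[of _ q] exI[of _ r] exI[of _ s]) simp
  qed
  then have "\<forall>N. \<exists>q r s. \<forall>i<m. q i < Suc N \<and> (\<forall>j<m. q j \<le> r i j \<and> r i j \<le> q j + 1) \<and> (\<forall>j<m. q j \<le> s i j \<and> s i j \<le> q j + 1) \<and>
      lab (Suc N) (r i) i = 0 \<and> lab (Suc N) (s i) i = 1" ..
  from choice[OF this] obtain q where "\<forall>N. \<exists>r s. \<forall>i<m. q N i < Suc N \<and> (\<forall>j<m. q N j \<le> r i j \<and> r i j \<le> q N j + 1) \<and> (\<forall>j<m. q N j \<le> s i j \<and> s i j \<le> q N j + 1) \<and>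
      lab (Suc N) (r i) i = 0 \<and> lab (Suc N) (s i) i = 1" ..
  from choice[OF this] obtain r where "\<forall>N. \<exists>s. \<forall>i<m. q N i < Suc N \<and> (\<forall>j<m. q N j \<le> r N i j \<and> r N i j \<le> q N j + 1) \<and> (\<forall>j<m. q N j \<le> s i j \<and> s i j \<le> q N j + 1) \<and>
      lab (Suc N) (r N i) i = 0 \<and> lab (Suc N) (s i) i = 1" ..
  from choice[OF this] obtain s where qrs0: "\<forall>N. \<forall>i<m. q N i < Suc N \<and> (\<forall>j<m. q N j \<le> r N i j \<and> r N i j \<le> q N j + 1) \<and> (\<forall>j<m. q N j \<le> s N i j \<and> s N i j \<le> q N j + 1) \<and>
      lab (Suc N) (r N i) i = 0 \<and> lab (Suc N) (s N i) i = 1" ..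
  have qrs: "q N i < Suc N \<and> (\<forall>j<m. q N j \<le> r N i j \<and> r N i j \<le> q N j + 1) \<and> (\<forall>j<m. q N j \<le> s N i j \<and> s N i j \<le> q N j + 1) \<and>
      lab (Suc N) (r N i) i = 0 \<and> lab (Suc N) (s N i) i = 1" if "i < m" for N i
    using qrs0 that by simp
  \<comment> \<open>Components from \<open>m\<close> on are set to 0 because the diagonal argument
    asks for bounds on all components.\<close>
  define Y where "Y N i = (if i < m then pt (Suc N) (q N) i else 0)" for N i
  have ptb: "\<bar>pt (Suc N) x i\<bar> \<le> R" if "x i \<le> Suc N" for N x i
  proof -
    define v where "v = real (x i) / real (Suc N)"
    have v: "0 \<le> v" "v \<le> 1" using that by (simp_all add: v_def divide_le_eq del: of_nat_Suc)
    have "R * v \<le> R * 1" "0 \<le> R * v" using mult_left_mono[OF v(2), of R] R v by simp_all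
    then show ?thesis unfolding pt_def v_def[symmetric] abs_le_iff mult.assoc[of 2 R v] by linarith
  qed
  have "\<exists>B. \<forall>N. \<bar>Y N i\<bar> \<le> B" for i
  proof (intro exI allI)
    show "\<bar>Y N i\<bar> \<le> R" for N
      unfolding Y_def using ptb[of "q N" i N] qrs[of i N] R by auto
  qed
  from diagonal_convergent_subseq[of Y, OF this] obtain \<sigma> where \<sigma>: "strict_mono \<sigma>" "\<And>i. convergent (\<lambda>k. Y (\<sigma> k) i)" by blast
  define c where "c i = lim (\<lambda>k. Y (\<sigma> k) i)" for i
  have Yc: "(\<lambda>k. Y (\<sigma> k) i) \<longlonglongrightarrow> c i" for i
    unfolding c_def using \<sigma>(2) by (simp add: convergent_LIMSEQ_iff)
  have N0: "(\<lambda>k. 2 * R / real (Suc (\<sigma> k))) \<longlonglongrightarrow> 0"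
  proof -
    have "(\<lambda>N. 2 * R * inverse (real (Suc N))) \<longlonglongrightarrow> 2 * R * 0"
      by (intro tendsto_intros LIMSEQ_inverse_real_of_nat)
    from LIMSEQ_subseq_LIMSEQ[OF this \<sigma>(1)] show ?thesis by (simp add: o_def divide_inverse)
  qed
  have near: "(\<lambda>k. pt (Suc (\<sigma> k)) (t (\<sigma> k)) j) \<longlonglongrightarrow> c j"
    if t: "\<And>N. q N j \<le> t N j \<and> t N j \<le> q N j + 1" and j: "j < m" for t j
  proof -
    have *: "norm (pt (Suc (\<sigma> k)) (t (\<sigma> k)) j - Y (\<sigma> k) j) \<le> 2 * R / real (Suc (\<sigma> k))" for k
    proof -
      define u where "u = real (t (\<sigma> k) j) - real (q (\<sigma> k) j)"
      have "\<bar>u\<bar> \<le> 1" using t[of "\<sigma> k"] unfolding u_def by linarith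
      then have "2 * R * \<bar>u\<bar> \<le> 2 * R * 1" using R by (intro mult_left_mono) auto
      then have 1: "2 * R * \<bar>u\<bar> / real (Suc (\<sigma> k)) \<le> 2 * R / real (Suc (\<sigma> k))"
        by (intro divide_right_mono) simp_all
      have eq: "pt (Suc (\<sigma> k)) (t (\<sigma> k)) j - Y (\<sigma> k) j = 2 * R * u / real (Suc (\<sigma> k))"
        using j unfolding Y_def pt_def u_def by (simp add: right_diff_distrib diff_divide_distrib del: of_nat_Suc)
      have 2: "norm (2 * R * u / real (Suc (\<sigma> k))) = 2 * R * \<bar>u\<bar> / real (Suc (\<sigma> k))"
        by (simp only: real_norm_def abs_divide abs_mult abs_numeral abs_of_pos[OF R] abs_of_nat)
      show ?thesis unfolding eq 2 by (rule 1)
    qed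
    have "(\<lambda>k. pt (Suc (\<sigma> k)) (t (\<sigma> k)) j - Y (\<sigma> k) j) \<longlonglongrightarrow> 0"
      by (rule Lim_null_comparison[OF _ N0], rule always_eventually, rule allI, rule *)
    from tendsto_add[OF this Yc[of j]] show ?thesis by simp
  qed
  have cR: "\<bar>c i\<bar> \<le> R" if "i < m" for i
  proof (rule tendsto_upperbound[OF tendsto_rabs[OF Yc]])
    show "\<forall>\<^sub>F k in sequentially. \<bar>Y (\<sigma> k) i\<bar> \<le> R"
      using ptb[of "q (\<sigma> _)" i "\<sigma> _"] qrs[of i "\<sigma> _"] that by (intro always_eventually allI) (simp add: Y_def less_imp_le)
  qed simp
  have Plim: "(\<lambda>k. P (pt (Suc (\<sigma> k)) (t (\<sigma> k))) i) \<longlonglongrightarrow> P c i"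
    if t: "\<And>N j. j < m \<Longrightarrow> q N j \<le> t N j \<and> t N j \<le> q N j + 1" and i: "i < m" for t i
  proof (rule cont[OF _ _ i])
    show "(\<lambda>k. pt (Suc (\<sigma> k)) (t (\<sigma> k)) j) \<longlonglongrightarrow> c j" if "j < m" for j
      by (rule near[where t = t and j = j, OF t that], rule that)
    show "\<bar>pt (Suc (\<sigma> k)) (t (\<sigma> k)) j\<bar> \<le> R" if "j < m" for k j
      by (rule ptb) (use t[OF that, of "\<sigma> k"] qrs[OF that, of "\<sigma> k"] in linarith)
  qed
  \<comment> \<open>Vertices labelled 0 have a negative component unless they lie on the lower face,
    and they leave that face eventually if the limit does not lie on it. Label 1 and the upper face
    are treated in the mirror image. Together they give \<open>P c i * c i \<le> 0\<close> for every
    component, which coercivity permits only strictly inside the cube, where both signs force a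
    zero.\<close>
  have up: "P c i \<le> 0" if i: "i < m" and ci: "c i > - R" for i
  proof -
    have rt: "q N j \<le> r N i j \<and> r N i j \<le> q N j + 1" if "j < m" for N j using qrs[OF i] that by blast
    have "\<forall>\<^sub>F k in sequentially. pt (Suc (\<sigma> k)) (r (\<sigma> k) i) i > - R"
      by (rule order_tendstoD(1)[OF near[where t = "\<lambda>N. r N i" and j = i, OF rt[OF i] i] ci])
    then have "\<forall>\<^sub>F k in sequentially. P (pt (Suc (\<sigma> k)) (r (\<sigma> k) i)) i \<le> 0"
    proof eventually_elim
      case (elim k)
      have "r (\<sigma> k) i i \<noteq> 0"
      proof
        assume "r (\<sigma> k) i i = 0"
        with elim show False by (simp add: pt_def)
      qed
      moreover have "lab (Suc (\<sigma> k)) (r (\<sigma> k) i) i = 0" using qrs[OF i, of "\<sigma> k"] by blast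
      ultimately show ?case by (simp add: lab_def split: if_splits)
    qed
    moreover have "(\<lambda>k. P (pt (Suc (\<sigma> k)) (r (\<sigma> k) i)) i) \<longlonglongrightarrow> P c i"
      by (rule Plim[where t = "\<lambda>N. r N i" and i = i], rule rt, assumption, rule i)
    ultimately show ?thesis by (intro tendsto_upperbound[where F = sequentially]) simp_all
  qed
  have lo: "P c i \<ge> 0" if i: "i < m" and ci: "c i < R" for i
  proof -
    have rt: "q N j \<le> s N i j \<and> s N i j \<le> q N j + 1" if "j < m" for N j using qrs[OF i] that by blast
    have "\<forall>\<^sub>F k in sequentially. pt (Suc (\<sigma> k)) (s (\<sigma> k) i) i < R"
      by (rule order_tendstoD(2)[OF near[where t = "\<lambda>N. s N i" and j = i, OF rt[OF i] i] ci])
    then have "\<forall>\<^sub>F k in sequentially. P (pt (Suc (\<sigma> k)) (s (\<sigma> k) i)) i \<ge> 0"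
    proof eventually_elim
      case (elim k)
      have "s (\<sigma> k) i i \<noteq> Suc (\<sigma> k)"
      proof
        assume "s (\<sigma> k) i i = Suc (\<sigma> k)"
        with elim show False by (simp add: pt_def del: of_nat_Suc)
      qed
      moreover have "lab (Suc (\<sigma> k)) (s (\<sigma> k) i) i = 1" using qrs[OF i, of "\<sigma> k"] by blast
      ultimately show ?case by (simp add: lab_def split: if_splits)
    qed
    moreover have "(\<lambda>k. P (pt (Suc (\<sigma> k)) (s (\<sigma> k) i)) i) \<longlonglongrightarrow> P c i"
      by (rule Plim[where t = "\<lambda>N. s N i" and i = i], rule rt, assumption, rule i)
    ultimately show ?thesis by (intro tendsto_lowerbound[where F = sequentially]) simp_all
  qed
  have "P c i * c i \<le> 0" if i: "i < m" for i
  proof -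
    consider "c i = - R" | "c i = R" | "- R < c i" "c i < R" using cR[OF i] by linarith
    then show ?thesis
    proof cases
      case 1 then show ?thesis using lo[OF i] R by (simp add: mult_nonneg_nonneg)
    next
      case 2 then show ?thesis using up[OF i] R by (simp add: mult_nonpos_nonneg)
    next
      case 3 then have "P c i = 0" using lo[OF i] up[OF i] by linarith
      then show ?thesis by simp
    qed
  qed
  then have sum: "(\<Sum>i<m. P c i * c i) \<le> 0" by (intro sum_nonpos) auto
  have strict: "\<bar>c i\<bar> < R" if "i < m" for i
    using coer[OF cR that] cR[OF that] sum by fastforce
  have "P c i = 0" if "i < m" for i
    using lo[OF that] up[OF that] strict[OF that] by (auto simp: abs_less_iff)
  with cR that show ?thesis by blast
qed

section \<open>Test functions\<close>

lemma has_derivative_grad: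
  fixes w :: "real^'n \<Rightarrow> real"
  assumes "w differentiable (at x)"
  shows "(w has_derivative (\<lambda>h. grad w x \<bullet> h)) (at x)"
proof -
  have D: "(w has_derivative frechet_derivative w (at x)) (at x)"
    using assms by (simp add: frechet_derivative_works)
  then have lin: "linear (frechet_derivative w (at x))" by (rule has_derivative_linear)
  have "frechet_derivative w (at x) h = grad w x \<bullet> h" for h
  proof -
    have "frechet_derivative w (at x) h = frechet_derivative w (at x) (\<Sum>i\<in>UNIV. h $ i *\<^sub>R axis i 1)"
      by (metis basis_expansion scalar_mult_eq_scaleR)
    also have "\<dots> = (\<Sum>i\<in>UNIV. h $ i * frechet_derivative w (at x) (axis i 1))"
      using lin by (simp add: linear_sum linear_cmul)
    finally show ?thesis by (simp add: grad_def partial_deriv_def inner_vec_def mult.commute)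
  qed
  then have "frechet_derivative w (at x) = (\<lambda>h. grad w x \<bullet> h)" by blast
  with D show ?thesis by simp
qed

lemma partial_deriv_eqI:
  assumes "(f has_derivative f') (at x)"
  shows "partial_deriv i f x = f' (axis i 1)"
  using frechet_derivative_at[OF assms] by (simp add: partial_deriv_def)

lemma grad_eqI:
  assumes "(f has_derivative (\<lambda>h. g \<bullet> h)) (at x)"
  shows "grad f x = g"
  by (simp add: grad_def partial_deriv_eqI[OF assms] inner_axis vec_eq_iff)

lemma partial_deriv_eq_grad: "partial_deriv i f x = grad f x $ i"
  by (simp add: grad_def)

section \<open>Closure of \<open>Ck\<close> under sums and products\<close>

lemma Ck_SucD: "Ck (Suc k) f \<Longrightarrow> Ck k f"
  by (induction k arbitrary: f) auto

lemma Ck_const: "Ck k (\<lambda>x::real^'n. c)"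
proof (induction k arbitrary: c)
  case (Suc k)
  have "partial_deriv i (\<lambda>x::real^'n. c) = (\<lambda>x. 0)" for i
    by (simp add: partial_deriv_def fun_eq_iff)
  with Suc show ?case by simp
qed simp

lemma Ck_add: "Ck k f \<Longrightarrow> Ck k g \<Longrightarrow> Ck k (\<lambda>x. f x + g x)"
proof (induction k arbitrary: f g)
  case (Suc k)
  then have D: "f differentiable (at x)" "g differentiable (at x)" for x by auto
  have "partial_deriv i (\<lambda>x. f x + g x) = (\<lambda>x. partial_deriv i f x + partial_deriv i g x)" for i
    using partial_deriv_eqI[OF has_derivative_add[OF has_derivative_grad[OF D(1)] has_derivative_grad[OF D(2)]]]
    by (simp add: inner_axis partial_deriv_eq_grad fun_eq_iff)
  with Suc D show ?case by (auto intro!: continuous_intros)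
qed (auto intro!: continuous_intros)

lemma Ck_mult: "Ck k f \<Longrightarrow> Ck k g \<Longrightarrow> Ck k (\<lambda>x. f x * g x)"
proof (induction k arbitrary: f g)
  case (Suc k)
  then have D: "f differentiable (at x)" "g differentiable (at x)" for x by auto
  have eq: "partial_deriv i (\<lambda>x. f x * g x) = (\<lambda>x. f x * partial_deriv i g x + partial_deriv i f x * g x)" for i
    using partial_deriv_eqI[OF has_derivative_mult[OF has_derivative_grad[OF D(1)] has_derivative_grad[OF D(2)]]]
    by (simp add: inner_axis partial_deriv_eq_grad fun_eq_iff)
  have "Ck k (\<lambda>x. f x * partial_deriv i g x + partial_deriv i f x * g x)" for i
    using Suc.prems Ck_SucD[OF Suc.prems(1)] Ck_SucD[OF Suc.prems(2)] by (intro Ck_add Suc.IH) auto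
  with eq Suc.prems D show ?case by (auto intro!: continuous_intros)
qed (auto intro!: continuous_intros)

section \<open>A smooth substitute for \<open>min s 0\<close>\<close>

definition refl_logistic :: "real \<Rightarrow> real" where "refl_logistic t = 1 / (1 + exp t)"

lemma refl_logistic_bounds: "0 < refl_logistic t" "refl_logistic t < 1"
  by (auto simp: refl_logistic_def add_pos_pos)

lemma exp_add1_nz: "1 + exp t \<noteq> (0::real)"
  by (metis add_pos_pos exp_gt_zero less_irrefl zero_less_one)

lemma refl_logistic_deriv: "(refl_logistic has_real_derivative (refl_logistic t * (refl_logistic t - 1))) (at t)"
proof -
  have "(refl_logistic has_real_derivative - (exp t) / (1 + exp t)^2) (at t)"
    unfolding refl_logistic_def[abs_def] using exp_add1_nz[of t]
    by (auto intro!: derivative_eq_intros simp: power2_eq_square)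
  also have "- (exp t) / (1 + exp t)^2 = refl_logistic t * (refl_logistic t - 1)"
    using exp_add1_nz[of t] by (simp add: refl_logistic_def field_simps power2_eq_square)
  finally show ?thesis .
qed

lemma continuous_refl_logistic: "continuous_on A refl_logistic"
  unfolding refl_logistic_def[abs_def] using exp_add1_nz by (intro continuous_intros) auto

text \<open>The derivative of \<open>refl_logistic\<close> is a polynomial in
  \<open>refl_logistic\<close> itself, so the induction closes with sums and products alone.\<close>

lemma Ck_refl_logistic: "Ck k f \<Longrightarrow> Ck k (\<lambda>x. refl_logistic (f x))"
proof (induction k arbitrary: f)
  case 0
  then show ?case using continuous_on_compose2[OF continuous_refl_logistic[of UNIV], of UNIV f] by simp
next
  case (Suc k)
  then have D: "f differentiable (at x)" for x by auto
  have der: "((\<lambda>x. refl_logistic (f x)) has_derivative (\<lambda>h. (grad f x \<bullet> h) * (refl_logistic (f x) * (refl_logistic (f x) - 1)))) (at x)" for x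
    using has_derivative_compose[OF has_derivative_grad[OF D] refl_logistic_deriv[unfolded has_field_derivative_def], of x]
    by (simp add: mult.commute)
  have eq: "partial_deriv i (\<lambda>x. refl_logistic (f x)) = (\<lambda>x. partial_deriv i f x * (refl_logistic (f x) * (refl_logistic (f x) + (-1))))" for i
    using partial_deriv_eqI[OF der]
    by (simp add: inner_axis partial_deriv_eq_grad fun_eq_iff)
  have "Ck k (\<lambda>x. refl_logistic (f x))" by (intro Suc.IH Ck_SucD[OF Suc.prems])
  then have "Ck k (\<lambda>x. partial_deriv i f x * (refl_logistic (f x) * (refl_logistic (f x) + (-1))))" for i
    using Suc.prems by (intro Ck_mult Ck_add Ck_const) auto
  moreover have "continuous_on UNIV (\<lambda>x. refl_logistic (f x))"
    using continuous_on_compose2[OF continuous_refl_logistic[of UNIV], of UNIV f] Suc.prems by simp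
  ultimately show ?case using der unfolding Ck.simps eq by (auto simp: differentiable_def)
qed

text \<open>A softened \<open>min s 0\<close> for \<open>k > 0\<close>: the derivative is
  \<open>refl_logistic (k * s)\<close>, so the function is increasing and 1-Lipschitz. Division by 2
  inside the logarithm normalises the value at 0 to 0, which preserves compact supports; the
  resulting error against \<open>min s 0\<close> is at most \<open>ln 2 / k\<close>.\<close>

definition eta :: "real \<Rightarrow> real \<Rightarrow> real" where
  "eta k s = s - ln ((1 + exp (k * s)) / 2) / k"

lemma eta_0 [simp]: "eta k 0 = 0"
  by (simp add: eta_def)

lemma eta_deriv:
  assumes "k > 0" shows "(eta k has_real_derivative refl_logistic (k * s)) (at s)"
proof -
  define E where "E = exp (k * s)"
  have pos: "1 + E > 0" by (simp add: E_def add_pos_pos)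
  have "((\<lambda>s. ln ((1 + exp (k * s)) / 2)) has_real_derivative (E * k / 2) / ((1 + E) / 2)) (at s)"
    using pos unfolding E_def by (auto intro!: derivative_eq_intros simp: divide_simps)
  then have "((\<lambda>s. s - ln ((1 + exp (k * s)) / 2) / k) has_real_derivative 1 - (E * k / 2) / ((1 + E) / 2) / k) (at s)"
    by (intro DERIV_diff DERIV_ident DERIV_cdivide)
  moreover have "1 - (E * k / 2) / ((1 + E) / 2) / k = refl_logistic (k * s)"
    using assms pos unfolding refl_logistic_def E_def[symmetric] by (simp add: divide_simps)
  ultimately show ?thesis by (simp add: eta_def[abs_def])
qed

lemma eta_diff_le:
  assumes k: "k > 0" shows "\<bar>eta k s - eta k t\<bar> \<le> \<bar>s - t\<bar>"
proof -
  have "norm (eta k s - eta k t) \<le> 1 * norm (s - t)"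
    by (rule field_differentiable_bound[of UNIV "eta k" "\<lambda>s. refl_logistic (k * s)"])
       (use eta_deriv[OF k] refl_logistic_bounds in \<open>auto simp: abs_of_pos less_imp_le\<close>)
  then show ?thesis by simp
qed

lemma eta_abs_le: "k > 0 \<Longrightarrow> \<bar>eta k s\<bar> \<le> \<bar>s\<bar>"
  using eta_diff_le[of k s 0] by simp

text \<open>The logarithm of \<open>1 + exp (k * s)\<close> lies between
  \<open>max 0 (k * s)\<close> and \<open>ln 2 + max 0 (k * s)\<close>, since the larger of the two
  summands is at least half of the sum.\<close>

lemma eta_bounds:
  assumes k: "k > 0"
  shows "eta k s \<le> min s 0 + ln 2 / k" "min s 0 \<le> eta k s"
proof -
  have eq: "eta k s = s - (ln (1 + exp (k * s)) - ln 2) / k"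
    unfolding eta_def by (subst ln_div) (use exp_add1_nz[of "k * s"] in \<open>auto simp: add_pos_pos\<close>)
  have "max 0 (k * s) \<le> ln (1 + exp (k * s))"
  proof -
    have "ln 1 \<le> ln (1 + exp (k * s))" by (subst ln_le_cancel_iff) (auto simp: add_pos_pos)
    moreover have "ln (exp (k * s)) \<le> ln (1 + exp (k * s))" by (subst ln_le_cancel_iff) (auto simp: add_pos_pos)
    ultimately show ?thesis by simp
  qed
  then have "max 0 (k * s) / k \<le> ln (1 + exp (k * s)) / k" using k by (intro divide_right_mono) auto
  moreover have "max 0 (k * s) / k = max 0 s" using k by (auto simp: max_def zero_le_mult_iff mult_le_0_iff)
  ultimately show "eta k s \<le> min s 0 + ln 2 / k"
    using k unfolding eq by (auto simp: diff_divide_distrib max_def min_def split: if_splits)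
  have "ln (1 + exp (k * s)) \<le> ln (2 * exp (max 0 (k * s)))"
  proof (subst ln_le_cancel_iff)
    have "exp 0 \<le> exp (max 0 (k * s))" "exp (k * s) \<le> exp (max 0 (k * s))" by (simp_all only: exp_le_cancel_iff max.cobounded1 max.cobounded2)
    then show "1 + exp (k * s) \<le> 2 * exp (max 0 (k * s))" unfolding exp_zero by linarith
  qed (auto simp: add_pos_pos)
  also have "\<dots> = ln 2 + max 0 (k * s)" by (subst ln_mult) auto
  finally have "(ln (1 + exp (k * s)) - ln 2) / k \<le> max 0 (k * s) / k" using k by (intro divide_right_mono) auto
  moreover have "max 0 (k * s) / k = max 0 s" using k by (auto simp: max_def zero_le_mult_iff mult_le_0_iff)
  ultimately show "min s 0 \<le> eta k s"
    unfolding eq by (simp add: max_def min_def split: if_splits)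
qed

lemma eta_tendsto: "(\<lambda>k. eta (real (Suc k)) s) \<longlonglongrightarrow> min s 0"
proof -
  have lim: "(\<lambda>k. min s 0 + ln 2 * inverse (real (Suc k))) \<longlonglongrightarrow> min s 0 + ln 2 * 0"
    by (intro tendsto_intros LIMSEQ_inverse_real_of_nat)
  show ?thesis
  proof (rule tendsto_sandwich)
    show "\<forall>\<^sub>F k in sequentially. min s 0 \<le> eta (real (Suc k)) s"
      by (intro always_eventually allI eta_bounds) simp
    show "\<forall>\<^sub>F k in sequentially. eta (real (Suc k)) s \<le> min s 0 + ln 2 * inverse (real (Suc k))"
      using eta_bounds(1)[of "real (Suc _)" s] by (intro always_eventually allI) (simp add: divide_inverse)
  qed (use lim in simp_all)
qed

lemma has_derivative_eta:
  assumes "k > 0" "f differentiable (at x)"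
  shows "((\<lambda>x. eta k (f x)) has_derivative (\<lambda>h. (refl_logistic (k * f x) *\<^sub>R grad f x) \<bullet> h)) (at x)"
  using has_derivative_compose[OF has_derivative_grad[OF assms(2)] eta_deriv[OF assms(1), unfolded has_field_derivative_def]]
  by simp

lemma Ck_eta:
  assumes k: "k > 0" and f: "Ck m f" shows "Ck m (\<lambda>x. eta k (f x))"
proof (cases m)
  case 0
  have "continuous_on UNIV (eta k)" using eta_deriv[OF k] by (intro DERIV_continuous_on) auto
  from continuous_on_compose2[OF this, of UNIV f] f 0 show ?thesis by simp
next
  case (Suc j)
  then have D: "f differentiable (at x)" for x using f by auto
  note der = has_derivative_eta[OF k D]
  have eq: "partial_deriv i (\<lambda>x. eta k (f x)) = (\<lambda>x. refl_logistic (k * f x) * partial_deriv i f x)" for i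
    using partial_deriv_eqI[OF der] by (simp add: inner_axis partial_deriv_eq_grad fun_eq_iff)
  have "Ck j f" using f Suc Ck_SucD by auto
  then have "Ck j (\<lambda>x. refl_logistic (k * f x) * partial_deriv i f x)" for i
    using f Suc by (intro Ck_mult Ck_refl_logistic Ck_const) auto
  moreover have "continuous_on UNIV (\<lambda>x. eta k (f x))"
    using der by (intro differentiable_imp_continuous_on) (auto simp: differentiable_on_def differentiable_def intro: has_derivative_at_withinI)
  ultimately show ?thesis using der unfolding Suc Ck.simps eq by (auto simp: differentiable_def)
qed

section \<open>Operations on test functions and their gradients\<close>

lemma test_fun_iff:
  "test_fun \<phi> \<longleftrightarrow> smooth_fun \<phi> \<and> (\<exists>R. \<forall>x. norm x > R \<longrightarrow> \<phi> x = 0)"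
  unfolding test_fun_def compact_closure bounded_iff
  by (metis (mono_tags, lifting) linorder_not_less mem_Collect_eq)

lemma test_fun_lincomb:
  assumes "test_fun f" "test_fun g" shows "test_fun (\<lambda>x. a * f x + b * g x)"
proof -
  obtain R S where RS: "\<forall>x. norm x > R \<longrightarrow> f x = 0" "\<forall>x. norm x > S \<longrightarrow> g x = 0" using assms by (auto simp: test_fun_iff)
  have "\<forall>x. norm x > max R S \<longrightarrow> a * f x + b * g x = 0" using RS by auto
  moreover have "smooth_fun (\<lambda>x. a * f x + b * g x)"
    using assms by (auto simp: test_fun_iff smooth_fun_def intro!: Ck_add Ck_mult Ck_const)
  ultimately show ?thesis unfolding test_fun_iff by blast
qed

lemma test_fun_0: "test_fun (\<lambda>x. 0)"
  by (auto simp: test_fun_iff smooth_fun_def Ck_const)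

lemma test_fun_sum: "(\<And>i. i \<in> I \<Longrightarrow> test_fun (f i)) \<Longrightarrow> test_fun (\<lambda>x. \<Sum>i\<in>I. c i * f i x)"
proof (induction I rule: infinite_finite_induct)
  case (insert i I)
  then have "test_fun (\<lambda>x. c i * f i x + 1 * (\<Sum>i\<in>I. c i * f i x))"
    by (intro test_fun_lincomb) auto
  with insert show ?case by simp
qed (auto simp: test_fun_0)

lemma test_fun_eta:
  assumes "k > 0" "test_fun f" shows "test_fun (\<lambda>x. eta k (f x))"
proof -
  obtain R where "\<forall>x. norm x > R \<longrightarrow> f x = 0" using assms by (auto simp: test_fun_iff)
  then have "\<forall>x. norm x > R \<longrightarrow> eta k (f x) = 0" by simp
  moreover have "smooth_fun (\<lambda>x. eta k (f x))"
    using assms by (auto simp: test_fun_iff smooth_fun_def intro!: Ck_eta)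
  ultimately show ?thesis unfolding test_fun_iff by blast
qed

lemma test_fun_C1:
  assumes "test_fun w"
  shows "w differentiable (at x)" "continuous_on UNIV w" "continuous_on UNIV (grad w)"
    "\<exists>R>0. \<forall>x. norm x \<ge> R \<longrightarrow> w x = 0 \<and> grad w x = 0"
proof -
  have "smooth_fun w" using assms by (simp add: test_fun_iff)
  then have "Ck (Suc 0) w" unfolding smooth_fun_def by blast
  then show D: "w differentiable (at x)" and "continuous_on UNIV w" "continuous_on UNIV (grad w)" for x
    by (auto simp: grad_def[abs_def] intro!: continuous_intros)
  obtain R where R: "\<forall>x. norm x > R \<longrightarrow> w x = 0" using assms by (auto simp: test_fun_iff)
  have g: "grad w x = 0" if x: "norm x > R" for x
  proof (rule grad_eqI)
    have "open {x::real^'a. norm x > R}" by (intro open_Collect_less continuous_intros)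
    from has_derivative_transform_within_open[OF _ this, of "\<lambda>x. 0" "\<lambda>h. 0" x UNIV w]
    have "(w has_derivative (\<lambda>h. 0)) (at x)" using x R by simp
    then show "(w has_derivative (\<bullet>) 0) (at x)" by (metis ext inner_zero_left)
  qed
  show "\<exists>R>0. \<forall>x. norm x \<ge> R \<longrightarrow> w x = 0 \<and> grad w x = 0"
    \<comment> \<open>The gradient is known to vanish only where \<open>norm x > R\<close>; one more
      unit covers the closed inequality and makes the radius positive.\<close>
    by (rule exI[of _ "max R 0 + 1"]) (use g R in auto)
qed

lemma grad_lincomb:
  assumes "test_fun f" "test_fun g"
  shows "grad (\<lambda>x. a * f x + b * g x) x = a *\<^sub>R grad f x + b *\<^sub>R grad g x"
proof (rule grad_eqI)
  note [derivative_intros] = has_derivative_grad[OF test_fun_C1(1)[OF assms(1)]] has_derivative_grad[OF test_fun_C1(1)[OF assms(2)]]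
  show "((\<lambda>x. a * f x + b * g x) has_derivative (\<bullet>) (a *\<^sub>R grad f x + b *\<^sub>R grad g x)) (at x)"
    by (auto intro!: derivative_eq_intros simp: inner_add_left fun_eq_iff)
qed

lemma grad_zero: "grad (\<lambda>x. 0) x = 0"
  by (rule grad_eqI) simp

lemma grad_sum:
  "(\<And>i. i \<in> I \<Longrightarrow> test_fun (f i)) \<Longrightarrow> grad (\<lambda>x. \<Sum>i\<in>I. c i * f i x) x = (\<Sum>i\<in>I. c i *\<^sub>R grad (f i) x)"
proof (induction I rule: infinite_finite_induct)
  case (insert i I)
  have "grad (\<lambda>x. c i * f i x + 1 * (\<Sum>i\<in>I. c i * f i x)) x = c i *\<^sub>R grad (f i) x + 1 *\<^sub>R grad (\<lambda>x. \<Sum>i\<in>I. c i * f i x) x"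
    using insert by (intro grad_lincomb test_fun_sum) auto
  with insert show ?case by simp
qed (auto simp: grad_zero)

lemma grad_eta:
  assumes "k > 0" "test_fun f"
  shows "grad (\<lambda>x. eta k (f x)) x = refl_logistic (k * f x) *\<^sub>R grad f x"
  using assms by (intro grad_eqI has_derivative_eta test_fun_C1)

lemma bounded_of_compact_support:
  fixes g :: "'a::euclidean_space \<Rightarrow> 'b::real_normed_vector"
  assumes "continuous_on UNIV g" "\<And>x. norm x \<ge> R \<Longrightarrow> g x = 0"
  obtains B where "B > 0" "\<And>x. norm (g x) \<le> B"
proof -
  have "compact (g ` cball 0 R)"
    by (intro compact_continuous_image compact_cball continuous_on_subset[OF assms(1)]) auto
  then obtain B where B: "B > 0" "\<And>x. norm x \<le> R \<Longrightarrow> norm (g x) \<le> B"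
    by (auto dest!: compact_imp_bounded simp: bounded_pos)
  have "norm (g x) \<le> B" for x
  proof (cases "norm x \<le> R")
    case False
    then show ?thesis using B(1) assms(2)[of x] by simp
  qed (rule B(2))
  from that[OF B(1) this] show ?thesis .
qed

lemma Lp_compact_support:
  fixes g :: "'a::euclidean_space \<Rightarrow> 'b::euclidean_space"
  assumes c: "continuous_on UNIV g" "\<And>x. norm x \<ge> R \<Longrightarrow> g x = 0" and p: "p \<ge> 0"
  shows "Lp p lebesgue g"
proof -
  have m: "g \<in> borel_measurable borel" using c by (intro borel_measurable_continuous_onI)
  then have m': "g \<in> borel_measurable lebesgue" by (simp add: measurable_completion)
  obtain B where B: "B > 0" "\<And>x. norm (g x) \<le> B" using bounded_of_compact_support[OF c] by blast
  have "integrable lebesgue (\<lambda>x. B powr p * indicat_real (cball 0 R) x :: real)"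
    using emeasure_bounded_finite[OF bounded_cball[of 0 R]] by (intro integrable_mult_right integrable_real_indicator) auto
  then have "integrable lebesgue (\<lambda>x. norm (g x) powr p)"
  proof (rule Bochner_Integration.integrable_bound)
    show "AE x in lebesgue. norm (norm (g x) powr p) \<le> norm (B powr p * indicat_real (cball 0 R) x)"
      using powr_mono2[OF p norm_ge_zero B(2)] c(2)
      by (intro always_eventually allI) (auto split: split_indicator)
  qed (use m' in auto)
  with m' show ?thesis by (simp add: Lp_def)
qed

section \<open>Hardy's inequality\<close>

lemma nn_integral_lborel_scaleR:
  fixes g :: "'a::euclidean_space \<Rightarrow> ennreal"
  assumes [measurable]: "g \<in> borel_measurable borel" and s: "s \<noteq> 0"
  shows "(\<integral>\<^sup>+x. g x \<partial>lborel) = ennreal (\<bar>s\<bar> ^ DIM('a)) * (\<integral>\<^sup>+x. g (s *\<^sub>R x) \<partial>lborel)"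
  by (subst lborel_affine[OF s, of 0])
     (simp add: nn_integral_density nn_integral_distr nn_integral_cmult)

lemma nn_integral_lborel_translate:
  fixes g :: "'a::euclidean_space \<Rightarrow> ennreal"
  assumes [measurable]: "g \<in> borel_measurable borel"
  shows "(\<integral>\<^sup>+x. g (h + x) \<partial>lborel) = (\<integral>\<^sup>+x. g x \<partial>lborel)"
  by (subst (2) lborel_distr_plus[symmetric, of h]) (simp add: nn_integral_distr)

lemma pint_lborel:
  fixes f :: "'a::euclidean_space \<Rightarrow> 'b::euclidean_space"
  assumes [measurable]: "f \<in> borel_measurable borel"
  shows "pint p lebesgue f = pint p lborel f"
  unfolding pint_def by (rule integral_completion) measurable

text \<open>The source of the condition \<open>p < n\<close>: dilation by \<open>s\<close>
  multiplies the \<open>L^p\<close> norm by \<open>s powr (- n / p)\<close>, with \<open>n\<close>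
  the dimension, and this is integrable at infinity exactly when \<open>n > p\<close>.\<close>

lemma pint_scaleR:
  fixes g :: "'a::euclidean_space \<Rightarrow> 'b::euclidean_space"
  assumes c: "continuous_on UNIV g" "\<And>x. norm x \<ge> R \<Longrightarrow> g x = 0" and p: "p \<ge> 0" and s: "s > 0"
  shows "integrable lborel (\<lambda>x. norm (g (s *\<^sub>R x)) powr p)"
    "(\<integral>x. norm (g (s *\<^sub>R x)) powr p \<partial>lborel) = pint p lborel g / s ^ DIM('a)"
proof -
  have m[measurable]: "g \<in> borel_measurable borel" using c(1) by (rule borel_measurable_continuous_onI)
  have I: "integrable lborel (\<lambda>x. norm (g (t *\<^sub>R x)) powr p)" if t: "t > 0" for t
  proof -
    have "Lp p lebesgue (\<lambda>x. g (t *\<^sub>R x))"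
    proof (rule Lp_compact_support[OF _ _ p])
      show "continuous_on UNIV (\<lambda>x. g (t *\<^sub>R x))"
        by (rule continuous_on_compose2[OF c(1)]) (auto intro!: continuous_intros)
      show "g (t *\<^sub>R x) = 0" if "norm x \<ge> R / t" for x
        using that t by (intro c(2)) (simp add: field_simps)
    qed
    then show ?thesis unfolding Lp_def by (subst (asm) integrable_completion) auto
  qed
  show "integrable lborel (\<lambda>x. norm (g (s *\<^sub>R x)) powr p)" by (rule I[OF s])
  have I1: "integrable lborel (\<lambda>x. norm (g x) powr p)" using I[of 1] by simp
  have "ennreal (pint p lborel g) = (\<integral>\<^sup>+x. ennreal (norm (g x) powr p) \<partial>lborel)"
    unfolding pint_def by (rule nn_integral_eq_integral[symmetric, OF I1]) simp
  also have "\<dots> = ennreal (\<bar>s\<bar> ^ DIM('a)) * (\<integral>\<^sup>+x. ennreal (norm (g (s *\<^sub>R x)) powr p) \<partial>lborel)"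
    by (rule nn_integral_lborel_scaleR) (use s in auto)
  also have "(\<integral>\<^sup>+x. ennreal (norm (g (s *\<^sub>R x)) powr p) \<partial>lborel) = ennreal (\<integral>x. norm (g (s *\<^sub>R x)) powr p \<partial>lborel)"
    by (rule nn_integral_eq_integral[OF I[OF s]]) simp
  also have "ennreal (\<bar>s\<bar> ^ DIM('a)) * \<dots> = ennreal (s ^ DIM('a) * (\<integral>x. norm (g (s *\<^sub>R x)) powr p \<partial>lborel))"
    using s by (subst ennreal_mult) auto
  finally have "pint p lborel g = s ^ DIM('a) * (\<integral>x. norm (g (s *\<^sub>R x)) powr p \<partial>lborel)"
    using s by (subst (asm) ennreal_inj) auto
  then show "(\<integral>x. norm (g (s *\<^sub>R x)) powr p \<partial>lborel) = pint p lborel g / s ^ DIM('a)"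
    using s by simp
qed

lemma has_vector_derivative_along_line:
  fixes w :: "real^'n \<Rightarrow> real"
  assumes "\<And>x. w differentiable (at x)"
  shows "((\<lambda>s. w (a + s *\<^sub>R v)) has_vector_derivative (grad w (a + s *\<^sub>R v) \<bullet> v)) (at s within T)"
proof -
  have "((\<lambda>s. a + s *\<^sub>R v) has_derivative (\<lambda>h. h *\<^sub>R v)) (at s within T)"
    by (auto intro!: derivative_eq_intros)
  from has_derivative_compose[OF this has_derivative_grad[OF assms]]
  show ?thesis unfolding has_vector_derivative_def by simp
qed

text \<open>Stated with nonnegative extended integrals, so that Tonelli's theorem applies to it
  without integrability checks.\<close>

lemma abs_diff_along_line_le:
  fixes w :: "real^'n \<Rightarrow> real"
  assumes d: "\<And>x. w differentiable (at x)" and c: "continuous_on UNIV (grad w)" and ab: "b \<le> d"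
  shows "ennreal \<bar>w (x + d *\<^sub>R v) - w (x + b *\<^sub>R v)\<bar>
     \<le> (\<integral>\<^sup>+s. indicator {b..d} s * ennreal (norm v * norm (grad w (x + s *\<^sub>R v))) \<partial>lborel)"
proof -
  have cg: "continuous_on T (\<lambda>s. grad w (x + s *\<^sub>R v))" for T :: "real set"
    by (rule continuous_on_compose2[OF c]) (auto intro!: continuous_intros)
  have F: "((\<lambda>s. grad w (x + s *\<^sub>R v) \<bullet> v) has_integral (w (x + d *\<^sub>R v) - w (x + b *\<^sub>R v))) {b..d}"
    by (rule fundamental_theorem_of_calculus[OF ab has_vector_derivative_along_line[OF d]])
  define I where "I = integral {b..d} (\<lambda>s. norm v * norm (grad w (x + s *\<^sub>R v)))"
  have i: "(\<lambda>s. norm v * norm (grad w (x + s *\<^sub>R v))) integrable_on {b..d}"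
    by (intro integrable_continuous_real continuous_intros cg)
  have "norm (integral {b..d} (\<lambda>s. grad w (x + s *\<^sub>R v) \<bullet> v)) \<le> I"
    unfolding I_def
    by (rule Henstock_Kurzweil_Integration.integral_norm_bound_integral[OF has_integral_integrable[OF F] i])
       (simp add: Cauchy_Schwarz_ineq2 mult.commute[of "norm v"])
  then have "\<bar>w (x + d *\<^sub>R v) - w (x + b *\<^sub>R v)\<bar> \<le> I"
    using integral_unique[OF F] by simp
  moreover have "(\<integral>\<^sup>+s. ennreal (indicator {b..d} s * (norm v * norm (grad w (x + s *\<^sub>R v)))) \<partial>lborel) = ennreal I"
    by (rule nn_integral_has_integral_lebesgue) (use i in \<open>auto simp: I_def has_integral_iff\<close>)
  moreover have "ennreal (indicator {b..d} s * (norm v * norm (grad w (x + s *\<^sub>R v))))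
      = indicator {b..d} s * ennreal (norm v * norm (grad w (x + s *\<^sub>R v)))" for s :: real
    by (auto split: split_indicator)
  ultimately show ?thesis by (simp add: ennreal_leI)
qed

text \<open>
  Integrating \<open>\<nabla>w\<close> from \<open>x\<close> outwards along the ray through \<open>x\<close> and applying Hoelder's inequality
  after Tonelli gives Hardy's inequality in its dual form.
\<close>

theorem hardy_dual:
  fixes w :: "real^'n \<Rightarrow> real" and f :: "real^'n \<Rightarrow> real"
  assumes pq: "p > 1" "q > 1" "1/p + 1/q = 1" and n: "real CARD('n) > p"
    and w: "test_fun w" and fm[measurable]: "f \<in> borel_measurable borel" and f0: "\<And>x. f x \<ge> 0"
    and fi: "integrable lborel (\<lambda>x. (norm x * f x) powr q)"
  shows "(\<integral>\<^sup>+x. ennreal (f x * \<bar>w x\<bar>) \<partial>lborel) \<le>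
     ennreal (p / (real CARD('n) - p) * (\<integral>x. (norm x * f x) powr q \<partial>lborel) powr (1/q) * pint p lebesgue (grad w) powr (1/p))"
proof -
  note C1 = test_fun_C1[OF w]
  obtain R where R: "R > 0" "\<And>x. norm x \<ge> R \<Longrightarrow> w x = 0" "\<And>x. norm x \<ge> R \<Longrightarrow> grad w x = 0" using C1(4) by blast
  have gm[measurable]: "grad w \<in> borel_measurable borel" using C1(3) by (rule borel_measurable_continuous_onI)
  define n where "n = real CARD('n)"
  define A where "A = (\<integral>x. (norm x * f x) powr q \<partial>lborel)"
  define P where "P = pint p lborel (grad w)"
  have n0: "n > p" "n > 0" using n pq by (auto simp: n_def)
  have pointwise: "ennreal (f x * \<bar>w x\<bar>) \<le> (\<integral>\<^sup>+s. indicator {1..} s * ennreal (norm (grad w (s *\<^sub>R x)) * (norm x * f x)) \<partial>lborel)"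
    if x: "x \<noteq> 0" for x
  proof -
    \<comment> \<open>At parameter \<open>S\<close> the ray through \<open>x\<close> has left the
      support, so the value at the far end is 0. The maximum with 1 covers points that are already
      outside.\<close>
    define S where "S = max 1 (R / norm x)"
    have S: "1 \<le> S" "norm (S *\<^sub>R x) \<ge> R" using x R(1) by (auto simp: S_def field_simps max_def)
    have "ennreal \<bar>w (0 + S *\<^sub>R x) - w (0 + 1 *\<^sub>R x)\<bar> \<le> (\<integral>\<^sup>+s. indicator {1..S} s * ennreal (norm x * norm (grad w (0 + s *\<^sub>R x))) \<partial>lborel)"
      by (rule abs_diff_along_line_le[OF C1(1,3) S(1)])
    then have 1: "ennreal \<bar>w x\<bar> \<le> (\<integral>\<^sup>+s. indicator {1..S} s * ennreal (norm x * norm (grad w (s *\<^sub>R x))) \<partial>lborel)"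
      using R(2)[OF S(2)] by simp
    have "ennreal (f x * \<bar>w x\<bar>) = ennreal (f x) * ennreal \<bar>w x\<bar>" using f0 by (simp add: ennreal_mult)
    also have "\<dots> \<le> ennreal (f x) * (\<integral>\<^sup>+s. indicator {1..S} s * ennreal (norm x * norm (grad w (s *\<^sub>R x))) \<partial>lborel)"
      by (rule mult_left_mono[OF 1]) simp
    also have "\<dots> = (\<integral>\<^sup>+s. ennreal (f x) * (indicator {1..S} s * ennreal (norm x * norm (grad w (s *\<^sub>R x)))) \<partial>lborel)"
      by (rule nn_integral_cmult[symmetric]) measurable
    also have "\<dots> \<le> (\<integral>\<^sup>+s. indicator {1..} s * ennreal (norm (grad w (s *\<^sub>R x)) * (norm x * f x)) \<partial>lborel)"
      by (rule nn_integral_mono) (use f0 in \<open>auto split: split_indicator simp: ennreal_mult[symmetric] mult_ac\<close>)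
    finally show ?thesis .
  qed
  \<comment> \<open>Hoelder's inequality for a fixed dilation \<open>s\<close>: the factor with the
    datum does not depend on \<open>s\<close>, and all the decay comes from the dilated
    gradient.\<close>
  have inner: "(\<integral>\<^sup>+x. ennreal (norm (grad w (s *\<^sub>R x)) * (norm x * f x)) \<partial>lborel) \<le> ennreal (P powr (1/p) * A powr (1/q) * s powr (- n / p))"
    if s: "s \<ge> 1" for s
  proof -
    have s0: "s > 0" using s by simp
    note PS = pint_scaleR[where R = R and p = p, OF C1(3) R(3) _ s0]
    have H: "integrable lborel (\<lambda>x. norm (grad w (s *\<^sub>R x)) * (norm x * f x))"
      "(\<integral>x. norm (grad w (s *\<^sub>R x)) * (norm x * f x) \<partial>lborel) \<le> (\<integral>x. norm (grad w (s *\<^sub>R x)) powr p \<partial>lborel) powr (1/p) * A powr (1/q)"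
    proof -
      note H = holder_real[OF pq, of "\<lambda>x. norm (grad w (s *\<^sub>R x))" lborel "\<lambda>x. norm x * f x"]
      show "integrable lborel (\<lambda>x. norm (grad w (s *\<^sub>R x)) * (norm x * f x))"
        by (rule H(1)) (use fi f0 PS(1) pq in simp_all)
      show "(\<integral>x. norm (grad w (s *\<^sub>R x)) * (norm x * f x) \<partial>lborel) \<le> (\<integral>x. norm (grad w (s *\<^sub>R x)) powr p \<partial>lborel) powr (1/p) * A powr (1/q)"
        unfolding A_def by (rule H(2)) (use fi f0 PS(1) pq in simp_all)
    qed
    have "(P / s ^ CARD('n)) powr (1/p) = P powr (1/p) / (s powr n) powr (1/p)"
      unfolding n_def using s0 by (subst powr_divide) (auto simp: P_def powr_realpow)
    also have "\<dots> = P powr (1/p) * s powr (- n / p)"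
      by (simp add: powr_powr powr_minus_divide)
    finally have e: "(P / s ^ CARD('n)) powr (1/p) = P powr (1/p) * s powr (- n / p)" .
    have "(\<integral>\<^sup>+x. ennreal (norm (grad w (s *\<^sub>R x)) * (norm x * f x)) \<partial>lborel) = ennreal (\<integral>x. norm (grad w (s *\<^sub>R x)) * (norm x * f x) \<partial>lborel)"
      by (rule nn_integral_eq_integral[OF H(1)]) (use f0 in auto)
    also have "\<dots> \<le> ennreal ((P / s ^ CARD('n)) powr (1/p) * A powr (1/q))"
      using H(2) PS(2) pq by (intro ennreal_leI) (simp add: P_def)
    finally show ?thesis unfolding e by (simp add: mult_ac)
  qed
  \<comment> \<open>The origin lies on no ray and is left out as a null set.\<close>
  have "(\<integral>\<^sup>+x. ennreal (f x * \<bar>w x\<bar>) \<partial>lborel)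
      \<le> (\<integral>\<^sup>+x. (\<integral>\<^sup>+s. indicator {1..} s * ennreal (norm (grad w (s *\<^sub>R x)) * (norm x * f x)) \<partial>lborel) \<partial>lborel)"
    by (rule nn_integral_mono_AE, rule AE_mp[OF AE_lborel_singleton[of 0]]) (use pointwise in auto)
  also have "\<dots> = (\<integral>\<^sup>+s. (\<integral>\<^sup>+x. indicator {1..} s * ennreal (norm (grad w (s *\<^sub>R x)) * (norm x * f x)) \<partial>lborel) \<partial>lborel)"
    by (rule lborel_pair.Fubini'[symmetric]) measurable
  also have "\<dots> = (\<integral>\<^sup>+s. indicator {1..} s * (\<integral>\<^sup>+x. ennreal (norm (grad w (s *\<^sub>R x)) * (norm x * f x)) \<partial>lborel) \<partial>lborel)"
    by (intro nn_integral_cong nn_integral_cmult) measurable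
  also have "\<dots> \<le> (\<integral>\<^sup>+s. ennreal (P powr (1/p) * A powr (1/q)) * ennreal (indicator {1..} s * s powr (- n / p)) \<partial>lborel)"
    by (rule nn_integral_mono) (use inner in \<open>auto split: split_indicator simp: ennreal_mult[symmetric]\<close>)
  also have "\<dots> = ennreal (P powr (1/p) * A powr (1/q)) * (\<integral>\<^sup>+s. ennreal (indicator {1..} s * s powr (- n / p)) \<partial>lborel)"
    by (rule nn_integral_cmult) measurable
  also have "(\<integral>\<^sup>+s. ennreal (indicator {1..} s * s powr (- n / p)) \<partial>lborel) = ennreal (p / (n - p))"
  proof -
    \<comment> \<open>Here \<open>n > p\<close> is used: the integral of the power converges and
      produces Hardy's constant \<open>p / (n - p)\<close>.\<close>
    have "- n / p < - 1" using n0 pq by (simp add: field_simps)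
    from has_integral_powr_to_inf[OF this, of 1]
    have "((\<lambda>x::real. x powr (- n / p)) has_integral - (1 / (- n / p + 1))) {1..}" by simp
    moreover have "- (1 / (- n / p + 1)) = p / (n - p)" using n0 pq by (simp add: field_simps)
    ultimately show ?thesis by (intro nn_integral_has_integral_lebesgue) auto
  qed
  also have "ennreal (P powr (1/p) * A powr (1/q)) * ennreal (p / (n - p)) = ennreal (p / (n - p) * A powr (1/q) * P powr (1/p))"
    using n0 pq by (subst ennreal_mult[symmetric]) (auto simp: mult_ac)
  finally show ?thesis by (simp add: n_def A_def P_def pint_lborel)
qed

section \<open>Radial data\<close>

text \<open>Polar coordinates without surface measure: the image of Lebesgue measure under the norm
  is identified by its values on the half lines \<open>{..r}\<close>, which are volumes of balls,
  and these half lines generate the Borel sets.\<close>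

lemma nn_integral_radial:
  fixes g :: "real \<Rightarrow> ennreal"
  assumes [measurable]: "g \<in> borel_measurable borel"
  shows "(\<integral>\<^sup>+x. g (norm (x::real^'n)) \<partial>lborel) =
    (\<integral>\<^sup>+r. (indicator {0..} r * ennreal (real CARD('n) * unit_ball_vol (real CARD('n)) * r ^ (CARD('n) - 1))) * g r \<partial>lborel)"
proof -
  define N where "N = CARD('n)"
  have N: "N > 0" by (simp add: N_def)
  define V where "V = unit_ball_vol (real N)"
  have V: "V \<ge> 0" by (simp add: V_def)
  define d where "d r = indicator {0..} r * ennreal (real N * V * r ^ (N - 1))" for r :: real
  have [measurable]: "d \<in> borel_measurable borel" unfolding d_def by measurable
  have ball: "emeasure lborel {x::real^'n. norm x \<le> r} = (if r < 0 then 0 else ennreal (V * r ^ N))" for r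
  proof (cases "r < 0")
    case False
    have "{x::real^'n. norm x \<le> r} = cball 0 r" by auto
    then show ?thesis using emeasure_cball[of r "0::real^'n"] False by (simp add: V_def N_def)
  next
    case True
    then have "{x::real^'n. norm x \<le> r} = {}" by (auto simp: not_le intro: less_le_trans[OF _ norm_ge_zero])
    then show ?thesis using True by simp
  qed
  have den: "(\<integral>\<^sup>+t. d t * indicator {..r} t \<partial>lborel) = (if r < 0 then 0 else ennreal (V * r ^ N))" for r
  proof (cases "r < 0")
    case True
    then have "(\<integral>\<^sup>+t. d t * indicator {..r} t \<partial>lborel) = (\<integral>\<^sup>+t. 0 \<partial>(lborel :: real measure))"
      by (intro nn_integral_cong) (auto simp: d_def split: split_indicator)
    then show ?thesis using True by simp
  next
    case False
    have "(\<integral>\<^sup>+t. d t * indicator {..r} t \<partial>lborel) = (\<integral>\<^sup>+t. ennreal (real N * V * t ^ (N - 1)) * indicator {0..r} t \<partial>lborel)"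
      by (rule nn_integral_cong) (auto simp: d_def split: split_indicator)
    also have "\<dots> = ennreal (V * r ^ N - V * 0 ^ N)"
    proof (rule nn_integral_FTC_Icc)
      show "((\<lambda>r. V * r ^ N) has_real_derivative real N * V * t ^ (N - 1)) (at t)" for t
        by (auto intro!: derivative_eq_intros)
    qed (use False V in auto)
    finally show ?thesis using False by (simp add: zero_power[OF N])
  qed
  have "distr lborel borel (norm :: real^'n \<Rightarrow> real) = density lborel d"
  proof (rule measure_eqI_generator_eq[where E = "range atMost" and \<Omega> = UNIV and A = "\<lambda>i. {..real i}"])
    show "Int_stable (range atMost :: real set set)"
      by (auto simp: Int_stable_def)
    show "emeasure (distr lborel borel (norm :: real^'n \<Rightarrow> real)) X = emeasure (density lborel d) X" if "X \<in> range atMost" for X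
    proof -
      obtain r where X: "X = {..r}" using \<open>X \<in> range atMost\<close> by blast
      have "emeasure (distr lborel borel (norm :: real^'n \<Rightarrow> real)) X = emeasure lborel {x::real^'n. norm x \<le> r}"
        unfolding X by (subst emeasure_distr) (auto intro!: arg_cong[where f = "emeasure lborel"])
      also have "\<dots> = emeasure (density lborel d) X"
        unfolding X ball by (subst emeasure_density) (auto simp: den)
      finally show ?thesis .
    qed
    show "emeasure (distr lborel borel (norm :: real^'n \<Rightarrow> real)) {..real i} \<noteq> \<infinity>" for i
      using ball[of "real i"] by (subst emeasure_distr) (auto simp: vimage_def)
    show "(\<Union>i. {..real i}) = UNIV" using real_arch_simple by auto
  qed (auto simp: borel_eq_atMost)
  then have "(\<integral>\<^sup>+r. g r \<partial>distr lborel borel (norm :: real^'n \<Rightarrow> real)) = (\<integral>\<^sup>+r. g r \<partial>density lborel d)" by simp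
  then show ?thesis
    by (subst (asm) nn_integral_distr, simp, simp, subst (asm) nn_integral_density) (simp_all add: d_def N_def V_def)
qed

text \<open>\<open>F\<close> is monotone on the nonnegative half line and arbitrary elsewhere;
  freezing it to the left of 0 gives a function monotone on the whole line, hence Borel.\<close>

lemma borel_measurable_radial_antimono:
  fixes F :: "real \<Rightarrow> real"
  assumes "\<forall>r t. 0 \<le> r \<longrightarrow> r \<le> t \<longrightarrow> F t \<le> F r"
  shows "(\<lambda>r. F (max r 0)) \<in> borel_measurable borel" "(\<lambda>x::'a::euclidean_space. F (norm x)) \<in> borel_measurable borel"
proof -
  have "mono (\<lambda>r. - F (max r 0))" using assms by (intro monoI) auto
  then have "(\<lambda>r. - F (max r 0)) \<in> borel_measurable borel" by (rule borel_measurable_mono)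
  from borel_measurable_uminus[OF this] show m[measurable]: "(\<lambda>r. F (max r 0)) \<in> borel_measurable borel" by simp
  have "(\<lambda>x::'a. F (max (norm x) 0)) \<in> borel_measurable borel" by measurable
  then show "(\<lambda>x::'a. F (norm x)) \<in> borel_measurable borel" by simp
qed

text \<open>
  Monotonicity gives \<open>F(r) \<le> C r\<^bsup>-(a+1)\<^esup>\<close> for \<open>a = n(p-1)/p\<close>, and
  \<open>q + n - 1 - (a+1)(q-1) = a\<close> turns this into \<open>(r F(r))\<^sup>q r\<^bsup>n-1\<^esup> \<le> C r\<^sup>a F(r)\<close>.
\<close>

lemma radial_weight_integrable:
  fixes F :: "real \<Rightarrow> real"
  assumes pq: "p > 1" "q > 1" "1/p + 1/q = 1"
    and F0: "\<forall>r\<ge>0. F r \<ge> 0"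
    and mono: "\<forall>r t. 0 \<le> r \<longrightarrow> r \<le> t \<longrightarrow> F t \<le> F r"
    and int: "(\<integral>\<^sup>+r\<in>{0..}. ennreal (r powr (real CARD('n) * (p - 1) / p) * F r) \<partial>lborel) < \<infinity>"
  shows "integrable lborel (\<lambda>x::real^'n. (norm x * F (norm x)) powr q)"
proof -
  define n where "n = real CARD('n)"
  define a where "a = n * (p - 1) / p"
  have n: "n \<ge> 1" by (simp add: n_def Suc_leI)
  have a: "a > 0" using n pq by (simp add: a_def)
  note [measurable] = borel_measurable_radial_antimono[OF mono]
  define G where "G r = F (max r 0)" for r
  have Gm[measurable]: "G \<in> borel_measurable borel" unfolding G_def by measurable
  have GF: "G r = F r" if "r \<ge> 0" for r using that by (simp add: G_def)
  define I where "I = (\<integral>\<^sup>+r. ennreal (r powr a * G r) * indicator {0..} r \<partial>lborel)"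
  have "I = (\<integral>\<^sup>+r\<in>{0..}. ennreal (r powr a * F r) \<partial>lborel)"
    unfolding I_def by (rule nn_integral_cong) (auto simp: GF split: split_indicator)
  then have Ifin: "I < \<infinity>" using int by (simp add: a_def n_def)
  then obtain J where J: "I = ennreal J" "J \<ge> 0" by (cases I) auto
  \<comment> \<open>On \<open>{0..r}\<close> the function is at least \<open>F r\<close>, so the
    weighted integral \<open>J\<close> dominates \<open>F r\<close> times the integral of the power
    over \<open>{0..r}\<close>.\<close>
  have bound: "F r * (r powr (a + 1) / (a + 1)) \<le> J" if r: "r > 0" for r
  proof -
    have "(\<integral>\<^sup>+t. ennreal (indicator {0..r} t * t powr a) \<partial>lborel) = ennreal (r powr (a + 1) / (a + 1))"
      by (rule nn_integral_has_integral_lebesgue[OF _ has_integral_powr_from_0]) (use a r in auto)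
    then have "ennreal (F r * (r powr (a + 1) / (a + 1))) = ennreal (F r) * (\<integral>\<^sup>+t. ennreal (indicator {0..r} t * t powr a) \<partial>lborel)"
      using F0 r a by (subst ennreal_mult) auto
    also have "\<dots> = (\<integral>\<^sup>+t. ennreal (F r) * ennreal (indicator {0..r} t * t powr a) \<partial>lborel)"
      by (rule nn_integral_cmult[symmetric]) measurable
    also have "\<dots> \<le> I" unfolding I_def
    proof (rule nn_integral_mono)
      fix t :: real
      show "ennreal (F r) * ennreal (indicator {0..r} t * t powr a) \<le> ennreal (t powr a * G t) * indicator {0..} t"
      proof (cases "t \<in> {0..r}")
        case True
        then have "F r \<le> G t" using mono by (simp add: GF)
        then have "F r * t powr a \<le> t powr a * G t" by (simp add: mult.commute[of "F r"] mult_left_mono)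
        then show ?thesis using True F0 r by (simp add: ennreal_mult[symmetric] ennreal_leI)
      qed simp
    qed
    finally show ?thesis using J by simp
  qed
  have q1: "q - 1 = 1 / (p - 1)" using pq by (simp add: field_simps)
  define K where "K = ((a + 1) * J) powr (q - 1)"
  have key: "(r * G r) powr q * r ^ (CARD('n) - 1) \<le> K * (r powr a * G r)" if r: "r > 0" for r
  proof (cases "F r = 0")
    case True
    then show ?thesis using r by (simp add: GF)
  next
    case False
    then have Fp: "F r > 0" using F0 r by (metis less_eq_real_def)
    define X where "X = r powr (a + 1)"
    have X: "X > 0" "r powr (- (a + 1)) = 1 / X" using r by (simp_all add: X_def powr_minus_divide[symmetric])
    have "F r * X \<le> (a + 1) * J" using bound[OF r] a by (simp add: X_def[symmetric] divide_le_eq mult.commute)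
    then have "F r \<le> (a + 1) * J * r powr (- (a + 1))" unfolding X(2) using X(1) by (simp add: pos_le_divide_eq)
    then have "F r powr (q - 1) \<le> ((a + 1) * J * r powr (- (a + 1))) powr (q - 1)"
      using Fp pq by (intro powr_mono2) auto
    also have "\<dots> = K * r powr (- (a + 1) * (q - 1))"
      using a J by (subst powr_mult) (auto simp: K_def powr_powr)
    finally have Fq: "F r powr (q - 1) \<le> K * r powr (- (a + 1) * (q - 1))" .
    have "r ^ (CARD('n) - 1) = r powr (n - 1)"
      using r by (subst powr_realpow[symmetric]) (auto simp: n_def of_nat_diff Suc_leI)
    then have "(r * G r) powr q * r ^ (CARD('n) - 1) = F r powr (1 + (q - 1)) * r powr (q + (n - 1))"
      using r Fp by (simp add: GF powr_mult powr_add)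
    also have "\<dots> = F r * F r powr (q - 1) * r powr (q + (n - 1))"
      using Fp by (subst powr_add) simp
    also have "\<dots> \<le> F r * (K * r powr (- (a + 1) * (q - 1))) * r powr (q + (n - 1))"
      using Fq Fp by (intro mult_right_mono mult_left_mono) auto
    also have "\<dots> = K * F r * r powr (- (a + 1) * (q - 1) + (q + (n - 1)))"
      by (simp add: powr_add)
    also have "- (a + 1) * (q - 1) + (q + (n - 1)) = a"
    proof -
      have 1: "a * (1 / (p - 1)) = n / p" using pq by (simp add: a_def)
      have 2: "a = n - n / p" using pq by (simp add: a_def right_diff_distrib diff_divide_distrib)
      have "(a + 1) * (q - 1) = a * (1 / (p - 1)) + (q - 1)" unfolding q1 by (simp add: algebra_simps add_divide_distrib)
      then show ?thesis unfolding 1 using 2 by (simp only: minus_mult_left[symmetric])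
    qed
    finally show ?thesis using r by (simp add: GF mult_ac)
  qed
  define c where "c = n * unit_ball_vol n"
  have c: "c \<ge> 0" using n by (simp add: c_def)
  have K: "K \<ge> 0" by (simp add: K_def)
  have "(\<integral>\<^sup>+x. ennreal ((norm (x::real^'n) * G (norm x)) powr q) \<partial>lborel)
      = (\<integral>\<^sup>+r. (indicator {0..} r * ennreal (c * r ^ (CARD('n) - 1))) * ennreal ((r * G r) powr q) \<partial>lborel)"
    unfolding c_def n_def by (rule nn_integral_radial) measurable
  also have "\<dots> \<le> (\<integral>\<^sup>+r. ennreal (c * K) * (ennreal (r powr a * G r) * indicator {0..} r) \<partial>lborel)"
  proof (rule nn_integral_mono_AE, rule AE_mp[OF AE_lborel_singleton[of 0]], rule AE_I2, rule impI)
    fix r :: real assume r: "r \<noteq> 0"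
    show "(indicator {0..} r * ennreal (c * r ^ (CARD('n) - 1))) * ennreal ((r * G r) powr q)
      \<le> ennreal (c * K) * (ennreal (r powr a * G r) * indicator {0..} r)"
    proof (cases "r > 0")
      case True
      have "c * ((r * G r) powr q * r ^ (CARD('n) - 1)) \<le> c * (K * (r powr a * G r))"
        by (rule mult_left_mono[OF key[OF True] c])
      then have "ennreal (c * r ^ (CARD('n) - 1) * (r * G r) powr q) \<le> ennreal (c * K * (r powr a * G r))"
        by (intro ennreal_leI) (simp add: mult_ac)
      then show ?thesis using True c K F0 by (simp add: ennreal_mult GF)
    next
      case False
      then show ?thesis using r by simp
    qed
  qed
  also have "\<dots> = ennreal (c * K) * I" unfolding I_def by (rule nn_integral_cmult) measurable
  also have "\<dots> < \<infinity>" using J by (simp add: ennreal_mult_less_top)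
  finally have fin: "(\<integral>\<^sup>+x. ennreal ((norm (x::real^'n) * G (norm x)) powr q) \<partial>lborel) < \<infinity>" .
  have "integrable lborel (\<lambda>x::real^'n. (norm x * G (norm x)) powr q)"
    by (rule integrableI_bounded) (use fin in auto)
  then show ?thesis by (simp add: GF)
qed

section \<open>Dyadic cells and separability\<close>

text \<open>Index of the half-open dyadic cube of side \<open>1 / 2 ^ j\<close> that contains
  \<open>x\<close>. Indices are integer vectors, so there are countably many; they serve to
  discretise both points of the domain and values of gradients.\<close>

definition dyad :: "nat \<Rightarrow> real^'n \<Rightarrow> int^'n" where
  "dyad j x = (\<chi> i. \<lfloor>2 ^ j * x $ i\<rfloor>)"

lemma dyad_eq_norm_le:
  fixes x y :: "real^'n"
  assumes "dyad j x = dyad j y"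
  shows "norm (x - y) \<le> real CARD('n) / 2 ^ j"
proof -
  have c: "\<bar>(x - y) $ i\<bar> \<le> 1 / 2 ^ j" for i
  proof -
    have "\<lfloor>2 ^ j * x $ i\<rfloor> = \<lfloor>2 ^ j * y $ i\<rfloor>" using assms by (simp add: dyad_def vec_eq_iff)
    then have "\<bar>2 ^ j * x $ i - 2 ^ j * y $ i\<bar> \<le> 1" by linarith
    then have "2 ^ j * \<bar>x $ i - y $ i\<bar> \<le> 1" by (simp add: right_diff_distrib[symmetric] abs_mult)
    then show ?thesis by (simp add: pos_le_divide_eq mult.commute)
  qed
  have "norm (x - y) \<le> (\<Sum>i\<in>UNIV. \<bar>(x - y) $ i\<bar>)" by (rule norm_le_l1_cart)
  also have "\<dots> \<le> (\<Sum>i\<in>(UNIV::'n set). 1 / 2 ^ j)" by (rule sum_mono) (rule c)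
  finally show ?thesis by simp
qed

lemma finite_dyad_cball: "finite (dyad j ` cball (0::real^'n) R)"
proof -
  define M where "M = \<lceil>2 ^ j * \<bar>R\<bar>\<rceil>"
  have "dyad j ` cball (0::real^'n) R \<subseteq> (\<lambda>f. \<chi> i. f i) ` (PiE UNIV (\<lambda>_. {-M..M}))"
  proof
    fix z assume "z \<in> dyad j ` cball (0::real^'n) R"
    then obtain x where x: "norm x \<le> R" "z = dyad j x" by auto
    have "z $ i \<in> {-M..M}" for i
    proof -
      have "\<bar>x $ i\<bar> \<le> \<bar>R\<bar>" using component_le_norm_cart[of x i] x by linarith
      then have "\<bar>2 ^ j * x $ i\<bar> \<le> 2 ^ j * \<bar>R\<bar>" by (simp add: abs_mult)
      then have "- (2 ^ j * \<bar>R\<bar>) \<le> 2 ^ j * x $ i" "2 ^ j * x $ i \<le> 2 ^ j * \<bar>R\<bar>" by linarith+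
      then have "- M \<le> \<lfloor>2 ^ j * x $ i\<rfloor>" "\<lfloor>2 ^ j * x $ i\<rfloor> \<le> M" unfolding M_def by linarith+
      then show ?thesis by (simp add: x(2) dyad_def)
    qed
    then show "z \<in> (\<lambda>f. \<chi> i. f i) ` (PiE UNIV (\<lambda>_. {-M..M}))"
      by (intro image_eqI[of _ _ "\<lambda>i. z $ i"]) auto
  qed
  then show ?thesis by (rule finite_subset) (intro finite_imageI finite_PiE, auto)
qed

lemma dyad_cell_measurable[measurable]: "{y. dyad j y = z} \<in> sets borel"
proof -
  have "{y. dyad j y = z} = (\<Inter>i\<in>UNIV. {y. \<lfloor>2 ^ j * y $ i\<rfloor> = z $ i})"
    by (auto simp: dyad_def vec_eq_iff)
  moreover have "{y::real^'a. \<lfloor>2 ^ j * y $ i\<rfloor> = z $ i} \<in> sets borel" for i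
  proof -
    have "{y::real^'a. \<lfloor>2 ^ j * y $ i\<rfloor> = z $ i} = {y. of_int (z $ i) \<le> 2 ^ j * y $ i} \<inter> {y. 2 ^ j * y $ i < of_int (z $ i) + 1}"
      by (auto simp: floor_eq_iff)
    also have "\<dots> \<in> sets borel"
      by (intro sets.Int borel_closed borel_open closed_Collect_le open_Collect_less continuous_intros)
    finally show ?thesis .
  qed
  ultimately show ?thesis by auto
qed

lemma measurable_dyad_eq[measurable]:
  assumes [measurable]: "f \<in> M \<rightarrow>\<^sub>M borel" "g \<in> M \<rightarrow>\<^sub>M borel"
  shows "Measurable.pred M (\<lambda>x. dyad j (f x :: real^'n) = dyad j (g x))"
proof -
  have [measurable]: "(\<lambda>x. f x $ i) \<in> borel_measurable M" "(\<lambda>x. g x $ i) \<in> borel_measurable M" for i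
    using measurable_compose[OF assms(1) borel_measurable_continuous_onI[OF continuous_on_component[OF continuous_on_id]]]
      measurable_compose[OF assms(2) borel_measurable_continuous_onI[OF continuous_on_component[OF continuous_on_id]]] by simp_all
  have "Measurable.pred M (\<lambda>x. \<forall>i. \<lfloor>2 ^ j * f x $ i\<rfloor> = \<lfloor>2 ^ j * g x $ i\<rfloor>)" by measurable
  then show ?thesis by (simp add: dyad_def vec_eq_iff)
qed

lemma dyad_cell_emeasure_ge:
  "ennreal ((1 / 2 ^ j) ^ CARD('n)) \<le> emeasure lborel {y::real^'n. dyad j y = dyad j x}"
proof -
  define a :: "real^'n" where "a = (\<chi> i. of_int \<lfloor>2 ^ j * x $ i\<rfloor> / 2 ^ j)"
  define b :: "real^'n" where "b = (\<chi> i. a $ i + 1 / 2 ^ j)"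
  have "box a b \<subseteq> {y. dyad j y = dyad j x}"
  proof
    fix y assume "y \<in> box a b"
    then have y: "a $ i < y $ i" "y $ i < a $ i + 1 / 2 ^ j" for i by (auto simp: mem_box_cart b_def)
    have "\<lfloor>2 ^ j * y $ i\<rfloor> = \<lfloor>2 ^ j * x $ i\<rfloor>" for i
    proof -
      have "of_int \<lfloor>2 ^ j * x $ i\<rfloor> < 2 ^ j * y $ i" "2 ^ j * y $ i < of_int \<lfloor>2 ^ j * x $ i\<rfloor> + 1"
        using y[of i] by (simp_all add: a_def field_simps)
      then show ?thesis by linarith
    qed
    then show "y \<in> {y. dyad j y = dyad j x}" by (simp add: dyad_def vec_eq_iff)
  qed
  then have "emeasure lborel (box a b) \<le> emeasure lborel {y. dyad j y = dyad j x}"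
    by (rule emeasure_mono) simp
  moreover have "emeasure lborel (box a b) = ennreal (\<Prod>i\<in>(Basis::(real^'n) set). (b - a) \<bullet> i)"
    by (rule emeasure_lborel_box) (auto simp: Basis_vec_def inner_axis b_def)
  moreover have "(\<Prod>i\<in>(Basis::(real^'n) set). (b - a) \<bullet> i) = (\<Prod>i\<in>(Basis::(real^'n) set). 1 / 2 ^ j)"
    by (rule prod.cong) (auto simp: Basis_vec_def inner_axis b_def)
  ultimately show ?thesis by simp
qed

text \<open>
  A test function is determined up to a small error in \<open>\<nabla>\<phi>\<close> by its support radius and by the finite set
  of pairs (dyadic cell of \<open>x\<close>, dyadic cell of \<open>\<nabla>\<phi>(x)\<close>), and there are only countably many such data.
\<close>

lemma test_fun_separable:
  assumes p: "p > 0"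
  obtains \<phi> :: "nat \<Rightarrow> real^'n \<Rightarrow> real" where "\<And>j. test_fun (\<phi> j)"
    "\<And>\<psi> e. test_fun \<psi> \<Longrightarrow> e > 0 \<Longrightarrow> \<exists>j. pint p lebesgue (\<lambda>x. grad \<psi> x - grad (\<phi> j) x) \<le> e"
proof -
  define T where "T R = {w::real^'n \<Rightarrow> real. test_fun w \<and> (\<forall>x. norm x \<ge> real R \<longrightarrow> grad w x = 0)}" for R :: nat
  define code where "code R k w = (\<lambda>x. (dyad k x, dyad k (grad w x))) ` cball 0 (real R)" for R k :: nat and w :: "real^'n \<Rightarrow> real"
  have Tex: "\<exists>R. w \<in> T R" if tw: "test_fun w" for w
  proof -
    obtain R where R: "\<forall>x. norm x \<ge> R \<longrightarrow> w x = 0 \<and> grad w x = 0" using test_fun_C1(4)[OF tw] by blast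
    obtain R' where "R \<le> real R'" using real_arch_simple by blast
    then have "w \<in> T R'" using R tw by (auto simp: T_def)
    then show ?thesis ..
  qed
  have fin: "finite (code R k w)" if w: "w \<in> T R" for R k w
  proof -
    have tw: "test_fun w" using w by (simp add: T_def)
    have 0: "grad w x = 0" if "norm x \<ge> real R" for x using w that by (simp add: T_def)
    obtain B where B: "B > 0" "\<And>x. norm (grad w x) \<le> B"
      by (rule bounded_of_compact_support[where R = "real R", OF test_fun_C1(3)[OF tw] 0]) (assumption, rule that)
    have "code R k w \<subseteq> dyad k ` cball 0 (real R) \<times> dyad k ` cball 0 B"
      using B by (auto simp: code_def)
    then show ?thesis by (rule finite_subset) (intro finite_cartesian_product finite_dyad_cball)
  qed
  define I where "I = {(R, k, c). \<exists>w\<in>T R. code R k w = c}"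
  define rep where "rep = (\<lambda>(R, k, c). SOME w. w \<in> T R \<and> code R k w = c)"
  have rep: "rep (R, k, c) \<in> T R \<and> code R k (rep (R, k, c)) = c" if "(R, k, c) \<in> I" for R k c
  proof -
    have "\<exists>w. w \<in> T R \<and> code R k w = c" using that by (auto simp: I_def)
    then show ?thesis unfolding rep_def prod.case by (rule someI_ex)
  qed
  have "I \<subseteq> UNIV \<times> (UNIV \<times> Collect finite)" using fin by (auto simp: I_def)
  moreover have "countable ((UNIV::nat set) \<times> ((UNIV::nat set) \<times> (Collect finite :: ((int^'n) \<times> (int^'n)) set set)))"
    by (intro countable_SIGMA countable_Collect_finite) auto
  ultimately have cI: "countable I" by (rule countable_subset)
  have "(\<lambda>x. 0) \<in> T 0" by (simp add: T_def test_fun_0 grad_zero)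
  then have Ine: "I \<noteq> {}" unfolding I_def by blast
  define \<phi> where "\<phi> j = rep (from_nat_into I j)" for j
  show ?thesis
  proof (rule that[of \<phi>])
    show "test_fun (\<phi> j)" for j
    proof -
      have "from_nat_into I j \<in> I" by (rule from_nat_into[OF Ine])
      then show ?thesis unfolding \<phi>_def using rep by (cases "from_nat_into I j") (auto simp: T_def)
    qed
    fix \<psi> :: "real^'n \<Rightarrow> real" and e :: real assume \<psi>: "test_fun \<psi>" and e: "e > 0"
    obtain R where R: "\<psi> \<in> T R" using Tex[OF \<psi>] by blast
    \<comment> \<open>The summand 1 keeps the divisor in \<open>d\<close> positive for
      \<open>R = 0\<close>.\<close>
    define m where "m = measure lebesgue (cball (0::real^'n) (real R)) + 1"
    have m: "m > 0" by (simp add: m_def add_nonneg_pos)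
    define d where "d = (e / m) powr (1 / p)"
    have d: "d > 0" "d powr p \<le> e / m" using e m p by (auto simp: powr_powr d_def)
    have "uniformly_continuous_on (cball 0 (real R)) (grad \<psi>)"
      by (intro compact_uniformly_continuous continuous_on_subset[OF test_fun_C1(3)[OF \<psi>]]) auto
    then obtain \<delta> where \<delta>: "\<delta> > 0" "\<And>x y. norm x \<le> real R \<Longrightarrow> norm y \<le> real R \<Longrightarrow> dist x y < \<delta> \<Longrightarrow> dist (grad \<psi> x) (grad \<psi> y) < d / 2"
      unfolding uniformly_continuous_on_def using d(1) half_gt_zero[OF d(1)] by (metis mem_cball_0 dist_commute)
    \<comment> \<open>Fine enough that points in one cell are closer than \<open>\<delta>\<close>
      and gradient values in one cell closer than \<open>d / 2\<close>.\<close>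
    define \<gamma> where "\<gamma> = min \<delta> (d / 2) / real CARD('n)"
    have "\<gamma> > 0" using \<delta> d by (simp add: \<gamma>_def)
    then obtain k where k: "(1/2) ^ k < \<gamma>" using real_arch_pow_inv[of \<gamma> "1/2"] by auto
    have k': "real CARD('n) / 2 ^ k < \<delta>" "real CARD('n) / 2 ^ k < d / 2"
    proof -
      have "real CARD('n) * (1/2) ^ k < real CARD('n) * \<gamma>" using k by (intro mult_strict_left_mono) auto
      also have "\<dots> = min \<delta> (d / 2)" by (simp add: \<gamma>_def)
      finally show "real CARD('n) / 2 ^ k < \<delta>" "real CARD('n) / 2 ^ k < d / 2" by (auto simp: power_one_over)
    qed
    define c where "c = code R k \<psi>"
    have cI': "(R, k, c) \<in> I" using R by (auto simp: I_def c_def)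
    obtain j where j: "from_nat_into I j = (R, k, c)" using from_nat_into_surj[OF cI cI'] by blast
    have r: "\<phi> j \<in> T R" "code R k (\<phi> j) = code R k \<psi>" using rep[OF cI'] by (auto simp: \<phi>_def j c_def)
    have out: "grad \<psi> x - grad (\<phi> j) x = 0" if "norm x \<ge> real R" for x using r R that by (auto simp: T_def)
    have close: "norm (grad \<psi> x - grad (\<phi> j) x) \<le> d" for x
    proof (cases "norm x \<le> real R")
      case True
      then have "(dyad k x, dyad k (grad (\<phi> j) x)) \<in> code R k (\<phi> j)"
        unfolding code_def by (intro image_eqI[OF refl]) simp
      then have "(dyad k x, dyad k (grad (\<phi> j) x)) \<in> code R k \<psi>"
        unfolding r(2) .
      \<comment> \<open>Equal codes provide a point \<open>y\<close> in the cell of \<open>x\<close>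
        at which the gradient of \<open>\<psi>\<close> is near that of \<open>\<phi> j\<close> at
        \<open>x\<close>; uniform continuity of the former moves \<open>y\<close> back to
        \<open>x\<close>.\<close>
      then obtain y where y: "norm y \<le> real R" "dyad k x = dyad k y" "dyad k (grad (\<phi> j) x) = dyad k (grad \<psi> y)"
        by (auto simp: code_def)
      have "dist x y < \<delta>" using dyad_eq_norm_le[OF y(2)] k' by (simp add: dist_norm)
      then have 1: "norm (grad \<psi> x - grad \<psi> y) < d / 2" using \<delta>(2) True y(1) by (simp add: dist_norm)
      have 2: "norm (grad \<psi> y - grad (\<phi> j) x) < d / 2"
        using order.strict_trans1[OF dyad_eq_norm_le[OF y(3)] k'(2)] by (simp only: norm_minus_commute)
      have "norm (grad \<psi> x - grad (\<phi> j) x) \<le> norm (grad \<psi> x - grad \<psi> y) + norm (grad \<psi> y - grad (\<phi> j) x)"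
        using norm_triangle_ineq[of "grad \<psi> x - grad \<psi> y" "grad \<psi> y - grad (\<phi> j) x"] by simp
      then show ?thesis using 1 2 by argo
    next
      case False
      then show ?thesis using out[of x] d by simp
    qed
    have meas: "cball (0::real^'n) (real R) \<in> sets lebesgue" "emeasure lebesgue (cball (0::real^'n) (real R)) < \<infinity>"
      using emeasure_bounded_finite[OF bounded_cball[of "0::real^'n" "real R"]] by auto
    have ptw: "norm (grad \<psi> x - grad (\<phi> j) x) powr p \<le> (e / m) * indicat_real (cball 0 (real R)) x" for x
    proof (cases "norm x \<ge> real R \<or> norm (grad \<psi> x - grad (\<phi> j) x) = 0")
      case True
      then have "norm (grad \<psi> x - grad (\<phi> j) x) = 0" using out by auto
      then show ?thesis using e m by (simp add: mult_nonneg_nonneg split: split_indicator)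
    next
      case False
      have "norm (grad \<psi> x - grad (\<phi> j) x) powr p \<le> d powr p" by (rule powr_mono2[OF _ _ close]) (use p in simp_all)
      also have "\<dots> \<le> e / m" by (rule d(2))
      finally show ?thesis using False by (simp split: split_indicator)
    qed
    have "pint p lebesgue (\<lambda>x. grad \<psi> x - grad (\<phi> j) x) \<le> (\<integral>x. (e / m) * indicat_real (cball (0::real^'n) (real R)) x \<partial>lebesgue)"
      unfolding pint_def
    proof (rule integral_mono)
      have "Lp p lebesgue (\<lambda>x. grad \<psi> x - grad (\<phi> j) x)"
        by (rule Lp_compact_support[OF _ out])
           (use r \<psi> p in \<open>auto intro!: continuous_intros test_fun_C1(3) simp: T_def\<close>)
      then show "integrable lebesgue (\<lambda>x. norm (grad \<psi> x - grad (\<phi> j) x) powr p)" by (rule LpD)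
      show "integrable lebesgue (\<lambda>x. (e / m) * indicat_real (cball (0::real^'n) (real R)) x)"
        using meas by (intro integrable_mult_right integrable_real_indicator)
    qed (rule ptw)
    also have "\<dots> = (e / m) * (m - 1)" using meas by (simp add: m_def)
    also have "\<dots> \<le> e" using e m by (simp add: field_simps)
    finally show "\<exists>j. pint p lebesgue (\<lambda>x. grad \<psi> x - grad (\<phi> j) x) \<le> e" ..
  qed
qed

section \<open>Rellich compactness\<close>

lemma cball_in_borel[measurable]: "cball (a::'a::euclidean_space) r \<in> sets borel"
  by (rule borel_closed) simp

lemma integrable_ball_weight:
  assumes "q > 0"
  shows "integrable lborel (\<lambda>x::real^'n. (norm x * indicat_real (cball 0 R) x) powr q)"
proof (rule Bochner_Integration.integrable_bound)
  show "integrable lborel (\<lambda>x::real^'n. \<bar>R\<bar> powr q * indicat_real (cball 0 R) x)"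
    using emeasure_bounded_finite[OF bounded_cball[of "0::real^'n" R]] by (intro integrable_mult_right integrable_real_indicator) auto
  have "(norm x * indicat_real (cball 0 R) x) powr q \<le> \<bar>R\<bar> powr q * indicat_real (cball 0 R) x" for x :: "real^'n"
  proof (cases "norm x \<le> R")
    case True
    then have "norm x powr q \<le> \<bar>R\<bar> powr q" using assms by (intro powr_mono2) auto
    then show ?thesis using True by simp
  qed (use assms in simp)
  then show "AE x in lborel. norm ((norm x * indicat_real (cball (0::real^'n) R) x) powr q) \<le> norm (\<bar>R\<bar> powr q * indicat_real (cball 0 R) x)"
    by (intro always_eventually allI) simp
qed measurable

text \<open>The dual Hardy inequality with the indicator of a ball as datum: gradient energy alone
  controls the function locally.\<close>

lemma hardy_local_L1:
  assumes pq: "p > 1" "q > 1" "1/p + 1/q = 1" and n: "real CARD('n) > p"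
  obtains C where "C \<ge> 0"
    "\<And>w :: real^'n \<Rightarrow> real. test_fun w \<Longrightarrow> (\<integral>\<^sup>+x. indicator (cball 0 R) x * ennreal \<bar>w x\<bar> \<partial>lborel) \<le> ennreal (C * pint p lebesgue (grad w) powr (1/p))"
proof -
  define C where "C = p / (real CARD('n) - p) * (\<integral>x. (norm x * indicat_real (cball (0::real^'n) R) x) powr q \<partial>lborel) powr (1/q)"
  have "C \<ge> 0" using pq n by (simp add: C_def)
  moreover have "(\<integral>\<^sup>+x. indicator (cball 0 R) x * ennreal \<bar>w x\<bar> \<partial>lborel) \<le> ennreal (C * pint p lebesgue (grad w) powr (1/p))"
    if w: "test_fun w" for w :: "real^'n \<Rightarrow> real"
  proof -
    have "(\<integral>\<^sup>+x. indicator (cball 0 R) x * ennreal \<bar>w x\<bar> \<partial>lborel) = (\<integral>\<^sup>+x. ennreal (indicat_real (cball 0 R) x * \<bar>w x\<bar>) \<partial>lborel)"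
      by (rule nn_integral_cong) (auto split: split_indicator)
    also have "\<dots> \<le> ennreal (C * pint p lebesgue (grad w) powr (1/p))"
      unfolding C_def by (rule hardy_dual[OF pq n w]) (use integrable_ball_weight[of q R] pq in simp_all)
    finally show ?thesis .
  qed
  ultimately show ?thesis by (rule that)
qed

text \<open>The increment is an integral of the gradient along the segment from \<open>x\<close> to
  \<open>x + h\<close>; after Tonelli each shifted integral is moved back by translation invariance.
  The shifts carry the ball of radius \<open>R\<close> into that of radius
  \<open>R + norm h\<close>.\<close>

lemma translate_L1_le:
  fixes w :: "real^'n \<Rightarrow> real"
  assumes w: "test_fun w"
  shows "(\<integral>\<^sup>+x. indicator (cball 0 R) x * ennreal \<bar>w (x + h) - w x\<bar> \<partial>lborel)
    \<le> ennreal (norm h) * (\<integral>\<^sup>+x. indicator (cball 0 (R + norm h)) x * ennreal (norm (grad w x)) \<partial>lborel)"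
proof -
  note C1 = test_fun_C1[OF w]
  have [measurable]: "w \<in> borel_measurable borel" "grad w \<in> borel_measurable borel"
    using C1(2,3) by (auto intro: borel_measurable_continuous_onI)
  define Q where "Q = (\<integral>\<^sup>+x. indicator (cball 0 (R + norm h)) x * ennreal (norm (grad w x)) \<partial>lborel)"
  have inner: "(\<integral>\<^sup>+x. indicator (cball 0 R) x * ennreal (norm h * norm (grad w (x + s *\<^sub>R h))) \<partial>lborel) \<le> ennreal (norm h) * Q"
    if s: "0 \<le> s" "s \<le> 1" for s
  proof -
    have *: "norm (s *\<^sub>R h + x) \<le> R + norm h" if "norm x \<le> R" for x
    proof -
      have "norm (s *\<^sub>R h) \<le> norm h" using s by (simp add: mult_left_le_one_le)
      then show ?thesis using norm_triangle_ineq[of "s *\<^sub>R h" x] that by linarith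
    qed
    have "(\<integral>\<^sup>+x. indicator (cball 0 R) x * ennreal (norm h * norm (grad w (x + s *\<^sub>R h))) \<partial>lborel)
       \<le> (\<integral>\<^sup>+x. ennreal (norm h) * (indicator (cball 0 (R + norm h)) (s *\<^sub>R h + x) * ennreal (norm (grad w (s *\<^sub>R h + x)))) \<partial>lborel)"
      by (rule nn_integral_mono) (use * in \<open>auto split: split_indicator simp: ennreal_mult add.commute\<close>)
    also have "\<dots> = (\<integral>\<^sup>+x. ennreal (norm h) * (indicator (cball 0 (R + norm h)) x * ennreal (norm (grad w x))) \<partial>lborel)"
      by (rule nn_integral_lborel_translate) measurable
    also have "\<dots> = ennreal (norm h) * Q" unfolding Q_def by (rule nn_integral_cmult) measurable
    finally show ?thesis .
  qed
  have "(\<integral>\<^sup>+x. indicator (cball 0 R) x * ennreal \<bar>w (x + h) - w x\<bar> \<partial>lborel)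
     \<le> (\<integral>\<^sup>+x. indicator (cball 0 R) x * (\<integral>\<^sup>+s. indicator {0..1} s * ennreal (norm h * norm (grad w (x + s *\<^sub>R h))) \<partial>lborel) \<partial>lborel)"
  proof (intro nn_integral_mono mult_left_mono)
    fix x
    show "ennreal \<bar>w (x + h) - w x\<bar> \<le> (\<integral>\<^sup>+s. indicator {0..1} s * ennreal (norm h * norm (grad w (x + s *\<^sub>R h))) \<partial>lborel)"
      using abs_diff_along_line_le[OF C1(1,3), of 0 1 x h] by simp
  qed simp
  also have "\<dots> = (\<integral>\<^sup>+x. (\<integral>\<^sup>+s. indicator (cball 0 R) x * (indicator {0..1} s * ennreal (norm h * norm (grad w (x + s *\<^sub>R h)))) \<partial>lborel) \<partial>lborel)"
    by (intro nn_integral_cong nn_integral_cmult[symmetric]) measurable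
  also have "\<dots> = (\<integral>\<^sup>+s. (\<integral>\<^sup>+x. indicator (cball 0 R) x * (indicator {0..1} s * ennreal (norm h * norm (grad w (x + s *\<^sub>R h)))) \<partial>lborel) \<partial>lborel)"
    by (rule lborel_pair.Fubini'[symmetric]) measurable
  also have "\<dots> \<le> (\<integral>\<^sup>+s. (ennreal (norm h) * Q) * indicator {0..1::real} s \<partial>lborel)"
  proof (rule nn_integral_mono)
    fix s :: real
    show "(\<integral>\<^sup>+x. indicator (cball 0 R) x * (indicator {0..1} s * ennreal (norm h * norm (grad w (x + s *\<^sub>R h)))) \<partial>lborel) \<le> (ennreal (norm h) * Q) * indicator {0..1} s"
      using inner[of s] by (cases "s \<in> {0..1}") auto
  qed
  also have "\<dots> = ennreal (norm h) * Q" by (subst nn_integral_cmult_indicator) auto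
  finally show ?thesis by (simp add: Q_def)
qed

text \<open>Comparing \<open>g x\<close> with the integral of \<open>g\<close> over the dyadic cell
  of \<open>x\<close> leaves differences \<open>g y - g x\<close> with \<open>y\<close> within
  \<open>\<rho>\<close> of \<open>x\<close>, which the gradient controls, and finitely many cell
  integrals. The first part becomes small with the mesh, the second depends on finitely many numbers
  only; this is the core of the compactness theorem. The lower bound for the cell volume is kept as
  a factor to avoid division in the extended reals.\<close>

lemma dyadic_poincare:
  fixes g :: "real^'n \<Rightarrow> real"
  assumes g: "test_fun g" and \<rho>_def: "\<rho> = real CARD('n) / 2 ^ j"
  shows "ennreal ((1 / 2 ^ j) ^ CARD('n)) * (\<integral>\<^sup>+x. indicator (cball 0 R) x * ennreal \<bar>g x\<bar> \<partial>lborel)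
    \<le> emeasure lborel (cball (0::real^'n) \<rho>) * (ennreal \<rho> * (\<integral>\<^sup>+x. indicator (cball 0 (R + \<rho>)) x * ennreal (norm (grad g x)) \<partial>lborel))
     + emeasure lborel (cball (0::real^'n) R) * ennreal (\<Sum>z\<in>dyad j ` cball 0 R. \<bar>\<integral>y. indicat_real {y. dyad j y = z} y * g y \<partial>lborel\<bar>)"
proof -
  note C1 = test_fun_C1[OF g]
  have gm[measurable]: "g \<in> borel_measurable borel" and [measurable]: "grad g \<in> borel_measurable borel"
    using C1(2,3) by (auto intro: borel_measurable_continuous_onI)
  obtain R0 where "\<forall>x. norm x \<ge> R0 \<longrightarrow> g x = 0" using C1(4) by blast
  then have R0: "g x = 0" if "norm x \<ge> R0" for x using that by simp
  obtain B where B0: "B > 0" and B: "\<And>x. norm (g x) \<le> B"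
    by (rule bounded_of_compact_support[where R = R0, OF C1(2) R0]) (assumption, rule that)
  define S where "S = (\<Sum>z\<in>dyad j ` cball 0 R. \<bar>\<integral>y. indicat_real {y. dyad j y = z} y * g y \<partial>lborel\<bar>)"
  have \<rho>: "\<rho> \<ge> 0" by (simp add: \<rho>_def)
  have pt: "ennreal ((1 / 2 ^ j) ^ CARD('n)) * ennreal \<bar>g x\<bar> \<le> (\<integral>\<^sup>+h. indicator (cball 0 \<rho>) h * ennreal \<bar>g (x + h) - g x\<bar> \<partial>lborel) + ennreal S"
    if x: "norm x \<le> R" for x
  proof -
    define Q where "Q = {y. dyad j y = dyad j x}"
    have Qm[measurable]: "Q \<in> sets borel" unfolding Q_def by measurable
    have Qsub: "Q \<subseteq> cball x \<rho>"
      using dyad_eq_norm_le[of j x] by (auto simp: Q_def \<rho>_def dist_norm)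
    have "emeasure lborel Q \<le> emeasure lborel (cball x \<rho>)" by (rule emeasure_mono[OF Qsub]) simp
    also have "\<dots> < \<infinity>" using emeasure_bounded_finite[OF bounded_cball] by auto
    finally have Qfin: "emeasure lborel Q < \<infinity>" .
    have iQ: "integrable lborel (indicat_real Q)" using Qfin by (intro integrable_real_indicator) auto
    have igQ: "integrable lborel (\<lambda>y. indicat_real Q y * g y)"
      by (rule Bochner_Integration.integrable_bound[OF integrable_mult_right[OF iQ, of B]])
         (use B B0 in \<open>auto intro!: always_eventually split: split_indicator\<close>)
    have idQ: "integrable lborel (\<lambda>y. indicat_real Q y * (g y - g x))"
      using igQ iQ by (simp add: right_diff_distrib)
    define m where "m = measure lborel Q"
    have m: "(1 / 2 ^ j) ^ CARD('n) \<le> m"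
    proof -
      have "ennreal ((1 / 2 ^ j) ^ CARD('n)) \<le> ennreal m"
        using dyad_cell_emeasure_ge[of j x] Qfin unfolding m_def Q_def[symmetric]
        by (simp add: emeasure_eq_ennreal_measure less_top)
      then show ?thesis by (simp add: m_def)
    qed
    have "(\<integral>y. indicat_real Q y * (g y - g x) \<partial>lborel) = (\<integral>y. indicat_real Q y * g y \<partial>lborel) - m * g x"
      using igQ iQ by (simp add: right_diff_distrib m_def)
    then have "m * g x = (\<integral>y. indicat_real Q y * g y \<partial>lborel) - (\<integral>y. indicat_real Q y * (g y - g x) \<partial>lborel)" by linarith
    moreover have "m * \<bar>g x\<bar> = \<bar>m * g x\<bar>" by (simp add: abs_mult m_def)
    ultimately have "m * \<bar>g x\<bar> \<le> \<bar>\<integral>y. indicat_real Q y * (g y - g x) \<partial>lborel\<bar> + \<bar>\<integral>y. indicat_real Q y * g y \<partial>lborel\<bar>" by linarith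
    also have "\<bar>\<integral>y. indicat_real Q y * (g y - g x) \<partial>lborel\<bar> \<le> (\<integral>y. \<bar>indicat_real Q y * (g y - g x)\<bar> \<partial>lborel)"
      by (rule integral_abs_bound)
    \<comment> \<open>A single cell integral is bounded crudely by the sum over all cells meeting
      the ball, a quantity independent of \<open>x\<close>.\<close>
    also have "\<bar>\<integral>y. indicat_real Q y * g y \<partial>lborel\<bar> \<le> S"
      unfolding S_def Q_def using x by (intro member_le_sum[of "dyad j x"] finite_dyad_cball) auto
    finally have "m * \<bar>g x\<bar> \<le> (\<integral>y. \<bar>indicat_real Q y * (g y - g x)\<bar> \<partial>lborel) + S" by simp
    moreover have "(1 / 2 ^ j) ^ CARD('n) * \<bar>g x\<bar> \<le> m * \<bar>g x\<bar>" by (rule mult_right_mono[OF m]) simp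
    ultimately have "(1 / 2 ^ j) ^ CARD('n) * \<bar>g x\<bar> \<le> (\<integral>y. \<bar>indicat_real Q y * (g y - g x)\<bar> \<partial>lborel) + S" by linarith
    then have "ennreal ((1 / 2 ^ j) ^ CARD('n) * \<bar>g x\<bar>) \<le> ennreal ((\<integral>y. \<bar>indicat_real Q y * (g y - g x)\<bar> \<partial>lborel) + S)"
      by (rule ennreal_leI)
    also have "\<dots> = ennreal (\<integral>y. \<bar>indicat_real Q y * (g y - g x)\<bar> \<partial>lborel) + ennreal S"
      by (rule ennreal_plus) (auto simp: S_def intro: sum_nonneg)
    also have "ennreal (\<integral>y. \<bar>indicat_real Q y * (g y - g x)\<bar> \<partial>lborel) = (\<integral>\<^sup>+y. ennreal \<bar>indicat_real Q y * (g y - g x)\<bar> \<partial>lborel)"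
      by (rule nn_integral_eq_integral[symmetric]) (use idQ in auto)
    also have "\<dots> = (\<integral>\<^sup>+h. ennreal \<bar>indicat_real Q (x + h) * (g (x + h) - g x)\<bar> \<partial>lborel)"
      by (rule nn_integral_lborel_translate[symmetric]) measurable
    \<comment> \<open>The cell of \<open>x\<close> is replaced by a ball for \<open>h\<close> that
      no longer depends on \<open>x\<close>, so that after Tonelli each \<open>h\<close> can be
      treated by \<open>translate_L1_le\<close>.\<close>
    also have "\<dots> \<le> (\<integral>\<^sup>+h. indicator (cball 0 \<rho>) h * ennreal \<bar>g (x + h) - g x\<bar> \<partial>lborel)"
    proof (rule nn_integral_mono)
      fix h
      have "h \<in> cball 0 \<rho>" if "x + h \<in> Q" using Qsub that by (force simp: dist_norm)
      then show "ennreal \<bar>indicat_real Q (x + h) * (g (x + h) - g x)\<bar> \<le> indicator (cball 0 \<rho>) h * ennreal \<bar>g (x + h) - g x\<bar>"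
        by (auto split: split_indicator)
    qed
    finally show ?thesis by (simp add: ennreal_mult[symmetric])
  qed
  define D where "D = (\<integral>\<^sup>+x. indicator (cball 0 (R + \<rho>)) x * ennreal (norm (grad g x)) \<partial>lborel)"
  have "ennreal ((1 / 2 ^ j) ^ CARD('n)) * (\<integral>\<^sup>+x. indicator (cball 0 R) x * ennreal \<bar>g x\<bar> \<partial>lborel)
    = (\<integral>\<^sup>+x. ennreal ((1 / 2 ^ j) ^ CARD('n)) * (indicator (cball 0 R) x * ennreal \<bar>g x\<bar>) \<partial>lborel)"
    by (rule nn_integral_cmult[symmetric]) measurable
  also have "\<dots> \<le> (\<integral>\<^sup>+x. indicator (cball 0 R) x * (\<integral>\<^sup>+h. indicator (cball 0 \<rho>) h * ennreal \<bar>g (x + h) - g x\<bar> \<partial>lborel) + ennreal S * indicator (cball 0 R) x \<partial>lborel)"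
    by (rule nn_integral_mono) (use pt in \<open>auto split: split_indicator\<close>)
  also have "\<dots> = (\<integral>\<^sup>+x. indicator (cball 0 R) x * (\<integral>\<^sup>+h. indicator (cball 0 \<rho>) h * ennreal \<bar>g (x + h) - g x\<bar> \<partial>lborel) \<partial>lborel) + (\<integral>\<^sup>+x. ennreal S * indicator (cball (0::real^'n) R) x \<partial>lborel)"
    by (rule nn_integral_add) measurable
  also have "(\<integral>\<^sup>+x. ennreal S * indicator (cball (0::real^'n) R) x \<partial>lborel) = ennreal S * emeasure lborel (cball (0::real^'n) R)"
    by (rule nn_integral_cmult_indicator) simp
  also have "(\<integral>\<^sup>+x. indicator (cball 0 R) x * (\<integral>\<^sup>+h. indicator (cball 0 \<rho>) h * ennreal \<bar>g (x + h) - g x\<bar> \<partial>lborel) \<partial>lborel)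
     = (\<integral>\<^sup>+x. (\<integral>\<^sup>+h. indicator (cball 0 R) x * (indicator (cball 0 \<rho>) h * ennreal \<bar>g (x + h) - g x\<bar>) \<partial>lborel) \<partial>lborel)"
    by (intro nn_integral_cong nn_integral_cmult[symmetric]) measurable
  also have "\<dots> = (\<integral>\<^sup>+h. (\<integral>\<^sup>+x. indicator (cball 0 R) x * (indicator (cball 0 \<rho>) h * ennreal \<bar>g (x + h) - g x\<bar>) \<partial>lborel) \<partial>lborel)"
    by (rule lborel_pair.Fubini'[symmetric]) measurable
  also have "\<dots> \<le> (\<integral>\<^sup>+h. (ennreal \<rho> * D) * indicator (cball (0::real^'n) \<rho>) h \<partial>lborel)"
  proof (rule nn_integral_mono)
    fix h :: "real^'n"
    show "(\<integral>\<^sup>+x. indicator (cball 0 R) x * (indicator (cball 0 \<rho>) h * ennreal \<bar>g (x + h) - g x\<bar>) \<partial>lborel) \<le> (ennreal \<rho> * D) * indicator (cball 0 \<rho>) h"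
    proof (cases "norm h \<le> \<rho>")
      case True
      have "(\<integral>\<^sup>+x. indicator (cball 0 (R + norm h)) x * ennreal (norm (grad g x)) \<partial>lborel) \<le> D"
        unfolding D_def using True by (intro nn_integral_mono mult_right_mono) (auto split: split_indicator)
      then have "ennreal (norm h) * (\<integral>\<^sup>+x. indicator (cball 0 (R + norm h)) x * ennreal (norm (grad g x)) \<partial>lborel) \<le> ennreal \<rho> * D"
        using True by (intro mult_mono ennreal_leI) auto
      from order.trans[OF translate_L1_le[OF g] this] show ?thesis using True by simp
    next
      case False
      then show ?thesis by simp
    qed
  qed
  also have "\<dots> = (ennreal \<rho> * D) * emeasure lborel (cball (0::real^'n) \<rho>)" by (rule nn_integral_cmult_indicator) simp
  finally show ?thesis by (simp add: D_def S_def mult.commute add_right_mono)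
qed

text \<open>Hardy's inequality bounds the integrals over each dyadic cell uniformly along the
  sequence, and there are countably many cells, so a diagonal subsequence makes all of these
  integrals converge. \<open>dyadic_poincare\<close>, applied to differences, then gives the Cauchy
  property in \<open>L^1\<close> of every ball, and a further subsequence converges almost
  everywhere.\<close>

theorem rellich_AE:
  fixes w :: "nat \<Rightarrow> real^'n \<Rightarrow> real"
  assumes p: "p > 1" and n: "real CARD('n) > p" and w: "\<And>m. test_fun (w m)" and M: "\<And>m. pint p lebesgue (grad (w m)) \<le> M"
  obtains r u where "strict_mono r" "u \<in> borel_measurable lebesgue" "AE x in lebesgue. (\<lambda>k. w (r k) x) \<longlonglongrightarrow> u x"
proof -
  define q where "q = p / (p - 1)"
  have pq: "p > 1" "q > 1" "1/p + 1/q = 1" using p by (auto simp: q_def field_simps)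
  define N where "N = real CARD('n)"
  have N: "N > 0" by (simp add: N_def)
  have wm[measurable]: "w m \<in> borel_measurable borel" for m
    using test_fun_C1(2)[OF w] by (rule borel_measurable_continuous_onI)
  have cell_bd: "\<exists>B. \<forall>m. \<bar>\<integral>y. indicat_real {y. dyad j y = z} y * w m y \<partial>lborel\<bar> \<le> B" for j and z :: "int^'n"
  proof (cases "{y. dyad j y = z} = {}")
    case False
    then obtain x where x: "dyad j x = z" by auto
    define R where "R = norm x + N / 2 ^ j"
    have sub: "{y. dyad j y = z} \<subseteq> cball 0 R"
    proof
      fix y assume "y \<in> {y. dyad j y = z}"
      then have "norm (y - x) \<le> N / 2 ^ j" using dyad_eq_norm_le[of j y x] x by (simp add: N_def)
      then show "y \<in> cball 0 R" using norm_triangle_ineq[of "y - x" x] by (simp add: R_def)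
    qed
    obtain C where C: "C \<ge> 0" "\<And>v :: real^'n \<Rightarrow> real. test_fun v \<Longrightarrow> (\<integral>\<^sup>+x. indicator (cball 0 R) x * ennreal \<bar>v x\<bar> \<partial>lborel) \<le> ennreal (C * pint p lebesgue (grad v) powr (1/p))"
      by (rule hardy_local_L1[OF pq n]) (rule that)
    have "\<bar>\<integral>y. indicat_real {y. dyad j y = z} y * w m y \<partial>lborel\<bar> \<le> C * M powr (1/p)" for m
    proof -
      have "ennreal \<bar>\<integral>y. indicat_real {y. dyad j y = z} y * w m y \<partial>lborel\<bar> \<le> (\<integral>\<^sup>+y. norm (indicat_real {y. dyad j y = z} y * w m y) \<partial>lborel)"
        using integral_norm_bound_ennreal[of lborel "\<lambda>y. indicat_real {y. dyad j y = z} y * w m y"]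
        by (cases "integrable lborel (\<lambda>y. indicat_real {y. dyad j y = z} y * w m y)") (auto simp: not_integrable_integral_eq)
      also have "\<dots> \<le> (\<integral>\<^sup>+x. indicator (cball 0 R) x * ennreal \<bar>w m x\<bar> \<partial>lborel)"
        by (rule nn_integral_mono) (use sub in \<open>auto split: split_indicator\<close>)
      also have "\<dots> \<le> ennreal (C * pint p lebesgue (grad (w m)) powr (1/p))" by (rule C(2)[OF w])
      also have "\<dots> \<le> ennreal (C * M powr (1/p))"
        using C(1) p M[of m] by (intro ennreal_leI mult_left_mono powr_mono2) auto
      finally show ?thesis using C(1) by simp
    qed
    then show ?thesis by blast
  next
    case True
    then show ?thesis by (intro exI[of _ 0]) (simp add: True)
  qed
  \<comment> \<open>All meshes and all cells are enumerated at once, so one extraction serves every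
    \<open>j\<close>.\<close>
  define X where "X m i = (case from_nat i of (j, z) \<Rightarrow> \<integral>y. indicat_real {y. dyad j y = z} y * w m y \<partial>lborel)" for m and i :: nat
  have "\<exists>B. \<forall>m. \<bar>X m i\<bar> \<le> B" for i
    unfolding X_def using cell_bd by (cases "from_nat i :: nat \<times> (int^'n)") simp
  from diagonal_convergent_subseq[of X, OF this] obtain r1 where r1: "strict_mono r1" "\<And>i. convergent (\<lambda>k. X (r1 k) i)" by blast
  have cellconv: "Cauchy (\<lambda>k. \<integral>y. indicat_real {y. dyad j y = z} y * w (r1 k) y \<partial>lborel)" for j and z :: "int^'n"
    using r1(2)[of "to_nat (j, z)"] by (simp add: X_def convergent_Cauchy)
  define B where "B k = cball (0::real^'n) (real k)" for k
  define v where "v k = w (r1 k)" for k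
  have v: "test_fun (v k)" for k using w by (simp add: v_def)
  define M' where "M' = 2 powr p * (M + M)"
  have M0: "M \<ge> 0" using M[of 0] pint_nonneg[of p lebesgue "grad (w 0)"] by linarith
  have gdiff: "test_fun (\<lambda>x. v m x - v l x)" "pint p lebesgue (grad (\<lambda>x. v m x - v l x)) \<le> M'"
    "Lp p lebesgue (grad (\<lambda>x. v m x - v l x))" for m l
  proof -
    have t: "test_fun (\<lambda>x. 1 * v m x + (-1) * v l x)" by (rule test_fun_lincomb[OF v v])
    then show "test_fun (\<lambda>x. v m x - v l x)" by simp
    have g: "grad (\<lambda>x. v m x - v l x) = (\<lambda>x. grad (v m) x - grad (v l) x)"
      using grad_lincomb[OF v v, of 1 m "-1" l] by (simp add: fun_eq_iff)
    have Lv: "Lp p lebesgue (grad (v k))" for k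
      using test_fun_C1(4)[OF v[of k]] p by (auto intro!: Lp_compact_support test_fun_C1(3)[OF v])
    show "Lp p lebesgue (grad (\<lambda>x. v m x - v l x))" unfolding g using Lp_diff(1)[OF Lv Lv] p by simp
    have "pint p lebesgue (\<lambda>x. grad (v m) x - grad (v l) x) \<le> 2 powr p * (pint p lebesgue (grad (v m)) + pint p lebesgue (grad (v l)))"
      using Lp_diff(2)[OF Lv Lv] p by simp
    also have "\<dots> \<le> M'" unfolding M'_def v_def using M by (intro mult_left_mono add_mono) auto
    finally show "pint p lebesgue (grad (\<lambda>x. v m x - v l x)) \<le> M'" unfolding g .
  qed
  have cau: "\<exists>K. \<forall>m\<ge>K. \<forall>l\<ge>K. (\<integral>\<^sup>+x\<in>B k. ennreal (norm (v m x - v l x)) \<partial>lebesgue) \<le> ennreal e" if e: "e > 0" for k e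
  proof -
    define V where "V = unit_ball_vol N * N ^ CARD('n)"
    define D where "D = M' powr (1/p) * measure lebesgue (cball (0::real^'n) (real k + N)) powr (1/q)"
    \<comment> \<open>Divided by the cell volume, the gradient part of
      \<open>dyadic_poincare\<close> is at most \<open>A * (1/2) ^ j\<close>. This fixes the mesh
      before the finitely many cells are considered.\<close>
    define A where "A = V * N * D"
    have V: "V \<ge> 0" and D: "D \<ge> 0" and A: "A \<ge> 0" using N by (auto simp: V_def D_def A_def)
    have "e / (2 * (A + 1)) > 0" using e A by simp
    then obtain j where j: "(1/2) ^ j < e / (2 * (A + 1))" using real_arch_pow_inv[of _ "1/2"] by auto
    have j': "A * (1/2) ^ j \<le> e / 2"
    proof -
      have "A * (1/2) ^ j \<le> (A + 1) * (e / (2 * (A + 1)))" using j A by (intro mult_mono) auto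
      also have "\<dots> = e / 2" using A by (simp add: field_simps)
      finally show ?thesis .
    qed
    define Z where "Z = dyad j ` cball (0::real^'n) (real k)"
    define c where "c = (2 ^ j) ^ CARD('n) * measure lborel (cball (0::real^'n) (real k))"
    have c: "c \<ge> 0" by (simp add: c_def)
    \<comment> \<open>The tolerance for one cell: summed over \<open>Z\<close> and multiplied by
      \<open>c\<close> it stays below \<open>e / 2\<close>. The summands 1 exclude division by
      zero.\<close>
    define d where "d = e / (2 * (c + 1) * (real (card Z) + 1))"
    have d: "d > 0" using e c by (simp add: d_def)
    have "\<forall>z\<in>Z. \<exists>K. \<forall>m\<ge>K. \<forall>l\<ge>K. \<bar>(\<integral>y. indicat_real {y. dyad j y = z} y * v m y \<partial>lborel) - (\<integral>y. indicat_real {y. dyad j y = z} y * v l y \<partial>lborel)\<bar> < d"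
      using cellconv[of j] d unfolding Cauchy_def dist_real_def v_def by blast
    from bchoice[OF this] obtain K where K': "\<forall>z\<in>Z. \<forall>m\<ge>K z. \<forall>l\<ge>K z. \<bar>(\<integral>y. indicat_real {y. dyad j y = z} y * v m y \<partial>lborel) - (\<integral>y. indicat_real {y. dyad j y = z} y * v l y \<partial>lborel)\<bar> < d" ..
    have K: "\<bar>(\<integral>y. indicat_real {y. dyad j y = z} y * v m y \<partial>lborel) - (\<integral>y. indicat_real {y. dyad j y = z} y * v l y \<partial>lborel)\<bar> < d"
      if "z \<in> Z" "m \<ge> K z" "l \<ge> K z" for z m l
      by (rule K'[rule_format, OF that])
    have Zf: "finite Z" unfolding Z_def by (rule finite_dyad_cball)
    define K0 where "K0 = (\<Sum>z\<in>Z. K z)"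
    have K0: "K z \<le> K0" if "z \<in> Z" for z unfolding K0_def using that Zf by (intro member_le_sum) auto
    have "(\<integral>\<^sup>+x\<in>B k. ennreal (norm (v m x - v l x)) \<partial>lebesgue) \<le> ennreal e" if ml: "m \<ge> K0" "l \<ge> K0" for m l
    proof -
      define g where "g x = v m x - v l x" for x
      note gt = gdiff[of m l, folded g_def]
      have gm[measurable]: "grad g \<in> borel_measurable borel" using test_fun_C1(3)[OF gt(1)] by (rule borel_measurable_continuous_onI)
      define I where "I = (\<integral>\<^sup>+x. indicator (B k) x * ennreal \<bar>g x\<bar> \<partial>lborel)"
      have icell: "integrable lborel (\<lambda>y. indicat_real {y. dyad j y = z} y * v i y)" for z i
      proof -
        have "Lp 1 lebesgue (v i)" using test_fun_C1(4)[OF v[of i]] by (auto intro!: Lp_compact_support test_fun_C1(2)[OF v])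
        then have "integrable lebesgue (\<lambda>x. \<bar>v i x\<bar>)" by (simp add: Lp_def powr_one)
        then have "integrable lborel (\<lambda>x. \<bar>v i x\<bar>)" unfolding v_def by (subst (asm) integrable_completion) auto
        then show ?thesis
          by (rule Bochner_Integration.integrable_bound) (auto simp: v_def intro!: always_eventually split: split_indicator)
      qed
      have S: "(\<Sum>z\<in>Z. \<bar>\<integral>y. indicat_real {y. dyad j y = z} y * g y \<partial>lborel\<bar>) \<le> real (card Z) * d"
      proof -
        have "\<bar>\<integral>y. indicat_real {y. dyad j y = z} y * g y \<partial>lborel\<bar> \<le> d" if "z \<in> Z" for z
          using K[OF that, of m l] K0[OF that] ml icell by (simp add: g_def right_diff_distrib)
        then show ?thesis using sum_bounded_above[of Z _ d] by simp
      qed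
      define \<rho> where "\<rho> = N / 2 ^ j"
      have \<rho>: "0 \<le> \<rho>" "\<rho> \<le> N" using N by (auto simp: \<rho>_def field_simps)
      have grad1: "(\<integral>\<^sup>+x. indicator (cball 0 (real k + \<rho>)) x * ennreal (norm (grad g x)) \<partial>lborel) \<le> ennreal D"
      proof -
        have "(\<integral>\<^sup>+x. indicator (cball 0 (real k + \<rho>)) x * ennreal (norm (grad g x)) \<partial>lborel)
            \<le> (\<integral>\<^sup>+x\<in>cball 0 (real k + N). ennreal (norm (grad g x)) \<partial>lborel)"
          using \<rho> by (intro nn_integral_mono) (auto split: split_indicator)
        also have "\<dots> = (\<integral>\<^sup>+x\<in>cball 0 (real k + N). ennreal (norm (grad g x)) \<partial>lebesgue)"
          by (rule nn_integral_completion[symmetric])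
        also have "\<dots> \<le> ennreal (pint p lebesgue (grad g) powr (1/p) * measure lebesgue (cball (0::real^'n) (real k + N)) powr (1/q))"
          by (rule Lp_local_L1[OF pq gt(3)]) (use emeasure_bounded_finite[OF bounded_cball[of "0::real^'n" "real k + N"]] in auto)
        also have "\<dots> \<le> ennreal D"
          unfolding D_def using gt(2) p by (intro ennreal_leI mult_right_mono powr_mono2) auto
        finally show ?thesis .
      qed
      \<comment> \<open>The ball of radius \<open>\<rho>\<close> has volume \<open>V * t\<close>
        with \<open>V\<close> independent of \<open>j\<close>, so the common factor \<open>t\<close>
        cancels in the end.\<close>
      define t :: real where "t = (1 / 2 ^ j) ^ CARD('n)"
      have t: "t > 0" by (simp add: t_def)
      have "emeasure lborel (cball (0::real^'n) \<rho>) = ennreal (V * t)"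
        using emeasure_cball[OF \<rho>(1), of "0::real^'n"]
        by (simp add: V_def t_def \<rho>_def N_def power_divide)
      moreover have "emeasure lborel (cball (0::real^'n) (real k)) = ennreal (measure lborel (cball (0::real^'n) (real k)))"
        using emeasure_bounded_finite[OF bounded_cball[of "0::real^'n" "real k"]] by (intro emeasure_eq_ennreal_measure) auto
      ultimately have em: "emeasure lborel (cball (0::real^'n) \<rho>) = ennreal (V * t)"
        "emeasure lborel (cball (0::real^'n) (real k)) = ennreal (measure lborel (cball (0::real^'n) (real k)))" by simp_all
      have \<rho>eq: "\<rho> = real CARD('n) / 2 ^ j" by (simp add: \<rho>_def N_def)
      have "ennreal t * I \<le> ennreal (V * t) * (ennreal \<rho> * (\<integral>\<^sup>+x. indicator (cball 0 (real k + \<rho>)) x * ennreal (norm (grad g x)) \<partial>lborel))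
         + ennreal (measure lborel (cball (0::real^'n) (real k))) * ennreal (\<Sum>z\<in>Z. \<bar>\<integral>y. indicat_real {y. dyad j y = z} y * g y \<partial>lborel\<bar>)"
        using dyadic_poincare[OF gt(1) \<rho>eq, of "real k"] unfolding I_def B_def t_def[symmetric] Z_def[symmetric] em .
      also have "\<dots> \<le> ennreal (V * t) * (ennreal \<rho> * ennreal D) + ennreal (measure lborel (cball (0::real^'n) (real k))) * ennreal (real (card Z) * d)"
        by (intro add_mono mult_left_mono grad1 ennreal_leI S) simp_all
      also have "\<dots> = ennreal (t * (V * \<rho> * D + c * (real (card Z) * d)))"
      proof -
        have ct: "c * t = measure lborel (cball (0::real^'n) (real k))" by (simp add: c_def t_def power_one_over)
        have "t * (V * \<rho> * D + c * (real (card Z) * d)) = (V * t) * (\<rho> * D) + measure lborel (cball (0::real^'n) (real k)) * (real (card Z) * d)"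
          unfolding ct[symmetric] by (simp add: algebra_simps)
        then show ?thesis using V t \<rho> D d by (simp add: ennreal_mult ennreal_plus)
      qed
      also have "\<dots> \<le> ennreal (t * e)"
      proof (intro ennreal_leI mult_left_mono)
        have "V * \<rho> * D = A * (1/2) ^ j" by (simp add: A_def \<rho>_def power_one_over)
        moreover have "c * (real (card Z) * d) \<le> e / 2"
        proof -
          have "c * (real (card Z) * d) \<le> (c + 1) * ((real (card Z) + 1) * d)" using c d by (intro mult_mono) auto
          also have "\<dots> = e / 2"
          proof -
            have *: "y * (z * (e / (2 * y * z))) = e / 2" if "y \<noteq> 0" "z \<noteq> 0" for y z :: real using that by simp
            show ?thesis unfolding d_def by (rule *) (use c in auto)
          qed
          finally show ?thesis .
        qed
        ultimately have "V * \<rho> * D \<le> e / 2" "c * (real (card Z) * d) \<le> e / 2" using j' by auto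
        then show "V * \<rho> * D + c * (real (card Z) * d) \<le> e" by argo
      qed (use t in simp)
      finally have "ennreal t * I \<le> ennreal (t * e)" .
      then have "ennreal (1/t) * (ennreal t * I) \<le> ennreal (1/t) * ennreal (t * e)" by (rule mult_left_mono) simp
      then have "I \<le> ennreal e"
        using t e by (simp add: mult.assoc[symmetric] ennreal_mult[symmetric])
      then show ?thesis unfolding I_def g_def nn_integral_completion by (simp add: mult.commute)
    qed
    then show ?thesis by (intro exI[of _ K0] allI impI)
  qed
  obtain r2 where r2: "strict_mono r2" "AE x in lebesgue. convergent (\<lambda>k. v (r2 k) x)"
  proof (rule AE_convergent_subseq_of_L1_loc_Cauchy[of v lebesgue B])
    show "v k \<in> borel_measurable lebesgue" for k unfolding v_def by (rule measurable_completion) measurable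
    show "B k \<in> sets lebesgue" for k by (simp add: B_def)
    show "\<forall>\<^sub>F k in sequentially. x \<in> B k" for x
    proof -
      obtain n where "norm x \<le> real n" using real_arch_simple by blast
      then show ?thesis unfolding B_def eventually_sequentially by (intro exI[of _ n]) (auto intro: order.trans)
    qed
  qed (rule cau)
  define u where "u x = lim (\<lambda>k. v (r2 k) x)" for x
  show ?thesis
  proof (rule that[of "r1 \<circ> r2" u])
    show "strict_mono (r1 \<circ> r2)" by (rule strict_mono_o[OF r1(1) r2(1)])
    show "u \<in> borel_measurable lebesgue"
      unfolding u_def by (rule borel_measurable_lim_metric) (unfold v_def, rule measurable_completion, measurable)
    show "AE x in lebesgue. (\<lambda>k. w ((r1 \<circ> r2) k) x) \<longlonglongrightarrow> u x"
      using r2(2) by eventually_elim (simp add: u_def v_def convergent_LIMSEQ_iff)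
  qed
qed

section \<open>Galerkin approximation\<close>

text \<open>For simple functions in the last two arguments the composition is a finite sum of
  measurable pieces. Pointwise approximation and continuity give the general case off a null set,
  and completeness of Lebesgue measure absorbs that set.\<close>

lemma caratheodory_measurable:
  fixes A :: "real^'n \<Rightarrow> real \<Rightarrow> real^'n \<Rightarrow> real^'n"
  assumes A: "caratheodory A" and u: "u \<in> borel_measurable lebesgue" and G: "G \<in> borel_measurable lebesgue"
  shows "(\<lambda>x. A x (u x) (G x)) \<in> borel_measurable lebesgue"
proof -
  have "(\<lambda>x. (u x, G x)) \<in> borel_measurable lebesgue" using u G by measurable
  from borel_measurable_implies_sequence_metric[OF this, of 0] obtain s where
    s: "\<And>i. simple_function lebesgue (s i)" "\<And>x. (\<lambda>i. s i x) \<longlonglongrightarrow> (u x, G x)" by auto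
  have Am: "(\<lambda>x. A x c d) \<in> borel_measurable lebesgue" for c d using A by (simp add: caratheodory_def)
  have B: "(\<lambda>x. A x (fst (s i x)) (snd (s i x))) \<in> borel_measurable lebesgue" for i
  proof -
    have fin: "finite (range (s i))" using simple_functionD(1)[OF s(1)] by simp
    have sets: "s i -` {v} \<in> sets lebesgue" for v using simple_functionD(2)[OF s(1)[of i], of "{v}"] by simp
    have "(\<lambda>x. \<Sum>v\<in>range (s i). indicat_real (s i -` {v}) x *\<^sub>R A x (fst v) (snd v)) \<in> borel_measurable lebesgue"
      by (intro borel_measurable_sum borel_measurable_scaleR borel_measurable_indicator sets Am)
    also have "(\<lambda>x. \<Sum>v\<in>range (s i). indicat_real (s i -` {v}) x *\<^sub>R A x (fst v) (snd v)) = (\<lambda>x. A x (fst (s i x)) (snd (s i x)))"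
    proof
      fix x
      have "(\<Sum>v\<in>range (s i). indicat_real (s i -` {v}) x *\<^sub>R A x (fst v) (snd v))
          = (\<Sum>v\<in>range (s i). if s i x = v then A x (fst v) (snd v) else 0)"
        by (intro sum.cong) (auto split: split_indicator)
      also have "\<dots> = A x (fst (s i x)) (snd (s i x))" using fin by (simp add: sum.delta')
      finally show "(\<Sum>v\<in>range (s i). indicat_real (s i -` {v}) x *\<^sub>R A x (fst v) (snd v)) = A x (fst (s i x)) (snd (s i x))" .
    qed
    finally show ?thesis .
  qed
  define L where "L x = lim (\<lambda>i. A x (fst (s i x)) (snd (s i x)))" for x
  have Lm: "L \<in> borel_measurable lebesgue" unfolding L_def by (rule borel_measurable_lim_metric[OF B])
  have "AE x in lebesgue. continuous_on UNIV (\<lambda>(s, \<xi>). A x s \<xi>)" using A by (simp add: caratheodory_def)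
  then have "AE x in lebesgue. L x = A x (u x) (G x)"
  proof eventually_elim
    case (elim x)
    have "(\<lambda>i. (\<lambda>(s, \<xi>). A x s \<xi>) (s i x)) \<longlonglongrightarrow> (\<lambda>(s, \<xi>). A x s \<xi>) (u x, G x)"
      by (rule continuous_on_tendsto_compose[OF elim s(2)]) auto
    then have "(\<lambda>i. A x (fst (s i x)) (snd (s i x))) \<longlonglongrightarrow> A x (u x) (G x)" by (simp add: case_prod_beta)
    then show ?case unfolding L_def by (rule limI)
  qed
  with Lm show ?thesis by (rule borel_measurable_AE)
qed

text \<open>Beyond its sign, the datum enters through the weight \<open>norm x * f x\<close>, the
  form in which Hardy's inequality makes it a bounded functional; \<open>q\<close> is the exponent
  conjugate to \<open>p\<close>.\<close>

locale leray_lions =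
  fixes p q :: real and A :: "real^'n::finite \<Rightarrow> real \<Rightarrow> real^'n \<Rightarrow> real^'n" and f :: "real^'n \<Rightarrow> real"
    and C1 C2 :: real
  assumes p: "p > 1" and q: "q > 1" and pq: "1/p + 1/q = 1" and n: "real CARD('n) > p"
    and car: "caratheodory A" and C1: "C1 > 0" and C2: "C2 > 0"
    and struct: "AE x in lebesgue. \<forall>s \<zeta> \<xi>.
        (A x s \<zeta> - A x s \<xi>) \<bullet> (\<zeta> - \<xi>) \<ge> 0 \<and>
        C1 * norm \<xi> powr p \<le> \<xi> \<bullet> A x s \<xi> \<and>
        norm (A x s \<xi>) \<le> C2 * norm \<xi> powr (p - 1)"
    and f0: "\<And>x. f x \<ge> 0" and fm: "f \<in> borel_measurable borel"
    and fi: "integrable lborel (\<lambda>x. (norm x * f x) powr q)"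
begin

lemma pqs: "p > 1" "q > 1" "1/p + 1/q = 1" by (rule p q pq)+

lemma qps: "q > 1" "p > 1" "1/q + 1/p = 1" using p q pq by auto

lemma p1q: "(p - 1) * q = p"
  using pq p q by (simp add: field_simps)

lemma fml: "f \<in> borel_measurable lebesgue"
  using fm by (simp add: measurable_completion)

lemma test_meas: "test_fun w \<Longrightarrow> w \<in> borel_measurable lebesgue"
  by (intro measurable_completion) (simp add: borel_measurable_continuous_onI test_fun_C1(2))

lemma Lp_grad:
  assumes "test_fun w" "r \<ge> 0" shows "Lp r lebesgue (grad w)"
proof -
  obtain R where R: "\<forall>x. norm x \<ge> R \<longrightarrow> w x = 0 \<and> grad w x = 0" using test_fun_C1(4)[OF assms(1)] by blast
  show ?thesis by (rule Lp_compact_support[where R = R, OF test_fun_C1(3)[OF assms(1)] _ assms(2)]) (use R in simp)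
qed

text \<open>A bound, taken from \<open>hardy_dual\<close>, for the norm of the functional that pairs
  a test function with \<open>f\<close>, relative to the \<open>L^p\<close> norm of the
  gradient.\<close>

definition K :: real where
  "K = p / (real CARD('n) - p) * (\<integral>x. (norm x * f x) powr q \<partial>lborel) powr (1/q)"

lemma K0: "K \<ge> 0" using p n by (simp add: K_def)

lemma f_hardy:
  assumes w: "test_fun w"
  shows "integrable lebesgue (\<lambda>x. f x * w x)"
    "(\<integral>x. f x * \<bar>w x\<bar> \<partial>lebesgue) \<le> K * pint p lebesgue (grad w) powr (1/p)"
    "\<bar>\<integral>x. f x * w x \<partial>lebesgue\<bar> \<le> K * pint p lebesgue (grad w) powr (1/p)"
proof -
  note [measurable] = fml test_meas[OF w]
  have H: "(\<integral>\<^sup>+x. ennreal (f x * \<bar>w x\<bar>) \<partial>lebesgue) \<le> ennreal (K * pint p lebesgue (grad w) powr (1/p))"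
    unfolding nn_integral_completion K_def by (rule hardy_dual[OF pqs n w fm f0 fi])
  have i: "integrable lebesgue (\<lambda>x. f x * \<bar>w x\<bar>)"
    by (rule integrableI_bounded) (use H f0 in \<open>auto simp: abs_mult intro: le_less_trans\<close>)
  have "ennreal (\<integral>x. f x * \<bar>w x\<bar> \<partial>lebesgue) = (\<integral>\<^sup>+x. ennreal (f x * \<bar>w x\<bar>) \<partial>lebesgue)"
    by (rule nn_integral_eq_integral[symmetric, OF i]) (use f0 in simp)
  also note H
  finally show 1: "(\<integral>x. f x * \<bar>w x\<bar> \<partial>lebesgue) \<le> K * pint p lebesgue (grad w) powr (1/p)"
    using K0 by (subst (asm) ennreal_le_iff) auto
  show i': "integrable lebesgue (\<lambda>x. f x * w x)"
    by (rule Bochner_Integration.integrable_bound[OF i]) (auto simp: abs_mult)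
  have "\<bar>\<integral>x. f x * w x \<partial>lebesgue\<bar> \<le> (\<integral>x. \<bar>f x * w x\<bar> \<partial>lebesgue)" by (rule integral_abs_bound)
  also have "\<dots> = (\<integral>x. f x * \<bar>w x\<bar> \<partial>lebesgue)" using f0 by (simp add: abs_mult)
  finally show "\<bar>\<integral>x. f x * w x \<partial>lebesgue\<bar> \<le> K * pint p lebesgue (grad w) powr (1/p)" using 1 by linarith
qed

lemma A_power:
  "AE x in lebesgue. \<forall>s \<xi>. norm (A x s \<xi>) powr q \<le> C2 powr q * norm \<xi> powr p"
  using struct
proof eventually_elim
  case (elim x)
  show ?case
  proof (intro allI)
    fix s \<xi>
    have "norm (A x s \<xi>) \<le> C2 * norm \<xi> powr (p - 1)" using elim by blast
    then have "norm (A x s \<xi>) powr q \<le> (C2 * norm \<xi> powr (p - 1)) powr q"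
      using q by (intro powr_mono2) auto
    also have "\<dots> = C2 powr q * norm \<xi> powr p"
      using C2 p1q by (subst powr_mult) (auto simp: powr_powr)
    finally show "norm (A x s \<xi>) powr q \<le> C2 powr q * norm \<xi> powr p" .
  qed
qed

text \<open>Since \<open>(p - 1) * q = p\<close>, the growth condition sends gradients in
  \<open>L^p\<close> to fluxes in \<open>L^q\<close>, whatever the measurable \<open>u\<close>; so
  fluxes can always be paired with gradients.\<close>

lemma A_Lp:
  assumes u: "u \<in> borel_measurable lebesgue" and G: "Lp p lebesgue G"
  shows "Lp q lebesgue (\<lambda>x. A x (u x) (G x))" "pint q lebesgue (\<lambda>x. A x (u x) (G x)) \<le> C2 powr q * pint p lebesgue G"
    "C1 * pint p lebesgue G \<le> (\<integral>x. A x (u x) (G x) \<bullet> G x \<partial>lebesgue)"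
proof -
  have m: "(\<lambda>x. A x (u x) (G x)) \<in> borel_measurable lebesgue"
    by (rule caratheodory_measurable[OF car u LpD(1)[OF G]])
  have i: "integrable lebesgue (\<lambda>x. C2 powr q * norm (G x) powr p)"
    using LpD(2)[OF G] by simp
  have b: "AE x in lebesgue. norm (A x (u x) (G x)) powr q \<le> C2 powr q * norm (G x) powr p"
    using A_power by eventually_elim blast
  show L: "Lp q lebesgue (\<lambda>x. A x (u x) (G x))"
    unfolding Lp_def
  proof (intro conjI m)
    show "integrable lebesgue (\<lambda>x. norm (A x (u x) (G x)) powr q)"
      by (rule Bochner_Integration.integrable_bound[OF i]) (use m b in auto)
  qed
  show "pint q lebesgue (\<lambda>x. A x (u x) (G x)) \<le> C2 powr q * pint p lebesgue G"
  proof -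
    have "pint q lebesgue (\<lambda>x. A x (u x) (G x)) \<le> (\<integral>x. C2 powr q * norm (G x) powr p \<partial>lebesgue)"
      unfolding pint_def by (rule integral_mono_AE[OF LpD(2)[OF L] i b])
    then show ?thesis by (simp add: pint_def)
  qed
  have "C1 * pint p lebesgue G = (\<integral>x. C1 * norm (G x) powr p \<partial>lebesgue)" by (simp add: pint_def)
  also have "\<dots> \<le> (\<integral>x. A x (u x) (G x) \<bullet> G x \<partial>lebesgue)"
  proof (rule integral_mono_AE)
    show "integrable lebesgue (\<lambda>x. C1 * norm (G x) powr p)" using LpD(2)[OF G] by simp
    show "integrable lebesgue (\<lambda>x. A x (u x) (G x) \<bullet> G x)" by (rule holder_inner(1)[OF qps L G])
    show "AE x in lebesgue. C1 * norm (G x) powr p \<le> A x (u x) (G x) \<bullet> G x"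
      using struct by eventually_elim (simp add: inner_commute)
  qed
  finally show "C1 * pint p lebesgue G \<le> (\<integral>x. A x (u x) (G x) \<bullet> G x \<partial>lebesgue)" .
qed

text \<open>The energy at which coercivity balances the datum: for \<open>X > 0\<close>,
  \<open>C1 * X \<le> K * X powr (1/p)\<close> means
  \<open>X powr (1/q) \<le> K / C1\<close>.\<close>

definition M :: real where "M = (K / C1) powr q"

lemma M0: "M \<ge> 0" by (simp add: M_def)

text \<open>Above \<open>M\<close> the coercive term beats the datum; below \<open>M\<close> the
  datum term is bounded by its value at \<open>M\<close>. The first inequality makes the finite
  dimensional problem coercive and bounds the regularising term, the second is the a priori bound
  for the energy.\<close>

lemma energy_bound:
  assumes X: "X \<ge> 0"
  shows "K * X powr (1/p) \<le> C1 * X + K * M powr (1/p)" "C1 * X \<le> K * X powr (1/p) \<Longrightarrow> X \<le> M"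
proof -
  have KM: "K = C1 * M powr (1/q)" using K0 C1 q by (simp add: M_def powr_powr)
  have XX: "X powr (1/q) * X powr (1/p) = X" using X pq by (simp add: powr_add[symmetric] add.commute)
  have less: "K * X powr (1/p) < C1 * X" if "X > M"
  proof -
    have "M powr (1/q) < X powr (1/q)" using that M0 q by (intro powr_less_mono2) auto
    then have "M powr (1/q) * X powr (1/p) < X powr (1/q) * X powr (1/p)" using that M0 by (intro mult_strict_right_mono) auto
    then have "C1 * (M powr (1/q) * X powr (1/p)) < C1 * X" using C1 XX by simp
    then show ?thesis by (subst KM) (simp add: mult.assoc)
  qed
  then show "C1 * X \<le> K * X powr (1/p) \<Longrightarrow> X \<le> M" by force
  show "K * X powr (1/p) \<le> C1 * X + K * M powr (1/p)"
  proof (cases "X > M")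
    case True
    moreover have "0 \<le> K * M powr (1/p)" using K0 by simp
    ultimately show ?thesis using less by linarith
  next
    case False
    then have "K * X powr (1/p) \<le> K * M powr (1/p)" using X K0 p by (intro mult_left_mono powr_mono2) auto
    moreover have "0 \<le> C1 * X" using C1 X by simp
    ultimately show ?thesis by linarith
  qed
qed

text \<open>Pairing the field \<open>P\<close> with \<open>c\<close> gives at least \<open>e\<close>
  times the sum of squares minus a constant \<open>D\<close> that does not depend on
  \<open>c\<close>, so \<open>zero_of_coercive_field\<close> applies on a large cube.\<close>

lemma galerkin_step:
  fixes \<phi> :: "nat \<Rightarrow> real^'n \<Rightarrow> real" and e :: real and m :: nat
  assumes \<phi>: "\<And>i. test_fun (\<phi> i)" and e: "e > 0"
  obtains c where "\<And>i. i < m \<Longrightarrow>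
      (\<integral>x. A x (\<Sum>i<m. c i * \<phi> i x) (grad (\<lambda>x. \<Sum>i<m. c i * \<phi> i x) x) \<bullet> grad (\<phi> i) x \<partial>lebesgue) + e * c i = (\<integral>x. f x * \<phi> i x \<partial>lebesgue)"
proof -
  define v where "v c x = (\<Sum>i<m. c i * \<phi> i x)" for c :: "nat \<Rightarrow> real" and x
  have tv: "test_fun (v c)" for c unfolding v_def by (rule test_fun_sum[OF \<phi>])
  have gv: "grad (v c) x = (\<Sum>i<m. c i *\<^sub>R grad (\<phi> i) x)" for c x unfolding v_def by (rule grad_sum[OF \<phi>])
  define a where "a c i = (\<integral>x. A x (v c x) (grad (v c) x) \<bullet> grad (\<phi> i) x \<partial>lebesgue)" for c i
  define P where "P c i = a c i + e * c i - (\<integral>x. f x * \<phi> i x \<partial>lebesgue)" for c i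
  have LA: "Lp q lebesgue (\<lambda>x. A x (v c x) (grad (v c) x))" for c
    by (rule A_Lp(1)[OF test_meas[OF tv] Lp_grad[OF tv]]) (use p in simp)
  have ai: "integrable lebesgue (\<lambda>x. A x (v c x) (grad (v c) x) \<bullet> grad (\<phi> i) x)" for c i
    by (rule holder_inner(1)[OF qps LA Lp_grad[OF \<phi>]]) (use p in simp)
  have sumP: "(\<Sum>i<m. P c i * c i) = (\<integral>x. A x (v c x) (grad (v c) x) \<bullet> grad (v c) x \<partial>lebesgue) + e * (\<Sum>i<m. (c i)\<^sup>2) - (\<integral>x. f x * v c x \<partial>lebesgue)" for c
  proof -
    have 1: "(\<integral>x. A x (v c x) (grad (v c) x) \<bullet> grad (v c) x \<partial>lebesgue) = (\<Sum>i<m. c i * a c i)"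
      unfolding a_def by (subst (2) gv) (simp add: inner_sum_right ai)
    have 2: "(\<integral>x. f x * v c x \<partial>lebesgue) = (\<Sum>i<m. c i * (\<integral>x. f x * \<phi> i x \<partial>lebesgue))"
    proof -
      have "(\<integral>x. f x * v c x \<partial>lebesgue) = (\<integral>x. (\<Sum>i<m. c i * (f x * \<phi> i x)) \<partial>lebesgue)"
        by (simp add: v_def sum_distrib_left mult_ac)
      also have "\<dots> = (\<Sum>i<m. c i * (\<integral>x. f x * \<phi> i x \<partial>lebesgue))"
        using f_hardy(1)[OF \<phi>] by simp
      finally show ?thesis .
    qed
    show ?thesis unfolding 1 2 P_def
      by (simp add: sum_distrib_left algebra_simps sum.distrib sum_subtractf power2_eq_square)
  qed
  define D where "D = K * M powr (1/p)"
  have D: "D \<ge> 0" using K0 by (simp add: D_def)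
  \<comment> \<open>Large enough that a single component of modulus \<open>R\<close> outweighs
    \<open>D\<close>, since \<open>e * R\<^sup>2 = D + 1\<close>.\<close>
  define R where "R = sqrt ((D + 1) / e)"
  have R: "R > 0" using D e by (simp add: R_def)
  have R2: "e * R\<^sup>2 = D + 1" using D e by (simp add: R_def)
  obtain c where c: "\<And>i. i < m \<Longrightarrow> \<bar>c i\<bar> \<le> R" "\<And>i. i < m \<Longrightarrow> P c i = 0"
  proof (rule zero_of_coercive_field[OF R, of m P])
    fix X :: "nat \<Rightarrow> nat \<Rightarrow> real" and c i
    assume X: "\<And>i. i < m \<Longrightarrow> (\<lambda>k. X k i) \<longlonglongrightarrow> c i" and XR: "\<And>k i. i < m \<Longrightarrow> \<bar>X k i\<bar> \<le> R" and i: "i < m"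
    \<comment> \<open>Dominates the gradients of all combinations with coefficients in the cube,
      which provides one majorant for the dominated convergence behind continuity of the
      field.\<close>
    define H where "H x = R * (\<Sum>i<m. norm (grad (\<phi> i) x))" for x
    have H0: "H x \<ge> 0" for x using R by (auto simp: H_def intro!: sum_nonneg mult_nonneg_nonneg)
    have LH: "Lp p lebesgue H"
    proof -
      have "Lp p lebesgue (\<lambda>x. norm (grad (\<phi> i) x))" for i
        using Lp_grad[OF \<phi>[of i], of p] p by (auto simp: Lp_def)
      moreover have "Lp p lebesgue (\<lambda>x. 0 :: real)" by (simp add: Lp_def)
      ultimately have "Lp p lebesgue (\<lambda>x. \<Sum>i<m. norm (grad (\<phi> i) x))"
        by (induction m) (use p in \<open>auto intro!: Lp_add(1)\<close>)
      from Lp_scale(1)[OF this, of R] show ?thesis by (simp add: H_def[abs_def])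
    qed
    have dom: "integrable lebesgue (\<lambda>x. C2 * (H x powr (p - 1) * norm (grad (\<phi> i) x)))"
    proof (rule integrable_mult_right, rule holder_real(1)[OF qps])
      show "integrable lebesgue (\<lambda>x. (H x powr (p - 1)) powr q)"
        using LpD(2)[OF LH] H0 p1q by (simp add: powr_powr)
      show "integrable lebesgue (\<lambda>x. norm (grad (\<phi> i) x) powr p)" by (rule LpD(2)[OF Lp_grad[OF \<phi>]]) (use p in simp)
    qed (use LpD(1)[OF LH] LpD(1)[OF Lp_grad[OF \<phi>, of p]] p in auto)
    have lim: "(\<lambda>k. a (X k) i) \<longlonglongrightarrow> a c i"
      unfolding a_def
    proof (rule integral_dominated_convergence[OF _ _ dom])
      show "(\<lambda>x. A x (v c x) (grad (v c) x) \<bullet> grad (\<phi> i) x) \<in> borel_measurable lebesgue" using ai by auto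
      show "(\<lambda>x. A x (v (X k) x) (grad (v (X k)) x) \<bullet> grad (\<phi> i) x) \<in> borel_measurable lebesgue" for k using ai by auto
      have "AE x in lebesgue. continuous_on UNIV (\<lambda>(s, \<xi>). A x s \<xi>)" using car by (simp add: caratheodory_def)
      then show "AE x in lebesgue. (\<lambda>k. A x (v (X k) x) (grad (v (X k)) x) \<bullet> grad (\<phi> i) x) \<longlonglongrightarrow> A x (v c x) (grad (v c) x) \<bullet> grad (\<phi> i) x"
      proof eventually_elim
        case (elim x)
        have "(\<lambda>k. (v (X k) x, grad (v (X k)) x)) \<longlonglongrightarrow> (v c x, grad (v c) x)"
          unfolding gv v_def by (intro tendsto_intros X) auto
        from continuous_on_tendsto_compose[OF elim this]
        have "(\<lambda>k. A x (v (X k) x) (grad (v (X k)) x)) \<longlonglongrightarrow> A x (v c x) (grad (v c) x)" by simp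
        then show ?case by (intro tendsto_intros)
      qed
      show "AE x in lebesgue. norm (A x (v (X k) x) (grad (v (X k)) x) \<bullet> grad (\<phi> i) x) \<le> C2 * (H x powr (p - 1) * norm (grad (\<phi> i) x))" for k
        using struct
      proof eventually_elim
        case (elim x)
        have "norm (grad (v (X k)) x) \<le> (\<Sum>i<m. \<bar>X k i\<bar> * norm (grad (\<phi> i) x))"
          unfolding gv by (rule order.trans[OF norm_sum]) simp
        also have "\<dots> \<le> (\<Sum>i<m. R * norm (grad (\<phi> i) x))" by (intro sum_mono mult_right_mono XR) auto
        also have "\<dots> = H x" by (simp add: H_def sum_distrib_left)
        finally have gH: "norm (grad (v (X k)) x) \<le> H x" .
        have "norm (A x (v (X k) x) (grad (v (X k)) x)) \<le> C2 * norm (grad (v (X k)) x) powr (p - 1)" using elim by blast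
        also have "\<dots> \<le> C2 * H x powr (p - 1)" using gH C2 p by (intro mult_left_mono powr_mono2) auto
        finally have "norm (A x (v (X k) x) (grad (v (X k)) x)) * norm (grad (\<phi> i) x) \<le> C2 * H x powr (p - 1) * norm (grad (\<phi> i) x)"
          by (rule mult_right_mono) simp
        then show ?case using Cauchy_Schwarz_ineq2[of "A x (v (X k) x) (grad (v (X k)) x)" "grad (\<phi> i) x"] by (simp add: mult.assoc)
      qed
    qed
    show "(\<lambda>k. P (X k) i) \<longlonglongrightarrow> P c i" unfolding P_def by (intro tendsto_intros lim X i)
  next
    fix c :: "nat \<Rightarrow> real" and i
    assume "i < m" "\<bar>c i\<bar> = R"
    then have "R\<^sup>2 \<le> (\<Sum>i<m. (c i)\<^sup>2)"
      using member_le_sum[of i "{..<m}" "\<lambda>i. (c i)\<^sup>2"] by (metis finite_lessThan lessThan_iff power2_abs zero_le_power2)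
    then have 1: "D + 1 \<le> e * (\<Sum>i<m. (c i)\<^sup>2)" using e unfolding R2[symmetric] by (intro mult_left_mono) auto
    have "C1 * pint p lebesgue (grad (v c)) \<le> (\<integral>x. A x (v c x) (grad (v c) x) \<bullet> grad (v c) x \<partial>lebesgue)"
      by (rule A_Lp(3)[OF test_meas[OF tv] Lp_grad[OF tv]]) (use p in simp)
    moreover have "(\<integral>x. f x * v c x \<partial>lebesgue) \<le> K * pint p lebesgue (grad (v c)) powr (1/p)"
      using f_hardy(3)[OF tv] by (meson abs_le_D1)
    moreover have "K * pint p lebesgue (grad (v c)) powr (1/p) \<le> C1 * pint p lebesgue (grad (v c)) + D"
      unfolding D_def by (rule energy_bound(1)) simp
    ultimately show "0 < (\<Sum>i<m. P c i * c i)" unfolding sumP using 1 by linarith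
  qed (rule that)
  have "a c i + e * c i = (\<integral>x. f x * \<phi> i x \<partial>lebesgue)" if "i < m" for i
    using c(2)[OF that] by (simp add: P_def)
  then show ?thesis
    unfolding a_def v_def[abs_def] by (rule that)
qed

text \<open>Testing with \<open>v m\<close> itself, the regularising term has a sign; dropping it
  yields the energy inequality, keeping it bounds \<open>e m\<close> times the sum of squared
  coefficients. The coefficients may be unbounded, yet \<open>e m * c m i\<close> is then of order
  \<open>sqrt (e m)\<close> and disappears in the limit. Convergence for all test functions follows
  from that for the dense family by uniform bounds on flux and datum.\<close>

lemma galerkin_sequence:
  obtains v where "\<And>m. test_fun (v m)" "\<And>m. pint p lebesgue (grad (v m)) \<le> M"
    "\<And>m. (\<integral>x. A x (v m x) (grad (v m) x) \<bullet> grad (v m) x \<partial>lebesgue) \<le> (\<integral>x. f x * v m x \<partial>lebesgue)"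
    "\<And>\<psi>. test_fun \<psi> \<Longrightarrow> (\<lambda>m. \<integral>x. A x (v m x) (grad (v m) x) \<bullet> grad \<psi> x \<partial>lebesgue) \<longlonglongrightarrow> (\<integral>x. f x * \<psi> x \<partial>lebesgue)"
proof -
  have p0: "p > 0" "p \<ge> 0" using p by auto
  obtain \<phi> :: "nat \<Rightarrow> real^'n \<Rightarrow> real" where \<phi>: "\<And>j. test_fun (\<phi> j)"
    and dense: "\<And>\<psi> e. test_fun \<psi> \<Longrightarrow> e > 0 \<Longrightarrow> \<exists>j. pint p lebesgue (\<lambda>x. grad \<psi> x - grad (\<phi> j) x) \<le> e"
    by (rule test_fun_separable[OF p0(1)]) (rule that)
  define e where "e m = 1 / real (Suc m)" for m
  have e: "e m > 0" for m by (simp add: e_def)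
  define G where "G m c i \<longleftrightarrow> (\<integral>x. A x (\<Sum>i<m. c i * \<phi> i x) (grad (\<lambda>x. \<Sum>i<m. c i * \<phi> i x) x) \<bullet> grad (\<phi> i) x \<partial>lebesgue) + e m * c i = (\<integral>x. f x * \<phi> i x \<partial>lebesgue)"
    for m c and i :: nat
  have "\<forall>m. \<exists>c. \<forall>i<m. G m c i"
  proof
    fix m
    obtain c where "\<And>i. i < m \<Longrightarrow> (\<integral>x. A x (\<Sum>i<m. c i * \<phi> i x) (grad (\<lambda>x. \<Sum>i<m. c i * \<phi> i x) x) \<bullet> grad (\<phi> i) x \<partial>lebesgue) + e m * c i = (\<integral>x. f x * \<phi> i x \<partial>lebesgue)"
      by (rule galerkin_step[where \<phi> = \<phi> and e = "e m" and m = m, OF \<phi> e]) (rule that)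
    then show "\<exists>c. \<forall>i<m. G m c i" unfolding G_def by (intro exI[of _ c] allI impI)
  qed
  from choice[OF this] obtain c where cG: "\<forall>m. \<forall>i<m. G m (c m) i" ..
  have c: "(\<integral>x. A x (\<Sum>i<m. c m i * \<phi> i x) (grad (\<lambda>x. \<Sum>i<m. c m i * \<phi> i x) x) \<bullet> grad (\<phi> i) x \<partial>lebesgue) + e m * c m i = (\<integral>x. f x * \<phi> i x \<partial>lebesgue)"
    if "i < m" for m i using cG that unfolding G_def by blast
  define v where "v m x = (\<Sum>i<m. c m i * \<phi> i x)" for m x
  have tv: "test_fun (v m)" for m unfolding v_def by (rule test_fun_sum[OF \<phi>])
  have gv: "grad (v m) x = (\<Sum>i<m. c m i *\<^sub>R grad (\<phi> i) x)" for m x unfolding v_def by (rule grad_sum[OF \<phi>])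
  define B where "B m x = A x (v m x) (grad (v m) x)" for m x
  have eq: "(\<integral>x. B m x \<bullet> grad (\<phi> i) x \<partial>lebesgue) + e m * c m i = (\<integral>x. f x * \<phi> i x \<partial>lebesgue)" if "i < m" for m i
    using c[OF that] unfolding B_def v_def[abs_def] .
  have LB: "Lp q lebesgue (B m)" for m
    unfolding B_def[abs_def] by (rule A_Lp(1)[OF test_meas[OF tv] Lp_grad[OF tv p0(2)]])
  have Bi: "integrable lebesgue (\<lambda>x. B m x \<bullet> grad w x)" if "test_fun w" for m w
    by (rule holder_inner(1)[OF qps LB Lp_grad[OF that p0(2)]])
  have energy: "(\<integral>x. B m x \<bullet> grad (v m) x \<partial>lebesgue) + e m * (\<Sum>i<m. (c m i)\<^sup>2) = (\<integral>x. f x * v m x \<partial>lebesgue)" for m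
  proof -
    have 1: "(\<integral>x. B m x \<bullet> grad (v m) x \<partial>lebesgue) = (\<Sum>i<m. c m i * (\<integral>x. B m x \<bullet> grad (\<phi> i) x \<partial>lebesgue))"
      by (subst gv) (simp add: inner_sum_right Bi \<phi>)
    have "(\<integral>x. f x * v m x \<partial>lebesgue) = (\<integral>x. (\<Sum>i<m. c m i * (f x * \<phi> i x)) \<partial>lebesgue)"
      by (simp add: v_def sum_distrib_left mult_ac)
    also have "\<dots> = (\<Sum>i<m. c m i * (\<integral>x. f x * \<phi> i x \<partial>lebesgue))"
      using f_hardy(1)[OF \<phi>] by simp
    also have "\<dots> = (\<Sum>i<m. c m i * ((\<integral>x. B m x \<bullet> grad (\<phi> i) x \<partial>lebesgue) + e m * c m i))"
      by (intro sum.cong) (auto simp: eq)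
    finally show ?thesis unfolding 1
      by (simp add: sum_distrib_left algebra_simps sum.distrib power2_eq_square)
  qed
  define X where "X m = pint p lebesgue (grad (v m))" for m
  have X0: "X m \<ge> 0" for m by (simp add: X_def)
  have en0: "e m * (\<Sum>i<m. (c m i)\<^sup>2) \<ge> 0" for m using e[of m] by (intro mult_nonneg_nonneg sum_nonneg) auto
  have low: "C1 * X m \<le> (\<integral>x. B m x \<bullet> grad (v m) x \<partial>lebesgue)" for m
    unfolding X_def B_def by (rule A_Lp(3)[OF test_meas[OF tv] Lp_grad[OF tv p0(2)]])
  have up: "(\<integral>x. f x * v m x \<partial>lebesgue) \<le> K * X m powr (1/p)" for m
    using f_hardy(3)[OF tv[of m]] unfolding X_def by (meson abs_le_D1)
  have XM: "X m \<le> M" for m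
    by (rule energy_bound(2)[OF X0]) (use low[of m] up[of m] energy[of m] en0[of m] in linarith)
  define D where "D = K * M powr (1/p)"
  have cD: "e m * (\<Sum>i<m. (c m i)\<^sup>2) \<le> D" for m
    using low[of m] up[of m] energy[of m] energy_bound(1)[OF X0[of m]] unfolding D_def by linarith
  have small: "\<bar>e m * c m i\<bar> \<le> sqrt (e m * D)" if "i < m" for m i
  proof (rule real_le_rsqrt)
    have "(c m i)\<^sup>2 \<le> (\<Sum>i<m. (c m i)\<^sup>2)" using that by (intro member_le_sum) auto
    then have "e m * (e m * (c m i)\<^sup>2) \<le> e m * (e m * (\<Sum>i<m. (c m i)\<^sup>2))"
      using e[of m] by (intro mult_left_mono) auto
    also have "\<dots> \<le> e m * D" using e[of m] cD[of m] by (intro mult_left_mono) auto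
    finally show "\<bar>e m * c m i\<bar>\<^sup>2 \<le> e m * D" by (simp add: power2_eq_square mult_ac)
  qed
  have conv_basis: "(\<lambda>m. \<integral>x. B m x \<bullet> grad (\<phi> i) x \<partial>lebesgue) \<longlonglongrightarrow> (\<integral>x. f x * \<phi> i x \<partial>lebesgue)" for i
  proof (rule LIM_zero_cancel, rule Lim_null_comparison)
    have "(\<lambda>m. sqrt (inverse (real (Suc m)) * D)) \<longlonglongrightarrow> sqrt (0 * D)"
      by (intro tendsto_intros LIMSEQ_inverse_real_of_nat)
    then show "(\<lambda>m. sqrt (e m * D)) \<longlonglongrightarrow> 0" by (simp add: e_def inverse_eq_divide)
    \<comment> \<open>The equation tested with \<open>\<phi> i\<close> is available only once
      \<open>m > i\<close>.\<close>
    show "\<forall>\<^sub>F m in sequentially. norm ((\<integral>x. B m x \<bullet> grad (\<phi> i) x \<partial>lebesgue) - (\<integral>x. f x * \<phi> i x \<partial>lebesgue)) \<le> sqrt (e m * D)"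
      using eventually_gt_at_top[of i]
    proof eventually_elim
      case (elim m)
      have "(\<integral>x. B m x \<bullet> grad (\<phi> i) x \<partial>lebesgue) - (\<integral>x. f x * \<phi> i x \<partial>lebesgue) = - (e m * c m i)"
        using eq[OF elim] by linarith
      then show ?case using small[OF elim] by simp
    qed
  qed
  define Q where "Q = (C2 powr q * M) powr (1/q)"
  have BQ: "pint q lebesgue (B m) powr (1/q) \<le> Q" for m
  proof -
    have "pint q lebesgue (B m) \<le> C2 powr q * X m"
      unfolding B_def[abs_def] X_def by (rule A_Lp(2)[OF test_meas[OF tv] Lp_grad[OF tv p0(2)]])
    also have "\<dots> \<le> C2 powr q * M" by (intro mult_left_mono XM) simp
    finally show ?thesis unfolding Q_def using q by (intro powr_mono2) auto
  qed
  have conv: "(\<lambda>m. \<integral>x. B m x \<bullet> grad \<psi> x \<partial>lebesgue) \<longlonglongrightarrow> (\<integral>x. f x * \<psi> x \<partial>lebesgue)" if \<psi>: "test_fun \<psi>" for \<psi>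
  proof (rule LIMSEQ_I)
    fix r :: real assume r: "r > 0"
    \<comment> \<open>An error of at most \<open>d\<close> in gradient energy costs at most
      \<open>r / 3\<close> in the flux and datum terms together, uniformly in \<open>m\<close>; the
      1 keeps the divisor positive.\<close>
    define d where "d = (r / (3 * (Q + K + 1))) powr p"
    have QK: "Q + K + 1 > 0" using K0 by (simp add: Q_def add_nonneg_pos)
    have d: "d > 0" "d powr (1/p) = r / (3 * (Q + K + 1))" using r QK p by (auto simp: d_def powr_powr)
    obtain j where j: "pint p lebesgue (\<lambda>x. grad \<psi> x - grad (\<phi> j) x) \<le> d" using dense[OF \<psi> d(1)] by blast
    define w where "w x = \<psi> x - \<phi> j x" for x
    have tw: "test_fun w" using test_fun_lincomb[OF \<psi> \<phi>[of j], of 1 "-1"] by (simp add: w_def[abs_def])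
    have gw: "grad w x = grad \<psi> x - grad (\<phi> j) x" for x
      using grad_lincomb[OF \<psi> \<phi>[of j], of 1 "-1" x] by (simp add: w_def[abs_def])
    have wd: "pint p lebesgue (grad w) powr (1/p) \<le> d powr (1/p)"
      using j p unfolding gw[abs_def] by (intro powr_mono2) auto
    from LIMSEQ_D[OF conv_basis[of j], of "r/3"] r obtain N where
      N: "\<And>m. m \<ge> N \<Longrightarrow> \<bar>(\<integral>x. B m x \<bullet> grad (\<phi> j) x \<partial>lebesgue) - (\<integral>x. f x * \<phi> j x \<partial>lebesgue)\<bar> < r/3" by auto
    have "norm ((\<integral>x. B m x \<bullet> grad \<psi> x \<partial>lebesgue) - (\<integral>x. f x * \<psi> x \<partial>lebesgue)) < r" if m: "m \<ge> N" for m
    proof -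
      have 1: "(\<integral>x. B m x \<bullet> grad \<psi> x \<partial>lebesgue) = (\<integral>x. B m x \<bullet> grad (\<phi> j) x \<partial>lebesgue) + (\<integral>x. B m x \<bullet> grad w x \<partial>lebesgue)"
        unfolding gw using Bi[OF \<psi>] Bi[OF \<phi>] by (simp add: inner_diff_right)
      have 2: "(\<integral>x. f x * \<psi> x \<partial>lebesgue) = (\<integral>x. f x * \<phi> j x \<partial>lebesgue) + (\<integral>x. f x * w x \<partial>lebesgue)"
        unfolding w_def using f_hardy(1)[OF \<psi>] f_hardy(1)[OF \<phi>] by (simp add: right_diff_distrib)
      have "\<bar>\<integral>x. B m x \<bullet> grad w x \<partial>lebesgue\<bar> \<le> pint q lebesgue (B m) powr (1/q) * pint p lebesgue (grad w) powr (1/p)"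
        by (rule holder_inner(3)[OF qps LB Lp_grad[OF tw p0(2)]])
      also have "\<dots> \<le> Q * d powr (1/p)" using BQ wd by (intro mult_mono) (auto simp: Q_def)
      finally have 3: "\<bar>\<integral>x. B m x \<bullet> grad w x \<partial>lebesgue\<bar> \<le> Q * d powr (1/p)" .
      have 4: "\<bar>\<integral>x. f x * w x \<partial>lebesgue\<bar> \<le> K * d powr (1/p)"
        using f_hardy(3)[OF tw] mult_left_mono[OF wd K0] by linarith
      have "(Q + K) * d powr (1/p) \<le> (Q + K + 1) * d powr (1/p)" by (intro mult_right_mono) auto
      also have "\<dots> = r / 3"
      proof -
        have *: "y * (r / (3 * y)) = r / 3" if "y > 0" for y :: real using that by simp
        show ?thesis unfolding d(2) by (rule *[OF QK])
      qed
      finally have 5: "Q * d powr (1/p) + K * d powr (1/p) \<le> r / 3" by (simp add: distrib_right)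
      have "r / 3 + r / 3 < r" using r by simp
      then show ?thesis using 3 4 5 N[OF m] unfolding 1 2 real_norm_def by linarith
    qed
    then show "\<exists>N. \<forall>m\<ge>N. norm ((\<integral>x. B m x \<bullet> grad \<psi> x \<partial>lebesgue) - (\<integral>x. f x * \<psi> x \<partial>lebesgue)) < r" by blast
  qed
  show ?thesis
  proof (rule that[of v])
    show "(\<integral>x. A x (v m x) (grad (v m) x) \<bullet> grad (v m) x \<partial>lebesgue) \<le> (\<integral>x. f x * v m x \<partial>lebesgue)" for m
      using energy[of m] en0[of m] unfolding B_def by linarith
  qed (use tv XM conv in \<open>auto simp: X_def B_def\<close>)
qed

end

section \<open>Limits in the energy space\<close>

lemma test_fun_bounds:
  assumes "test_fun w"
  obtains R B where "R > 0" "B > 0" "\<And>x. norm x \<ge> R \<Longrightarrow> w x = 0" "\<And>x. norm x \<ge> R \<Longrightarrow> grad w x = 0"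
    "\<And>x. \<bar>w x\<bar> \<le> B" "\<And>x. norm (grad w x) \<le> B"
proof -
  note C = test_fun_C1[OF assms]
  obtain R where R: "R > 0" "\<forall>x. norm x \<ge> R \<longrightarrow> w x = 0 \<and> grad w x = 0" using C(4) by blast
  then have R0: "norm x \<ge> R \<Longrightarrow> w x = 0" "norm x \<ge> R \<Longrightarrow> grad w x = 0" for x by auto
  obtain B1 where B1: "B1 > 0" "\<And>x. norm (w x) \<le> B1"
    by (rule bounded_of_compact_support[where R = R, OF C(2) R0(1)]) (assumption, rule that)
  obtain B2 where B2: "B2 > 0" "\<And>x. norm (grad w x) \<le> B2"
    by (rule bounded_of_compact_support[where R = R, OF C(3) R0(2)]) (assumption, rule that)
  show ?thesis
  proof (rule that[of R "max B1 B2"])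
    show "\<bar>w x\<bar> \<le> max B1 B2" for x using B1(2)[of x] by simp
    show "norm (grad w x) \<le> max B1 B2" for x using B2(2)[of x] by simp
  qed (use R(1) B1(1) R0 in auto)
qed

section \<open>Integration by parts for test functions\<close>

lemma integrable_continuous_compact_support:
  fixes h :: "'a::euclidean_space \<Rightarrow> real"
  assumes "continuous_on UNIV h" "\<And>x. norm x \<ge> R \<Longrightarrow> h x = 0"
  shows "integrable lebesgue h"
proof -
  have L: "Lp 1 lebesgue h" by (rule Lp_compact_support[where R = R]) (use assms in auto)
  then have "integrable lebesgue (\<lambda>x. \<bar>h x\<bar>)" by (simp add: Lp_def)
  then show ?thesis using LpD(1)[OF L] by (rule integrable_abs_cancel)
qed

text \<open>Difference quotients have integral zero by translation invariance, and they converge to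
  the derivative under a bounded majorant of compact support.\<close>

lemma integral_partial_deriv_zero:
  fixes \<psi> :: "real^'n \<Rightarrow> real"
  assumes \<psi>: "test_fun \<psi>"
  shows "(\<integral>x. grad \<psi> x $ i \<partial>lebesgue) = 0"
proof -
  note C = test_fun_C1[OF \<psi>]
  obtain R B where R: "R > 0" "\<And>x. norm x \<ge> R \<Longrightarrow> \<psi> x = 0" and B: "B > 0" "\<And>x. norm (grad \<psi> x) \<le> B"
    by (rule test_fun_bounds[OF \<psi>]) (rule that)
  have [measurable]: "\<psi> \<in> borel_measurable borel" "grad \<psi> \<in> borel_measurable borel"
    using C by (auto intro: borel_measurable_continuous_onI)
  have gm[measurable]: "(\<lambda>x. grad \<psi> x $ i) \<in> borel_measurable borel"
    by (rule borel_measurable_continuous_onI) (intro continuous_on_component C)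
  define e where "e = (axis i 1 :: real^'n)"
  have e1: "norm e = 1" by (simp add: e_def)
  define h where "h k = inverse (real (Suc k))" for k
  have h: "h k > 0" "h k \<le> 1" for k by (auto simp: h_def inverse_le_1_iff)
  have h0: "h \<longlonglongrightarrow> 0" unfolding h_def by (rule LIMSEQ_inverse_real_of_nat)
  define D where "D k x = (\<psi> (h k *\<^sub>R e + x) - \<psi> x) / h k" for k x
  have [measurable]: "D k \<in> borel_measurable borel" for k unfolding D_def[abs_def] by measurable
  have i\<psi>: "integrable lborel \<psi>"
  proof -
    have "integrable lebesgue \<psi>" by (rule integrable_continuous_compact_support[where R = R]) (use C R in auto)
    then show ?thesis by (subst (asm) integrable_completion) auto
  qed
  have tr: "integrable lborel (\<lambda>x. \<psi> (a + x)) \<and> (\<integral>x. \<psi> (a + x) \<partial>lborel) = (\<integral>x. \<psi> x \<partial>lborel)" for a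
  proof -
    have "integrable (distr lborel borel ((+) a)) \<psi>" using i\<psi> by (simp add: lborel_distr_plus)
    then have "integrable lborel (\<lambda>x. \<psi> (a + x))" by (subst (asm) integrable_distr_eq) auto
    moreover have "(\<integral>x. \<psi> x \<partial>distr lborel borel ((+) a)) = (\<integral>x. \<psi> (a + x) \<partial>lborel)"
      by (rule integral_distr) auto
    ultimately show ?thesis by (simp add: lborel_distr_plus)
  qed
  have zero: "(\<integral>x. D k x \<partial>lborel) = 0" for k
    unfolding D_def using tr[of "h k *\<^sub>R e"] i\<psi> by simp
  \<comment> \<open>The steps \<open>h k\<close> are at most 1, so all quotients vanish outside the
    ball of radius \<open>R + 1\<close>.\<close>
  have "(\<lambda>k. \<integral>x. D k x \<partial>lborel) \<longlonglongrightarrow> (\<integral>x. grad \<psi> x $ i \<partial>lborel)"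
  proof (rule integral_dominated_convergence[where w = "\<lambda>x. B * indicat_real (cball 0 (R + 1)) x"])
    show "integrable lborel (\<lambda>x. B * indicat_real (cball (0::real^'n) (R + 1)) x)"
      using emeasure_bounded_finite[OF bounded_cball[of "0::real^'n" "R + 1"]] by (intro integrable_mult_right integrable_real_indicator) auto
    show "AE x in lborel. (\<lambda>k. D k x) \<longlonglongrightarrow> grad \<psi> x $ i"
    proof (rule always_eventually, rule allI)
      fix x
      have "((\<lambda>s. \<psi> (x + s *\<^sub>R e)) has_vector_derivative (grad \<psi> (x + 0 *\<^sub>R e) \<bullet> e)) (at 0 within UNIV)"
        by (rule has_vector_derivative_along_line) (rule C(1))
      then have "((\<lambda>s. \<psi> (x + s *\<^sub>R e)) has_real_derivative (grad \<psi> x $ i)) (at 0)"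
        by (simp add: has_real_derivative_iff_has_vector_derivative e_def inner_axis)
      then have "((\<lambda>h. (\<psi> (x + (0 + h) *\<^sub>R e) - \<psi> (x + 0 *\<^sub>R e)) / h) \<longlongrightarrow> grad \<psi> x $ i) (at 0)"
        unfolding DERIV_def .
      moreover have "filterlim h (at 0) sequentially"
        unfolding filterlim_at using h0 h(1) by (auto simp: less_imp_neq[symmetric])
      ultimately have "(\<lambda>k. (\<psi> (x + (0 + h k) *\<^sub>R e) - \<psi> (x + 0 *\<^sub>R e)) / h k) \<longlonglongrightarrow> grad \<psi> x $ i"
        by (rule filterlim_compose)
      then show "(\<lambda>k. D k x) \<longlonglongrightarrow> grad \<psi> x $ i" by (simp add: D_def add.commute)
    qed
    show "AE x in lborel. norm (D k x) \<le> B * indicat_real (cball 0 (R + 1)) x" for k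
    proof (rule always_eventually, rule allI)
      fix x
      show "norm (D k x) \<le> B * indicat_real (cball 0 (R + 1)) x"
      proof (cases "norm x \<le> R + 1")
        case True
        have "norm (\<psi> (x + h k *\<^sub>R e) - \<psi> (x + 0 *\<^sub>R e)) \<le> B * norm (h k - 0)"
        proof (rule field_differentiable_bound[of UNIV "\<lambda>s. \<psi> (x + s *\<^sub>R e)" "\<lambda>s. grad \<psi> (x + s *\<^sub>R e) \<bullet> e"])
          show "((\<lambda>s. \<psi> (x + s *\<^sub>R e)) has_field_derivative grad \<psi> (x + s *\<^sub>R e) \<bullet> e) (at s within UNIV)" for s
            using has_vector_derivative_along_line[OF C(1), of x e s UNIV] by (simp add: has_real_derivative_iff_has_vector_derivative)
          show "norm (grad \<psi> (x + s *\<^sub>R e) \<bullet> e) \<le> B" for s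
            using Cauchy_Schwarz_ineq2[of "grad \<psi> (x + s *\<^sub>R e)" e] B(2)[of "x + s *\<^sub>R e"] e1 by simp
        qed auto
        then have "\<bar>\<psi> (h k *\<^sub>R e + x) - \<psi> x\<bar> \<le> B * h k" using h[of k] by (simp add: add.commute)
        then show ?thesis using True h[of k] by (simp add: D_def divide_le_eq)
      next
        case False
        have "norm x \<le> norm (h k *\<^sub>R e + x) + norm (h k *\<^sub>R e)" using norm_triangle_ineq4[of "h k *\<^sub>R e + x" "h k *\<^sub>R e"] by simp
        then have "norm (h k *\<^sub>R e + x) \<ge> R" using False h[of k] e1 by simp
        then show ?thesis using False R by (simp add: D_def)
      qed
    qed
  qed auto
  then have "(\<integral>x. grad \<psi> x $ i \<partial>lborel) = 0" unfolding zero by (simp add: LIMSEQ_const_iff)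
  then show ?thesis by (simp add: integral_completion)
qed

lemma test_fun_mult:
  assumes "test_fun f" "test_fun g"
  shows "test_fun (\<lambda>x. f x * g x)" "grad (\<lambda>x. f x * g x) x = f x *\<^sub>R grad g x + g x *\<^sub>R grad f x"
proof -
  obtain R where "\<forall>x. norm x > R \<longrightarrow> f x = 0" using assms by (auto simp: test_fun_iff)
  then have "\<forall>x. norm x > R \<longrightarrow> f x * g x = 0" by simp
  moreover have "smooth_fun (\<lambda>x. f x * g x)"
    using assms by (auto simp: test_fun_iff smooth_fun_def intro!: Ck_mult)
  ultimately show "test_fun (\<lambda>x. f x * g x)" unfolding test_fun_iff by blast
  show "grad (\<lambda>x. f x * g x) x = f x *\<^sub>R grad g x + g x *\<^sub>R grad f x"
  proof (rule grad_eqI)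
    note [derivative_intros] = has_derivative_grad[OF test_fun_C1(1)[OF assms(1)]] has_derivative_grad[OF test_fun_C1(1)[OF assms(2)]]
    show "((\<lambda>x. f x * g x) has_derivative (\<bullet>) (f x *\<^sub>R grad g x + g x *\<^sub>R grad f x)) (at x)"
      by (auto intro!: derivative_eq_intros simp: inner_add_left fun_eq_iff)
  qed
qed

lemma integration_by_parts:
  assumes w: "test_fun w" and \<phi>: "test_fun \<phi>"
  shows "(\<integral>x. w x * partial_deriv i \<phi> x \<partial>lebesgue) = - (\<integral>x. grad w x $ i * \<phi> x \<partial>lebesgue)"
proof -
  obtain R B where R: "\<And>x. norm x \<ge> R \<Longrightarrow> w x = 0" "\<And>x. norm x \<ge> R \<Longrightarrow> grad w x = 0"
    by (rule test_fun_bounds[OF w]) (rule that)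
  note Cw = test_fun_C1[OF w] and Cp = test_fun_C1[OF \<phi>]
  have 1: "integrable lebesgue (\<lambda>x. w x * grad \<phi> x $ i)"
    by (rule integrable_continuous_compact_support[where R = R])
       (use R Cw Cp in \<open>auto intro!: continuous_intros\<close>)
  have 2: "integrable lebesgue (\<lambda>x. grad w x $ i * \<phi> x)"
    by (rule integrable_continuous_compact_support[where R = R])
       (use R Cw Cp in \<open>auto intro!: continuous_intros\<close>)
  have "0 = (\<integral>x. grad (\<lambda>x. w x * \<phi> x) x $ i \<partial>lebesgue)"
    by (rule integral_partial_deriv_zero[symmetric]) (rule test_fun_mult(1)[OF w \<phi>])
  also have "\<dots> = (\<integral>x. w x * grad \<phi> x $ i + grad w x $ i * \<phi> x \<partial>lebesgue)"
    unfolding test_fun_mult(2)[OF w \<phi>] by (simp add: mult.commute)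
  also have "\<dots> = (\<integral>x. w x * grad \<phi> x $ i \<partial>lebesgue) + (\<integral>x. grad w x $ i * \<phi> x \<partial>lebesgue)"
    by (rule Bochner_Integration.integral_add[OF 1 2])
  finally show ?thesis by (simp add: partial_deriv_eq_grad)
qed

text \<open>The growth of the constant in \<open>R\<close> is made explicit: it is later compared
  with the volume of the ball to exclude a positive lower bound for the solution.\<close>

lemma hardy_ball:
  fixes w :: "real^'n \<Rightarrow> real"
  assumes pq: "p > 1" "q > 1" "1/p + 1/q = 1" and n: "real CARD('n) > p" and w: "test_fun w" and R: "R \<ge> 0"
  shows "(\<integral>\<^sup>+x. ennreal (indicat_real (cball 0 R) x * \<bar>w x\<bar>) \<partial>lebesgue)
    \<le> ennreal (p / (real CARD('n) - p) * (R * measure lebesgue (cball (0::real^'n) R) powr (1/q)) * pint p lebesgue (grad w) powr (1/p))"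
proof -
  define m where "m = measure lborel (cball (0::real^'n) R)"
  have fin: "emeasure lborel (cball (0::real^'n) R) < \<infinity>"
    using emeasure_bounded_finite[OF bounded_cball[of "0::real^'n" R]] by auto
  have i: "integrable lborel (\<lambda>x::real^'n. R powr q * indicat_real (cball 0 R) x)"
    using fin by (intro integrable_mult_right integrable_real_indicator) auto
  have "(\<integral>x. (norm x * indicat_real (cball (0::real^'n) R) x) powr q \<partial>lborel) \<le> (\<integral>x. R powr q * indicat_real (cball (0::real^'n) R) x \<partial>lborel)"
  proof (rule integral_mono[OF integrable_ball_weight i])
    fix x :: "real^'n"
    show "(norm x * indicat_real (cball 0 R) x) powr q \<le> R powr q * indicat_real (cball 0 R) x"
      using pq by (cases "norm x \<le> R") (auto intro!: powr_mono2)
  qed (use pq in simp)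
  also have "\<dots> = R powr q * m" using fin by (simp add: m_def)
  finally have "(\<integral>x. (norm x * indicat_real (cball (0::real^'n) R) x) powr q \<partial>lborel) powr (1/q) \<le> (R powr q * m) powr (1/q)"
    using pq by (intro powr_mono2) (auto intro: integral_nonneg_AE)
  also have "\<dots> = R * m powr (1/q)"
    using R pq by (subst powr_mult) (auto simp: powr_powr m_def)
  finally have 1: "(\<integral>x. (norm x * indicat_real (cball (0::real^'n) R) x) powr q \<partial>lborel) powr (1/q) \<le> R * m powr (1/q)" .
  have "(\<integral>\<^sup>+x. ennreal (indicat_real (cball 0 R) x * \<bar>w x\<bar>) \<partial>lborel)
     \<le> ennreal (p / (real CARD('n) - p) * (\<integral>x. (norm x * indicat_real (cball (0::real^'n) R) x) powr q \<partial>lborel) powr (1/q) * pint p lebesgue (grad w) powr (1/p))"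
    by (rule hardy_dual[OF pq n w]) (use integrable_ball_weight[of q R] pq in auto)
  also have "\<dots> \<le> ennreal (p / (real CARD('n) - p) * (R * m powr (1/q)) * pint p lebesgue (grad w) powr (1/p))"
    using 1 pq n by (intro ennreal_leI mult_right_mono mult_left_mono) auto
  also have "m = measure lebesgue (cball (0::real^'n) R)" unfolding m_def by simp
  finally show ?thesis unfolding nn_integral_completion .
qed

text \<open>The dual Hardy inequality gives back a primal one when
  \<open>\<bar>w x\<bar> powr (p - 1)\<close> on the ball is taken as datum. The integral to be
  estimated then stands on both sides, to a lower power on the right.\<close>

lemma hardy_ball_Lp:
  fixes w :: "real^'n \<Rightarrow> real"
  assumes pq: "p > 1" "q > 1" "1/p + 1/q = 1" and n: "real CARD('n) > p" and w: "test_fun w" and R: "R \<ge> 0"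
  shows "Lp p lebesgue (\<lambda>x. indicat_real (cball 0 R) x *\<^sub>R w x)"
    "pint p lebesgue (\<lambda>x. indicat_real (cball 0 R) x *\<^sub>R w x) \<le> (p / (real CARD('n) - p) * R) powr p * pint p lebesgue (grad w)"
proof -
  have p1q: "(p - 1) * q = p" using pq by (simp add: field_simps)
  obtain R0 B where R0: "\<And>x. norm x \<ge> R0 \<Longrightarrow> w x = 0"
    by (rule test_fun_bounds[OF w]) (rule that)
  have wm[measurable]: "w \<in> borel_measurable borel"
    using test_fun_C1(2)[OF w] by (rule borel_measurable_continuous_onI)
  have Lw: "Lp p lebesgue w" by (rule Lp_compact_support[where R = R0, OF test_fun_C1(2)[OF w] R0]) (use pq in auto)
  have gm: "(\<lambda>x. indicat_real (cball 0 R) x *\<^sub>R w x) \<in> borel_measurable borel" by measurable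
  show L: "Lp p lebesgue (\<lambda>x. indicat_real (cball 0 R) x *\<^sub>R w x)"
    by (rule Lp_bound(1)[OF Lw]) (use gm pq in \<open>auto intro!: measurable_completion split: split_indicator\<close>)
  define Y where "Y = pint p lebesgue (\<lambda>x. indicat_real (cball 0 R) x *\<^sub>R w x)"
  define k where "k = p / (real CARD('n) - p)"
  have k: "k \<ge> 0" using pq n by (simp add: k_def)
  have Y0: "Y \<ge> 0" by (simp add: Y_def)
  have Yl: "Y = (\<integral>x. norm (indicat_real (cball 0 R) x *\<^sub>R w x) powr p \<partial>lborel)"
    unfolding Y_def pint_lborel[OF gm] by (simp add: pint_def)
  have iY: "integrable lborel (\<lambda>x. norm (indicat_real (cball 0 R) x *\<^sub>R w x) powr p)"
    using LpD(2)[OF L] by (subst (asm) integrable_completion) auto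
  define f where "f x = indicat_real (cball 0 R) x * \<bar>w x\<bar> powr (p - 1)" for x
  have fm[measurable]: "f \<in> borel_measurable borel" unfolding f_def[abs_def] by measurable
  have fq: "(norm x * f x) powr q \<le> R powr q * norm (indicat_real (cball 0 R) x *\<^sub>R w x) powr p" for x
  proof (cases "norm x \<le> R")
    case True
    have "(norm x * f x) powr q = norm x powr q * (\<bar>w x\<bar> powr (p - 1)) powr q"
      using True by (simp add: f_def powr_mult)
    also have "\<dots> = norm x powr q * \<bar>w x\<bar> powr p" by (simp add: powr_powr p1q)
    also have "\<dots> \<le> R powr q * \<bar>w x\<bar> powr p" using True pq by (intro mult_right_mono powr_mono2) auto
    finally show ?thesis using True by simp
  next
    case False
    then show ?thesis using pq by (simp add: f_def)
  qed
  have iR: "integrable lborel (\<lambda>x. R powr q * norm (indicat_real (cball 0 R) x *\<^sub>R w x) powr p)" using iY by simp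
  have fi: "integrable lborel (\<lambda>x. (norm x * f x) powr q)"
    by (rule Bochner_Integration.integrable_bound[OF iR]) (use fq in auto)
  have "(\<integral>x. (norm x * f x) powr q \<partial>lborel) \<le> (\<integral>x. R powr q * norm (indicat_real (cball 0 R) x *\<^sub>R w x) powr p \<partial>lborel)"
    by (rule integral_mono[OF fi iR fq])
  also have "\<dots> = R powr q * Y" by (simp add: Yl)
  finally have "(\<integral>x. (norm x * f x) powr q \<partial>lborel) powr (1/q) \<le> (R powr q * Y) powr (1/q)"
    using pq by (intro powr_mono2) (auto intro: integral_nonneg_AE)
  also have "\<dots> = R * Y powr (1/q)" using R pq Y0 by (subst powr_mult) (auto simp: powr_powr)
  finally have 1: "(\<integral>x. (norm x * f x) powr q \<partial>lborel) powr (1/q) \<le> R * Y powr (1/q)" .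
  define E where "E = pint p lebesgue (grad w)"
  have E: "E \<ge> 0" by (simp add: E_def)
  have "f x * \<bar>w x\<bar> = norm (indicat_real (cball 0 R) x *\<^sub>R w x) powr p" for x
  proof (cases "w x = 0")
    case False
    then have "\<bar>w x\<bar> powr (p - 1) * \<bar>w x\<bar> = \<bar>w x\<bar> powr p"
      using powr_add[of "\<bar>w x\<bar>" "p - 1" 1] by (simp add: powr_one)
    then show ?thesis by (simp add: f_def split: split_indicator)
  qed (simp add: f_def)
  then have "ennreal Y = (\<integral>\<^sup>+x. ennreal (f x * \<bar>w x\<bar>) \<partial>lborel)"
    unfolding Yl using iY by (simp add: nn_integral_eq_integral)
  also have "\<dots> \<le> ennreal (k * (\<integral>x. (norm x * f x) powr q \<partial>lborel) powr (1/q) * E powr (1/p))"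
    unfolding k_def E_def by (rule hardy_dual[OF pq n w fm _ fi]) (simp add: f_def)
  also have "\<dots> \<le> ennreal (k * (R * Y powr (1/q)) * E powr (1/p))"
    using 1 k by (intro ennreal_leI mult_right_mono mult_left_mono) auto
  finally have YY: "Y \<le> k * (R * Y powr (1/q)) * E powr (1/p)" using k R by (subst (asm) ennreal_le_iff) auto
  \<comment> \<open>Absorption: \<open>Y\<close> is finite because \<open>w\<close> is a test
    function, so \<open>Y powr (1/q)\<close> can be cancelled.\<close>
  have "Y \<le> (k * R) powr p * E"
  proof (cases "Y = 0")
    case True then show ?thesis using E by simp
  next
    case False
    then have Yp: "Y > 0" using Y0 by simp
    have split: "Y powr (1/p) * Y powr (1/q) = Y" using Yp pq by (simp add: powr_add[symmetric])
    have "Y powr (1/p) * Y powr (1/q) \<le> (k * R * E powr (1/p)) * Y powr (1/q)" unfolding split using YY by (simp add: mult_ac)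
    then have "Y powr (1/p) \<le> k * R * E powr (1/p)" using Yp by (simp add: mult_le_cancel_right)
    then have "(Y powr (1/p)) powr p \<le> (k * R * E powr (1/p)) powr p" using pq by (intro powr_mono2) auto
    then show ?thesis using Y0 E k R pq by (simp add: powr_powr powr_mult)
  qed
  then show "pint p lebesgue (\<lambda>x. indicat_real (cball 0 R) x *\<^sub>R w x) \<le> (p / (real CARD('n) - p) * R) powr p * pint p lebesgue (grad w)"
    by (simp add: Y_def k_def E_def)
qed

text \<open>Meant for the partial derivatives of a test function as weight, when integration by
  parts is passed to the limit.\<close>

lemma hardy_compact_weight:
  fixes w h :: "real^'n \<Rightarrow> real"
  assumes pq: "p > 1" "q > 1" "1/p + 1/q = 1" and n: "real CARD('n) > p"
    and h: "continuous_on UNIV h" "\<And>x. norm x \<ge> R \<Longrightarrow> h x = 0"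
  obtains C where "C \<ge> 0" "\<And>w :: real^'n \<Rightarrow> real. test_fun w \<Longrightarrow> (\<integral>\<^sup>+x. ennreal (\<bar>h x\<bar> * \<bar>w x\<bar>) \<partial>lebesgue) \<le> ennreal (C * pint p lebesgue (grad w) powr (1/p))"
proof -
  define C where "C = p / (real CARD('n) - p) * (\<integral>x. (norm x * \<bar>h x\<bar>) powr q \<partial>lborel) powr (1/q)"
  have hm[measurable]: "h \<in> borel_measurable borel" using h(1) by (rule borel_measurable_continuous_onI)
  have "Lp q lebesgue (\<lambda>x. norm x * \<bar>h x\<bar>)"
    by (rule Lp_compact_support[where R = R]) (use h pq in \<open>auto intro!: continuous_intros\<close>)
  then have "integrable lebesgue (\<lambda>x. (norm x * \<bar>h x\<bar>) powr q)" by (simp add: Lp_def abs_mult)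
  then have i: "integrable lborel (\<lambda>x. (norm x * \<bar>h x\<bar>) powr q)" by (subst (asm) integrable_completion) auto
  show ?thesis
  proof (rule that[of C])
    show "C \<ge> 0" using pq n by (simp add: C_def)
    show "(\<integral>\<^sup>+x. ennreal (\<bar>h x\<bar> * \<bar>w x\<bar>) \<partial>lebesgue) \<le> ennreal (C * pint p lebesgue (grad w) powr (1/p))" if "test_fun w" for w :: "real^'n \<Rightarrow> real"
      unfolding C_def nn_integral_completion by (rule hardy_dual[OF pq n that _ _ i]) auto
  qed
qed

text \<open>Hardy's inequality, assumed here as \<open>H\<close>, converts the Cauchy property of
  the gradients into \<open>L^1\<close> convergence with weight \<open>h\<close>. The weight is
  abstract because three occur: the datum, the indicator of a ball and a partial derivative of a
  test function.\<close>

lemma weighted_strong_limit: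
  fixes w :: "nat \<Rightarrow> real^'n \<Rightarrow> real" and h :: "real^'n \<Rightarrow> real"
  assumes p: "p > 1" and h: "h \<in> borel_measurable lebesgue" and C: "C \<ge> 0"
    and H: "\<And>g :: real^'n \<Rightarrow> real. test_fun g \<Longrightarrow> (\<integral>\<^sup>+x. ennreal (\<bar>h x\<bar> * \<bar>g x\<bar>) \<partial>lebesgue) \<le> ennreal (C * pint p lebesgue (grad g) powr (1/p))"
    and w: "\<And>k. test_fun (w k)" and u: "u \<in> borel_measurable lebesgue" and lim: "AE x in lebesgue. (\<lambda>k. w k x) \<longlonglongrightarrow> u x"
    and M: "\<And>k. pint p lebesgue (grad (w k)) \<le> M"
    and cau: "\<And>e. e > 0 \<Longrightarrow> \<exists>N. \<forall>m\<ge>N. \<forall>l\<ge>N. pint p lebesgue (\<lambda>x. grad (w m) x - grad (w l) x) \<le> e"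
  shows "(\<integral>\<^sup>+x. ennreal (\<bar>h x\<bar> * \<bar>u x\<bar>) \<partial>lebesgue) \<le> ennreal (C * M powr (1/p))"
    "integrable lebesgue (\<lambda>x. h x * u x)"
    "(\<lambda>k. \<integral>x. \<bar>h x\<bar> * \<bar>w k x - u x\<bar> \<partial>lebesgue) \<longlonglongrightarrow> 0"
    "\<And>k. integrable lebesgue (\<lambda>x. \<bar>h x\<bar> * \<bar>w k x - u x\<bar>)"
    "(\<lambda>k. \<integral>x. h x * w k x \<partial>lebesgue) \<longlonglongrightarrow> (\<integral>x. h x * u x \<partial>lebesgue)"
    "\<And>k. integrable lebesgue (\<lambda>x. h x * w k x)"
proof -
  have wm[measurable]: "w k \<in> borel_measurable lebesgue" for k
    using test_fun_C1(2)[OF w] by (intro measurable_completion) (simp add: borel_measurable_continuous_onI)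
  note [measurable] = h u
  \<comment> \<open>Taken with \<open>g\<close> zero for the bound on the limit, and with
    \<open>g = w k\<close> for the distance to it.\<close>
  have fatou: "(\<integral>\<^sup>+x. ennreal (\<bar>h x\<bar> * \<bar>g x - u x\<bar>) \<partial>lebesgue) \<le> c"
    if g[measurable]: "g \<in> borel_measurable lebesgue" and ev: "\<forall>\<^sub>F l in sequentially. (\<integral>\<^sup>+x. ennreal (\<bar>h x\<bar> * \<bar>g x - w l x\<bar>) \<partial>lebesgue) \<le> c" for g c
  proof -
    have "(\<integral>\<^sup>+x. ennreal (\<bar>h x\<bar> * \<bar>g x - u x\<bar>) \<partial>lebesgue) = (\<integral>\<^sup>+x. liminf (\<lambda>l. ennreal (\<bar>h x\<bar> * \<bar>g x - w l x\<bar>)) \<partial>lebesgue)"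
    proof (intro nn_integral_cong_AE, use lim in eventually_elim)
      case (elim x)
      have "(\<lambda>l. ennreal (\<bar>h x\<bar> * \<bar>g x - w l x\<bar>)) \<longlonglongrightarrow> ennreal (\<bar>h x\<bar> * \<bar>g x - u x\<bar>)"
        by (intro tendsto_ennrealI tendsto_intros elim)
      from lim_imp_Liminf[OF _ this] show ?case by simp
    qed
    also have "\<dots> \<le> liminf (\<lambda>l. \<integral>\<^sup>+x. ennreal (\<bar>h x\<bar> * \<bar>g x - w l x\<bar>) \<partial>lebesgue)"
      by (rule nn_integral_liminf) measurable
    also have "\<dots> \<le> limsup (\<lambda>l. \<integral>\<^sup>+x. ennreal (\<bar>h x\<bar> * \<bar>g x - w l x\<bar>) \<partial>lebesgue)" by (rule Liminf_le_Limsup) auto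
    also have "\<dots> \<le> c" by (rule Limsup_bounded[OF ev])
    finally show ?thesis .
  qed
  show hu: "(\<integral>\<^sup>+x. ennreal (\<bar>h x\<bar> * \<bar>u x\<bar>) \<partial>lebesgue) \<le> ennreal (C * M powr (1/p))"
  proof -
    have "(\<integral>\<^sup>+x. ennreal (\<bar>h x\<bar> * \<bar>0 - u x\<bar>) \<partial>lebesgue) \<le> ennreal (C * M powr (1/p))"
    proof (rule fatou)
      have "(\<integral>\<^sup>+x. ennreal (\<bar>h x\<bar> * \<bar>0 - w l x\<bar>) \<partial>lebesgue) \<le> ennreal (C * M powr (1/p))" for l
      proof -
        have "(\<integral>\<^sup>+x. ennreal (\<bar>h x\<bar> * \<bar>w l x\<bar>) \<partial>lebesgue) \<le> ennreal (C * pint p lebesgue (grad (w l)) powr (1/p))" by (rule H[OF w])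
        also have "\<dots> \<le> ennreal (C * M powr (1/p))" using C M[of l] p by (intro ennreal_leI mult_left_mono powr_mono2) auto
        finally show ?thesis by simp
      qed
      then show "\<forall>\<^sub>F l in sequentially. (\<integral>\<^sup>+x. ennreal (\<bar>h x\<bar> * \<bar>0 - w l x\<bar>) \<partial>lebesgue) \<le> ennreal (C * M powr (1/p))"
        by (intro always_eventually allI)
    qed simp
    then show ?thesis by simp
  qed
  show ihu: "integrable lebesgue (\<lambda>x. h x * u x)"
    by (rule integrableI_bounded) (use hu in \<open>auto simp: abs_mult intro: le_less_trans\<close>)
  show ihw: "integrable lebesgue (\<lambda>x. h x * w k x)" for k
    by (rule integrableI_bounded) (use H[OF w[of k]] in \<open>auto simp: abs_mult intro: le_less_trans\<close>)
  show id: "integrable lebesgue (\<lambda>x. \<bar>h x\<bar> * \<bar>w k x - u x\<bar>)" for k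
    using integrable_abs[OF Bochner_Integration.integrable_diff[OF ihw[of k] ihu]] by (simp add: right_diff_distrib[symmetric] abs_mult)
  show lim0: "(\<lambda>k. \<integral>x. \<bar>h x\<bar> * \<bar>w k x - u x\<bar> \<partial>lebesgue) \<longlonglongrightarrow> 0"
  proof (rule LIMSEQ_I)
    fix r :: real assume r: "r > 0"
    define e where "e = (r / (2 * (C + 1))) powr p"
    have e: "e > 0" "C * e powr (1/p) < r"
    proof -
      show "e > 0" using r C by (simp add: e_def)
      have "e powr (1/p) = r / (2 * (C + 1))" using r C p by (simp add: e_def powr_powr)
      moreover have "C * (r / (2 * (C + 1))) < r"
      proof -
        have "C * (r / (2 * (C + 1))) \<le> (C + 1) * (r / (2 * (C + 1)))" using r C by (intro mult_right_mono) auto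
        also have "\<dots> = r / 2"
        proof -
          have *: "y * (r / (2 * y)) = r / 2" if "y > 0" for y :: real using that by simp
          show ?thesis by (rule *) (use C in simp)
        qed
        finally have "C * (r / (2 * (C + 1))) \<le> r / 2" .
        moreover have "r / 2 < r" using r by simp
        ultimately show ?thesis by (rule le_less_trans)
      qed
      ultimately show "C * e powr (1/p) < r" by simp
    qed
    from cau[OF e(1)] obtain N where N: "\<forall>m\<ge>N. \<forall>l\<ge>N. pint p lebesgue (\<lambda>x. grad (w m) x - grad (w l) x) \<le> e" ..
    have "norm ((\<integral>x. \<bar>h x\<bar> * \<bar>w k x - u x\<bar> \<partial>lebesgue) - 0) < r" if k: "k \<ge> N" for k
    proof -
      have "(\<integral>\<^sup>+x. ennreal (\<bar>h x\<bar> * \<bar>w k x - u x\<bar>) \<partial>lebesgue) \<le> ennreal (C * e powr (1/p))"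
      proof (rule fatou)
        show "\<forall>\<^sub>F l in sequentially. (\<integral>\<^sup>+x. ennreal (\<bar>h x\<bar> * \<bar>w k x - w l x\<bar>) \<partial>lebesgue) \<le> ennreal (C * e powr (1/p))"
          using eventually_ge_at_top[of N]
        proof eventually_elim
          case (elim l)
          have t: "test_fun (\<lambda>x. w k x - w l x)" using test_fun_lincomb[OF w w, of 1 k "-1" l] by simp
          have g: "grad (\<lambda>x. w k x - w l x) = (\<lambda>x. grad (w k) x - grad (w l) x)"
            using grad_lincomb[OF w w, of 1 k "-1" l] by (simp add: fun_eq_iff)
          have "pint p lebesgue (\<lambda>x. grad (w k) x - grad (w l) x) \<le> e" using N k elim by simp
          then have "C * pint p lebesgue (\<lambda>x. grad (w k) x - grad (w l) x) powr (1/p) \<le> C * e powr (1/p)"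
            using C p by (intro mult_left_mono powr_mono2) auto
          with H[OF t] show ?case unfolding g by (meson ennreal_leI order.trans)
        qed
      qed measurable
      then have "(\<integral>x. \<bar>h x\<bar> * \<bar>w k x - u x\<bar> \<partial>lebesgue) \<le> C * e powr (1/p)"
        using C by (subst (asm) nn_integral_eq_integral[OF id]) auto
      moreover have "(\<integral>x. \<bar>h x\<bar> * \<bar>w k x - u x\<bar> \<partial>lebesgue) \<ge> 0" by (rule integral_nonneg_AE) auto
      ultimately show ?thesis using e(2) by simp
    qed
    then show "\<exists>N. \<forall>k\<ge>N. norm ((\<integral>x. \<bar>h x\<bar> * \<bar>w k x - u x\<bar> \<partial>lebesgue) - 0) < r" by (intro exI[of _ N] allI impI)
  qed
  have bound: "norm ((\<integral>x. h x * w k x \<partial>lebesgue) - (\<integral>x. h x * u x \<partial>lebesgue)) \<le> (\<integral>x. \<bar>h x\<bar> * \<bar>w k x - u x\<bar> \<partial>lebesgue)" for k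
  proof -
    have "(\<integral>x. h x * w k x \<partial>lebesgue) - (\<integral>x. h x * u x \<partial>lebesgue) = (\<integral>x. h x * (w k x - u x) \<partial>lebesgue)"
      using ihw[of k] ihu by (simp add: right_diff_distrib)
    also have "norm \<dots> \<le> (\<integral>x. \<bar>h x * (w k x - u x)\<bar> \<partial>lebesgue)" unfolding real_norm_def by (rule integral_abs_bound)
    finally show ?thesis by (simp add: abs_mult)
  qed
  show "(\<lambda>k. \<integral>x. h x * w k x \<partial>lebesgue) \<longlonglongrightarrow> (\<integral>x. h x * u x \<partial>lebesgue)"
    by (rule LIM_zero_cancel, rule Lim_null_comparison[OF _ lim0], rule always_eventually, rule allI, rule bound)
qed

text \<open>Finite midpoint combinations of the tail from index \<open>k\<close> on. The inductive
  form transfers to them whatever averaging preserves: being a test function, the energy bound,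
  closeness to a pointwise limit and affine inequalities.\<close>

inductive midhull :: "(nat \<Rightarrow> 'a \<Rightarrow> real) \<Rightarrow> nat \<Rightarrow> ('a \<Rightarrow> real) \<Rightarrow> bool" for v k where
  base: "k \<le> m \<Longrightarrow> midhull v k (v m)"
| mid: "midhull v k a \<Longrightarrow> midhull v k b \<Longrightarrow> midhull v k (\<lambda>x. (1/2) * a x + (1/2) * b x)"

lemma midhull_antimono:
  assumes "midhull v l a" "k \<le> l" shows "midhull v k a"
  using assms
proof induction
  case (mid a b)
  then show ?case by (intro midhull.mid)
qed (auto intro: midhull.base)

lemma midhull_test_fun:
  assumes "midhull v k a" "\<And>m. test_fun (v m)" shows "test_fun a"
  using assms(1)
proof induction
  case (mid a b)
  from mid.IH show ?case by (rule test_fun_lincomb)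
qed (rule assms(2))

lemma midhull_grad:
  assumes "test_fun a" "test_fun b"
  shows "grad (\<lambda>x. (1/2) * a x + (1/2) * b x) = (\<lambda>x. (1/2) *\<^sub>R (grad a x + grad b x))"
  using grad_lincomb[OF assms, of "1/2" "1/2"] by (simp add: fun_eq_iff scaleR_add_right)

lemma midhull_pint:
  assumes "midhull v k a" and v: "\<And>m. test_fun (v m)" "\<And>m. pint p lebesgue (grad (v m)) \<le> M" and p: "p > 1"
  shows "pint p lebesgue (grad a) \<le> M"
  using assms(1)
proof induction
  case (mid a b)
  have t: "test_fun a" "test_fun b" using mid.hyps v(1) midhull_test_fun by blast+
  have L: "Lp p lebesgue (grad w)" if tw: "test_fun w" for w :: "real^'a \<Rightarrow> real"
  proof -
    obtain R B where R: "\<And>x. norm x \<ge> R \<Longrightarrow> grad w x = 0"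
      by (rule test_fun_bounds[OF tw]) (rule that)
    show ?thesis by (rule Lp_compact_support[where R = R, OF test_fun_C1(3)[OF tw] R]) (use p in auto)
  qed
  have Lm: "Lp p lebesgue (\<lambda>x. (1/2) *\<^sub>R (grad a x + grad b x))"
    by (intro Lp_scale(1) Lp_add(1) L t) (use p in simp)
  have "pint p lebesgue (\<lambda>x. (1/2) *\<^sub>R (grad a x + grad b x)) \<le> (\<integral>x. (norm (grad a x) powr p + norm (grad b x) powr p) / 2 \<partial>lebesgue)"
    unfolding pint_def
  proof (rule integral_mono)
    show "norm ((1/2) *\<^sub>R (grad a x + grad b x)) powr p \<le> (norm (grad a x) powr p + norm (grad b x) powr p) / 2" for x
      using midgap_nonneg[OF p, of "grad a x" "grad b x"] by (simp add: midgap_def)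
  qed (use LpD(2)[OF Lm] LpD(2)[OF L[OF t(1)]] LpD(2)[OF L[OF t(2)]] in auto)
  also have "\<dots> = (pint p lebesgue (grad a) + pint p lebesgue (grad b)) / 2"
    using LpD(2)[OF L[OF t(1)]] LpD(2)[OF L[OF t(2)]] by (simp add: pint_def)
  also have "\<dots> \<le> M" using mid.IH by simp
  finally show ?case unfolding midhull_grad[OF t] .
qed (rule v(2))

lemma midhull_tendsto:
  assumes v: "(\<lambda>m. v m x) \<longlonglongrightarrow> l" and w: "\<And>k. midhull v k (w k)"
  shows "(\<lambda>k. w k x) \<longlonglongrightarrow> l"
proof (rule LIMSEQ_I)
  fix r :: real assume r: "r > 0"
  from LIMSEQ_D[OF v half_gt_zero[OF r]] obtain N where N: "\<And>m. m \<ge> N \<Longrightarrow> norm (v m x - l) < r / 2" by blast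
  have "\<bar>a x - l\<bar> \<le> r / 2" if "midhull v N a" for a
    using that
  proof induction
    case (base m)
    then show ?case using N[of m] by simp
  next
    case (mid a b)
    then show ?case unfolding abs_le_iff by (simp add: field_simps)
  qed
  then have *: "\<bar>w k x - l\<bar> \<le> r / 2" if "k \<ge> N" for k
    using midhull_antimono[OF w that] by blast
  have "norm (w k x - l) < r" if "k \<ge> N" for k
    using *[OF that] r by simp
  then show "\<exists>N. \<forall>k\<ge>N. norm (w k x - l) < r" by blast
qed

section \<open>Passage to the limit in the equation\<close>

text \<open>Two sequences with complementary virtues: \<open>v\<close> carries the approximate
  equation, with gradients merely bounded, and \<open>w\<close> has strongly convergent gradients.
  The link between them is that \<open>w k\<close> is a midpoint combination of the tail of
  \<open>v\<close>.\<close>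

locale leray_lions_limit = leray_lions p q A f C1 C2
  for p q :: real and A :: "real^'n::finite \<Rightarrow> real \<Rightarrow> real^'n \<Rightarrow> real^'n" and f :: "real^'n \<Rightarrow> real" and C1 C2 :: real +
  fixes v w :: "nat \<Rightarrow> real^'n \<Rightarrow> real" and u :: "real^'n \<Rightarrow> real" and G :: "real^'n \<Rightarrow> real^'n"
  assumes v1: "\<And>m. test_fun (v m)" and v2: "\<And>m. pint p lebesgue (grad (v m)) \<le> M"
    and v3: "\<And>m. (\<integral>x. A x (v m x) (grad (v m) x) \<bullet> grad (v m) x \<partial>lebesgue) \<le> (\<integral>x. f x * v m x \<partial>lebesgue)"
    and v4: "\<And>\<psi>. test_fun \<psi> \<Longrightarrow> (\<lambda>m. \<integral>x. A x (v m x) (grad (v m) x) \<bullet> grad \<psi> x \<partial>lebesgue) \<longlonglongrightarrow> (\<integral>x. f x * \<psi> x \<partial>lebesgue)"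
    and um: "u \<in> borel_measurable lebesgue" and vu: "AE x in lebesgue. (\<lambda>m. v m x) \<longlonglongrightarrow> u x"
    and w1: "\<And>k. midhull v k (w k)"
    and w2: "\<And>e. e > 0 \<Longrightarrow> \<exists>N. \<forall>m\<ge>N. \<forall>l\<ge>N. pint p lebesgue (\<lambda>x. grad (w m) x - grad (w l) x) \<le> e"
    and G1: "Lp p lebesgue G" and G2: "(\<lambda>k. pint p lebesgue (\<lambda>x. grad (w k) x - G x)) \<longlonglongrightarrow> 0"
begin

lemma p0: "p \<ge> 0" "p > 0" using p by auto

lemma wt: "test_fun (w k)"
  by (rule midhull_test_fun[OF w1 v1])

lemma wM: "pint p lebesgue (grad (w k)) \<le> M"
  by (rule midhull_pint[OF w1 v1 v2 p])

lemma wu: "AE x in lebesgue. (\<lambda>k. w k x) \<longlonglongrightarrow> u x"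
  using vu by eventually_elim (rule midhull_tendsto[OF _ w1])

lemma f_hardy_nn:
  assumes "test_fun g"
  shows "(\<integral>\<^sup>+x. ennreal (\<bar>f x\<bar> * \<bar>g x\<bar>) \<partial>lebesgue) \<le> ennreal (K * pint p lebesgue (grad g) powr (1/p))"
  using hardy_dual[OF pqs n assms fm f0 fi] f0 unfolding nn_integral_completion K_def by simp

lemmas f_limit = weighted_strong_limit[OF p fml K0 f_hardy_nn wt um wu wM w2]

lemma A_continuous:
  "AE x in lebesgue. \<forall>s \<xi> s' \<xi>'. s \<longlonglongrightarrow> s' \<longrightarrow> \<xi> \<longlonglongrightarrow> \<xi>' \<longrightarrow> (\<lambda>k. A x (s k) (\<xi> k)) \<longlonglongrightarrow> A x s' \<xi>'"
proof -
  have "AE x in lebesgue. continuous_on UNIV (\<lambda>(s, \<xi>). A x s \<xi>)" using car by (simp add: caratheodory_def)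
  then show ?thesis
  proof eventually_elim
    case (elim x)
    show ?case
    proof (intro allI impI)
      fix s :: "nat \<Rightarrow> real" and s' and \<xi> :: "nat \<Rightarrow> real^'n" and \<xi>' assume "s \<longlonglongrightarrow> s'" "\<xi> \<longlonglongrightarrow> \<xi>'"
      then have "(\<lambda>k. (s k, \<xi> k)) \<longlonglongrightarrow> (s', \<xi>')" by (intro tendsto_intros)
      from continuous_on_tendsto_compose[OF elim this] show "(\<lambda>k. A x (s k) (\<xi> k)) \<longlonglongrightarrow> A x s' \<xi>'" by simp
    qed
  qed
qed

definition B :: "nat \<Rightarrow> real^'n \<Rightarrow> real^'n" where "B m x = A x (v m x) (grad (v m) x)"

definition Q :: real where "Q = (C2 powr q * M) powr (1/q)"

lemma LB: "Lp q lebesgue (B m)"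
  unfolding B_def[abs_def] by (rule A_Lp(1)[OF test_meas[OF v1] Lp_grad[OF v1 p0(1)]])

lemma BQ: "pint q lebesgue (B m) powr (1/q) \<le> Q"
proof -
  have "pint q lebesgue (B m) \<le> C2 powr q * pint p lebesgue (grad (v m))"
    unfolding B_def[abs_def] by (rule A_Lp(2)[OF test_meas[OF v1] Lp_grad[OF v1 p0(1)]])
  also have "\<dots> \<le> C2 powr q * M" by (intro mult_left_mono v2) simp
  finally show ?thesis unfolding Q_def using q by (intro powr_mono2) auto
qed

lemma Lw: "Lp p lebesgue (grad (w k))" by (rule Lp_grad[OF wt p0(1)])

text \<open>The fluxes \<open>B m\<close> have no known limit, but their pairing with each fixed
  \<open>grad (w k)\<close> converges. As they are bounded in \<open>L^q\<close>, it suffices to fix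
  \<open>k\<close> with \<open>grad (w k)\<close> close to \<open>G\<close> and let \<open>m\<close>
  grow.\<close>

lemma flux_times_G: "(\<lambda>m. \<integral>x. B m x \<bullet> G x \<partial>lebesgue) \<longlonglongrightarrow> (\<integral>x. f x * u x \<partial>lebesgue)"
proof (rule LIMSEQ_I)
  fix r :: real assume r: "r > 0"
  then have r3: "0 < r / 3" by simp
  define d where "d k = pint p lebesgue (\<lambda>x. grad (w k) x - G x)" for k
  have "(\<lambda>k. Q * d k powr (1/p)) \<longlonglongrightarrow> Q * 0 powr (1/p)"
    unfolding d_def by (intro tendsto_mult tendsto_powr2 G2 tendsto_const) (use p in auto)
  then have "(\<lambda>k. Q * d k powr (1/p)) \<longlonglongrightarrow> 0" using p by simp
  then have "\<forall>\<^sub>F k in sequentially. Q * d k powr (1/p) < r / 3" by (rule order_tendstoD(2)) (rule r3)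
  moreover have "\<forall>\<^sub>F k in sequentially. dist (\<integral>x. f x * w k x \<partial>lebesgue) (\<integral>x. f x * u x \<partial>lebesgue) < r / 3"
    by (rule tendstoD[OF f_limit(5) r3])
  ultimately have "\<forall>\<^sub>F k in sequentially. Q * d k powr (1/p) < r / 3 \<and> dist (\<integral>x. f x * w k x \<partial>lebesgue) (\<integral>x. f x * u x \<partial>lebesgue) < r / 3"
    by (rule eventually_conj)
  then obtain k where k: "Q * d k powr (1/p) < r / 3" "\<bar>(\<integral>x. f x * w k x \<partial>lebesgue) - (\<integral>x. f x * u x \<partial>lebesgue)\<bar> < r / 3"
    unfolding eventually_sequentially dist_real_def by blast
  from LIMSEQ_D[OF v4[OF wt[of k]] r3] obtain N where
    N: "\<And>m. m \<ge> N \<Longrightarrow> norm ((\<integral>x. B m x \<bullet> grad (w k) x \<partial>lebesgue) - (\<integral>x. f x * w k x \<partial>lebesgue)) < r / 3" unfolding B_def by blast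
  have "norm ((\<integral>x. B m x \<bullet> G x \<partial>lebesgue) - (\<integral>x. f x * u x \<partial>lebesgue)) < r" if m: "m \<ge> N" for m
  proof -
    have L: "Lp p lebesgue (\<lambda>x. grad (w k) x - G x)" by (rule Lp_diff(1)[OF Lw G1 p0(1)])
    have eq: "(\<integral>x. B m x \<bullet> (grad (w k) x - G x) \<partial>lebesgue) = (\<integral>x. B m x \<bullet> grad (w k) x \<partial>lebesgue) - (\<integral>x. B m x \<bullet> G x \<partial>lebesgue)"
      using holder_inner(1)[OF qps LB Lw] holder_inner(1)[OF qps LB G1] by (simp add: inner_diff_right)
    have "\<bar>\<integral>x. B m x \<bullet> (grad (w k) x - G x) \<partial>lebesgue\<bar> \<le> pint q lebesgue (B m) powr (1/q) * d k powr (1/p)"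
      unfolding d_def by (rule holder_inner(3)[OF qps LB L])
    also have "\<dots> \<le> Q * d k powr (1/p)" by (rule mult_right_mono[OF BQ]) simp
    finally have 1: "\<bar>\<integral>x. B m x \<bullet> (grad (w k) x - G x) \<partial>lebesgue\<bar> < r / 3" using k(1) by (rule le_less_trans)
    show ?thesis using 1 k(2) N[OF m] unfolding eq real_norm_def by linarith
  qed
  then show "\<exists>N. \<forall>m\<ge>N. norm ((\<integral>x. B m x \<bullet> G x \<partial>lebesgue) - (\<integral>x. f x * u x \<partial>lebesgue)) < r" by blast
qed

text \<open>
  Monotonicity at \<open>\<Psi> = G - t\<nabla>\<phi>\<close>: the inequality is affine in the Galerkin solution up to an error
  tending to zero, so it passes to midpoint combinations and then to their strong limit.
\<close>

lemma minty_inequality: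
  assumes \<phi>: "test_fun \<phi>" and t: "t > 0"
  shows "(\<integral>x. A x (u x) (G x - t *\<^sub>R grad \<phi> x) \<bullet> grad \<phi> x \<partial>lebesgue) \<le> (\<integral>x. f x * \<phi> x \<partial>lebesgue)"
proof -
  define \<Psi> where "\<Psi> x = G x - t *\<^sub>R grad \<phi> x" for x
  have L\<phi>: "Lp p lebesgue (grad \<phi>)" by (rule Lp_grad[OF \<phi> p0(1)])
  have L\<Psi>: "Lp p lebesgue \<Psi>" unfolding \<Psi>_def[abs_def] by (rule Lp_diff(1)[OF G1 Lp_scale(1)[OF L\<phi>] p0(1)])
  define S where "S x = A x (u x) (\<Psi> x)" for x
  \<comment> \<open>The flux at \<open>v m\<close> with the gradient frozen at
    \<open>\<Psi>\<close>. Its powers are dominated by a multiple of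
    \<open>norm (\<Psi> x) powr p\<close>, so almost everywhere convergence of \<open>v m\<close>
    gives strong convergence to \<open>S\<close>.\<close>
  define T where "T m x = A x (v m x) (\<Psi> x)" for m x
  have LS: "Lp q lebesgue S" unfolding S_def[abs_def] by (rule A_Lp(1)[OF um L\<Psi>])
  have LT: "Lp q lebesgue (T m)" for m unfolding T_def[abs_def] by (rule A_Lp(1)[OF test_meas[OF v1] L\<Psi>])
  have Lv: "Lp p lebesgue (grad (v m))" for m by (rule Lp_grad[OF v1 p0(1)])
  have q0: "q \<ge> 0" "q > 0" using q by auto
  have TS: "(\<lambda>m. pint q lebesgue (\<lambda>x. T m x - S x)) \<longlonglongrightarrow> 0"
  proof -
    have "(\<lambda>m. \<integral>x. norm (T m x - S x) powr q \<partial>lebesgue) \<longlonglongrightarrow> (\<integral>x. 0 \<partial>(lebesgue :: (real^'n) measure))"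
    proof (rule integral_dominated_convergence[where w = "\<lambda>x. 2 powr q * (2 * (C2 powr q * norm (\<Psi> x) powr p))"])
      show "(\<lambda>x. norm (T m x - S x) powr q) \<in> borel_measurable lebesgue" for m
        using LpD(2)[OF Lp_diff(1)[OF LT LS q0(1)]] by auto
      show "integrable lebesgue (\<lambda>x. 2 powr q * (2 * (C2 powr q * norm (\<Psi> x) powr p)))"
        using LpD(2)[OF L\<Psi>] by simp
      show "AE x in lebesgue. (\<lambda>m. norm (T m x - S x) powr q) \<longlonglongrightarrow> 0"
        using vu A_continuous
      proof eventually_elim
        case (elim x)
        then have "(\<lambda>m. T m x) \<longlonglongrightarrow> S x" unfolding T_def S_def using tendsto_const by blast
        then have "(\<lambda>m. norm (T m x - S x) powr q) \<longlonglongrightarrow> norm (S x - S x) powr q"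
          by (intro tendsto_powr2 tendsto_norm tendsto_diff tendsto_const) (use q in auto)
        then show ?case using q by simp
      qed
      show "AE x in lebesgue. norm (norm (T m x - S x) powr q) \<le> 2 powr q * (2 * (C2 powr q * norm (\<Psi> x) powr p))" for m
        using A_power
      proof eventually_elim
        case (elim x)
        have "norm (T m x - S x) powr q \<le> 2 powr q * (norm (T m x) powr q + norm (S x) powr q)"
          using norm_add_powr_le[OF q0(1), of "T m x" "- S x"] by simp
        also have "\<dots> \<le> 2 powr q * (C2 powr q * norm (\<Psi> x) powr p + C2 powr q * norm (\<Psi> x) powr p)"
          using elim unfolding T_def S_def by (intro mult_left_mono add_mono) auto
        finally show ?case by simp
      qed
    qed auto
    then show ?thesis by (simp add: pint_def)
  qed
  define c where "c = (2 powr p * (M + pint p lebesgue \<Psi>)) powr (1/p)"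
  have LvP: "Lp p lebesgue (\<lambda>x. grad (v m) x - \<Psi> x)" for m by (rule Lp_diff(1)[OF Lv L\<Psi> p0(1)])
  have cb: "pint p lebesgue (\<lambda>x. grad (v m) x - \<Psi> x) powr (1/p) \<le> c" for m
  proof -
    have "pint p lebesgue (\<lambda>x. grad (v m) x - \<Psi> x) \<le> 2 powr p * (pint p lebesgue (grad (v m)) + pint p lebesgue \<Psi>)"
      by (rule Lp_diff(2)[OF Lv L\<Psi> p0(1)])
    also have "\<dots> \<le> 2 powr p * (M + pint p lebesgue \<Psi>)" using v2 by (intro mult_left_mono add_mono) auto
    finally show ?thesis unfolding c_def using p by (intro powr_mono2) auto
  qed
  define e where "e m = pint q lebesgue (\<lambda>x. T m x - S x) powr (1/q) * c" for m
  have "e \<longlonglongrightarrow> 0 powr (1/q) * c"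
    unfolding e_def by (intro tendsto_mult tendsto_powr2 TS tendsto_const) (use q in auto)
  then have e0: "e \<longlonglongrightarrow> 0" using q by simp
  \<comment> \<open>With \<open>S\<close> frozen this functional is linear on test functions, which
    is why the inequality survives averaging.\<close>
  define l where "l a = (\<integral>x. f x * a x \<partial>lebesgue) - (\<integral>x. S x \<bullet> grad a x \<partial>lebesgue)" for a
  have Si: "integrable lebesgue (\<lambda>x. S x \<bullet> g x)" if "Lp p lebesgue g" for g by (rule holder_inner(1)[OF qps LS that])
  have Bi: "integrable lebesgue (\<lambda>x. B m x \<bullet> g x)" if "Lp p lebesgue g" for m g by (rule holder_inner(1)[OF qps LB that])
  have Ti: "integrable lebesgue (\<lambda>x. T m x \<bullet> g x)" if "Lp p lebesgue g" for m g by (rule holder_inner(1)[OF qps LT that])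
  \<comment> \<open>Monotonicity compares \<open>grad (v m)\<close> and \<open>\<Psi>\<close> at the
    same first argument \<open>v m\<close>; replacing \<open>T m\<close> by \<open>S\<close> costs
    \<open>e m\<close>. The pairing of the flux with \<open>grad (v m)\<close> itself, which has no
    accessible limit, is removed by the energy inequality.\<close>
  have lv: "(\<integral>x. B m x \<bullet> \<Psi> x \<partial>lebesgue) - (\<integral>x. S x \<bullet> \<Psi> x \<partial>lebesgue) - e m \<le> l (v m)" for m
  proof -
    have "0 \<le> (\<integral>x. (B m x - T m x) \<bullet> (grad (v m) x - \<Psi> x) \<partial>lebesgue)"
    proof (rule integral_nonneg_AE)
      show "AE x in lebesgue. 0 \<le> (B m x - T m x) \<bullet> (grad (v m) x - \<Psi> x)"
        using struct by eventually_elim (simp add: B_def T_def)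
    qed
    also have "\<dots> = (\<integral>x. B m x \<bullet> grad (v m) x - B m x \<bullet> \<Psi> x - T m x \<bullet> (grad (v m) x - \<Psi> x) \<partial>lebesgue)"
      by (simp add: inner_diff_left inner_diff_right algebra_simps)
    also have "\<dots> = (\<integral>x. B m x \<bullet> grad (v m) x \<partial>lebesgue) - (\<integral>x. B m x \<bullet> \<Psi> x \<partial>lebesgue) - (\<integral>x. T m x \<bullet> (grad (v m) x - \<Psi> x) \<partial>lebesgue)"
      using Bi[OF Lv, of m m] Bi[OF L\<Psi>, of m] Ti[OF LvP, of m m] by simp
    finally have 1: "0 \<le> (\<integral>x. B m x \<bullet> grad (v m) x \<partial>lebesgue) - (\<integral>x. B m x \<bullet> \<Psi> x \<partial>lebesgue) - (\<integral>x. T m x \<bullet> (grad (v m) x - \<Psi> x) \<partial>lebesgue)" .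
    have 2: "(\<integral>x. (T m x - S x) \<bullet> (grad (v m) x - \<Psi> x) \<partial>lebesgue) = (\<integral>x. T m x \<bullet> (grad (v m) x - \<Psi> x) \<partial>lebesgue) - (\<integral>x. S x \<bullet> (grad (v m) x - \<Psi> x) \<partial>lebesgue)"
      using Ti[OF LvP, of m m] Si[OF LvP, of m] by (simp add: inner_diff_left)
    have 3: "(\<integral>x. S x \<bullet> (grad (v m) x - \<Psi> x) \<partial>lebesgue) = (\<integral>x. S x \<bullet> grad (v m) x \<partial>lebesgue) - (\<integral>x. S x \<bullet> \<Psi> x \<partial>lebesgue)"
      using Si[OF Lv, of m] Si[OF L\<Psi>] by (simp add: inner_diff_right)
    have "\<bar>\<integral>x. (T m x - S x) \<bullet> (grad (v m) x - \<Psi> x) \<partial>lebesgue\<bar> \<le> pint q lebesgue (\<lambda>x. T m x - S x) powr (1/q) * pint p lebesgue (\<lambda>x. grad (v m) x - \<Psi> x) powr (1/p)"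
      by (rule holder_inner(3)[OF qps Lp_diff(1)[OF LT LS q0(1)] LvP])
    also have "\<dots> \<le> e m" unfolding e_def by (rule mult_left_mono[OF cb]) simp
    finally have 4: "\<bar>\<integral>x. (T m x - S x) \<bullet> (grad (v m) x - \<Psi> x) \<partial>lebesgue\<bar> \<le> e m" .
    have 5: "(\<integral>x. B m x \<bullet> grad (v m) x \<partial>lebesgue) \<le> (\<integral>x. f x * v m x \<partial>lebesgue)" unfolding B_def by (rule v3)
    show ?thesis using 1 4 5 unfolding 2 3 l_def by linarith
  qed
  define c0 where "c0 = (\<integral>x. f x * u x \<partial>lebesgue) - t * (\<integral>x. f x * \<phi> x \<partial>lebesgue) - (\<integral>x. S x \<bullet> \<Psi> x \<partial>lebesgue)"
  have BP: "(\<integral>x. B m x \<bullet> \<Psi> x \<partial>lebesgue) = (\<integral>x. B m x \<bullet> G x \<partial>lebesgue) - t * (\<integral>x. B m x \<bullet> grad \<phi> x \<partial>lebesgue)" for m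
    unfolding \<Psi>_def using Bi[OF G1, of m] Bi[OF L\<phi>, of m] by (simp add: inner_diff_right)
  have "(\<lambda>m. (\<integral>x. B m x \<bullet> \<Psi> x \<partial>lebesgue) - (\<integral>x. S x \<bullet> \<Psi> x \<partial>lebesgue) - e m) \<longlonglongrightarrow> c0 - 0"
    unfolding BP c0_def by (intro tendsto_intros flux_times_G e0) (unfold B_def, rule v4[OF \<phi>])
  then have lim: "(\<lambda>m. (\<integral>x. B m x \<bullet> \<Psi> x \<partial>lebesgue) - (\<integral>x. S x \<bullet> \<Psi> x \<partial>lebesgue) - e m) \<longlonglongrightarrow> c0" by simp
  have lw: "(\<lambda>k. l (w k)) \<longlonglongrightarrow> (\<integral>x. f x * u x \<partial>lebesgue) - (\<integral>x. S x \<bullet> G x \<partial>lebesgue)"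
  proof -
    have c: "(\<integral>x. g x \<bullet> S x \<partial>lebesgue) = (\<integral>x. S x \<bullet> g x \<partial>lebesgue)" for g
      by (rule Bochner_Integration.integral_cong) (rule refl, rule inner_commute)
    have "(\<lambda>k. \<integral>x. S x \<bullet> grad (w k) x \<partial>lebesgue) \<longlonglongrightarrow> (\<integral>x. S x \<bullet> G x \<partial>lebesgue)"
      unfolding c[symmetric] by (rule holder_tendsto[OF pqs G1 Lw LS G2])
    then show ?thesis unfolding l_def by (intro tendsto_diff f_limit(5))
  qed
  \<comment> \<open>The lower bound for \<open>l (v m)\<close> depends on \<open>m\<close>; with
    slack \<open>\<delta>\<close> it becomes one constant for a whole tail, hence for all its
    midpoint combinations and their limit.\<close>
  have "c0 \<le> (\<integral>x. f x * u x \<partial>lebesgue) - (\<integral>x. S x \<bullet> G x \<partial>lebesgue)"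
  proof (rule field_le_epsilon)
    fix \<delta> :: real assume \<delta>: "\<delta> > 0"
    have "\<forall>\<^sub>F m in sequentially. (\<integral>x. B m x \<bullet> \<Psi> x \<partial>lebesgue) - (\<integral>x. S x \<bullet> \<Psi> x \<partial>lebesgue) - e m > c0 - \<delta>"
      by (rule order_tendstoD(1)[OF lim]) (use \<delta> in simp)
    then obtain k0 where k0: "\<And>m. m \<ge> k0 \<Longrightarrow> (\<integral>x. B m x \<bullet> \<Psi> x \<partial>lebesgue) - (\<integral>x. S x \<bullet> \<Psi> x \<partial>lebesgue) - e m > c0 - \<delta>"
      unfolding eventually_sequentially by blast
    have hull: "c0 - \<delta> \<le> l a" if "midhull v k0 a" for a
      using that
    proof induction
      case (base m)
      then show ?case using k0[of m] lv[of m] by linarith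
    next
      case (mid a b)
      have ta: "test_fun a" and tb: "test_fun b" by (rule midhull_test_fun[OF mid.hyps(1) v1], rule midhull_test_fun[OF mid.hyps(2) v1])
      have La: "Lp p lebesgue (grad a)" and Lb: "Lp p lebesgue (grad b)" using Lp_grad[OF ta p0(1)] Lp_grad[OF tb p0(1)] by auto
      have fl: "(\<integral>x. f x * ((1/2) * a x + (1/2) * b x) \<partial>lebesgue) = (1/2) * (\<integral>x. f x * a x \<partial>lebesgue) + (1/2) * (\<integral>x. f x * b x \<partial>lebesgue)"
      proof -
        have "(\<integral>x. f x * ((1/2) * a x + (1/2) * b x) \<partial>lebesgue) = (\<integral>x. (1/2) * (f x * a x) + (1/2) * (f x * b x) \<partial>lebesgue)"
          by (rule Bochner_Integration.integral_cong) (auto simp: algebra_simps)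
        then show ?thesis using f_hardy(1)[OF ta] f_hardy(1)[OF tb] by simp
      qed
      have Sl: "(\<integral>x. S x \<bullet> grad (\<lambda>x. (1/2) * a x + (1/2) * b x) x \<partial>lebesgue) = (1/2) * (\<integral>x. S x \<bullet> grad a x \<partial>lebesgue) + (1/2) * (\<integral>x. S x \<bullet> grad b x \<partial>lebesgue)"
        unfolding midhull_grad[OF ta tb] using Si[OF La] Si[OF Lb] by (simp add: inner_add_right)
      have "l (\<lambda>x. (1/2) * a x + (1/2) * b x) = (1/2) * l a + (1/2) * l b"
        unfolding l_def fl Sl by (simp add: algebra_simps)
      then show ?case using mid.IH by argo
    qed
    have "c0 - \<delta> \<le> (\<integral>x. f x * u x \<partial>lebesgue) - (\<integral>x. S x \<bullet> G x \<partial>lebesgue)"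
    proof (rule tendsto_lowerbound[OF lw])
      show "\<forall>\<^sub>F k in sequentially. c0 - \<delta> \<le> l (w k)"
        using eventually_ge_at_top[of k0] by eventually_elim (rule hull[OF midhull_antimono[OF w1]])
    qed simp
    then show "c0 \<le> (\<integral>x. f x * u x \<partial>lebesgue) - (\<integral>x. S x \<bullet> G x \<partial>lebesgue) + \<delta>" by linarith
  qed
  \<comment> \<open>The terms with \<open>u\<close> and \<open>G\<close> cancel, and what remains is
    \<open>t\<close> times the claim.\<close>
  moreover have "(\<integral>x. S x \<bullet> \<Psi> x \<partial>lebesgue) = (\<integral>x. S x \<bullet> G x \<partial>lebesgue) - t * (\<integral>x. S x \<bullet> grad \<phi> x \<partial>lebesgue)"
    unfolding \<Psi>_def using Si[OF G1] Si[OF L\<phi>] by (simp add: inner_diff_right)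
  ultimately have "t * (\<integral>x. S x \<bullet> grad \<phi> x \<partial>lebesgue) \<le> t * (\<integral>x. f x * \<phi> x \<partial>lebesgue)" unfolding c0_def by linarith
  then have "(\<integral>x. S x \<bullet> grad \<phi> x \<partial>lebesgue) \<le> (\<integral>x. f x * \<phi> x \<partial>lebesgue)" using t by (simp add: mult_le_cancel_left)
  then show ?thesis by (simp add: S_def \<Psi>_def)
qed

lemma LS: "Lp q lebesgue (\<lambda>x. A x (u x) (G x))" by (rule A_Lp(1)[OF um G1])

text \<open>Hemicontinuity: the argument of the flux in \<open>minty_inequality\<close> tends to
  \<open>G\<close> as \<open>t\<close> tends to 0, and for \<open>t \<le> 1\<close> the growth
  condition supplies an integrable majorant.\<close>

lemma weak_equation_le:
  assumes \<phi>: "test_fun \<phi>"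
  shows "(\<integral>x. A x (u x) (G x) \<bullet> grad \<phi> x \<partial>lebesgue) \<le> (\<integral>x. f x * \<phi> x \<partial>lebesgue)"
proof -
  define t where "t k = inverse (real (Suc k))" for k
  have t: "t k > 0" "t k \<le> 1" for k by (auto simp: t_def inverse_le_1_iff)
  have t0: "t \<longlonglongrightarrow> 0" unfolding t_def by (rule LIMSEQ_inverse_real_of_nat)
  have L\<phi>: "Lp p lebesgue (grad \<phi>)" by (rule Lp_grad[OF \<phi> p0(1)])
  have LG: "Lp p lebesgue (\<lambda>x. G x - t k *\<^sub>R grad \<phi> x)" for k by (rule Lp_diff(1)[OF G1 Lp_scale(1)[OF L\<phi>] p0(1)])
  define H where "H x = norm (G x) + norm (grad \<phi> x)" for x
  have H0: "H x \<ge> 0" for x by (simp add: H_def)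
  have LH: "Lp p lebesgue H"
  proof -
    have "Lp p lebesgue (\<lambda>x. norm (G x))" "Lp p lebesgue (\<lambda>x. norm (grad \<phi> x))" using G1 L\<phi> by (auto simp: Lp_def)
    then show ?thesis unfolding H_def[abs_def] by (rule Lp_add(1)) (rule p0(1))
  qed
  have dom: "integrable lebesgue (\<lambda>x. C2 * (H x powr (p - 1) * norm (grad \<phi> x)))"
  proof (rule integrable_mult_right, rule holder_real(1)[OF qps])
    show "integrable lebesgue (\<lambda>x. (H x powr (p - 1)) powr q)"
      using LpD(2)[OF LH] H0 p1q by (simp add: powr_powr)
    show "integrable lebesgue (\<lambda>x. norm (grad \<phi> x) powr p)" by (rule LpD(2)[OF L\<phi>])
  qed (use LpD(1)[OF LH] LpD(1)[OF L\<phi>] in auto)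
  have "(\<lambda>k. \<integral>x. A x (u x) (G x - t k *\<^sub>R grad \<phi> x) \<bullet> grad \<phi> x \<partial>lebesgue) \<longlonglongrightarrow> (\<integral>x. A x (u x) (G x) \<bullet> grad \<phi> x \<partial>lebesgue)"
  proof (rule integral_dominated_convergence[OF _ _ dom])
    show "(\<lambda>x. A x (u x) (G x) \<bullet> grad \<phi> x) \<in> borel_measurable lebesgue"
      using LpD(1)[OF LS] LpD(1)[OF L\<phi>] by measurable
    show "(\<lambda>x. A x (u x) (G x - t k *\<^sub>R grad \<phi> x) \<bullet> grad \<phi> x) \<in> borel_measurable lebesgue" for k
      using LpD(1)[OF A_Lp(1)[OF um LG[of k]]] LpD(1)[OF L\<phi>] by measurable
    show "AE x in lebesgue. (\<lambda>k. A x (u x) (G x - t k *\<^sub>R grad \<phi> x) \<bullet> grad \<phi> x) \<longlonglongrightarrow> A x (u x) (G x) \<bullet> grad \<phi> x"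
      using A_continuous
    proof eventually_elim
      case (elim x)
      have "(\<lambda>k. G x - t k *\<^sub>R grad \<phi> x) \<longlonglongrightarrow> G x - 0 *\<^sub>R grad \<phi> x" by (intro tendsto_intros t0)
      then have "(\<lambda>k. G x - t k *\<^sub>R grad \<phi> x) \<longlonglongrightarrow> G x" by simp
      then have "(\<lambda>k. A x (u x) (G x - t k *\<^sub>R grad \<phi> x)) \<longlonglongrightarrow> A x (u x) (G x)"
        using elim[rule_format, of "\<lambda>k. u x" "u x"] by simp
      then show ?case by (intro tendsto_intros)
    qed
    show "AE x in lebesgue. norm (A x (u x) (G x - t k *\<^sub>R grad \<phi> x) \<bullet> grad \<phi> x) \<le> C2 * (H x powr (p - 1) * norm (grad \<phi> x))" for k
      using struct
    proof eventually_elim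
      case (elim x)
      have "norm (t k *\<^sub>R grad \<phi> x) \<le> norm (grad \<phi> x)" using t[of k] by (simp add: mult_left_le_one_le)
      then have gH: "norm (G x - t k *\<^sub>R grad \<phi> x) \<le> H x" unfolding H_def
        using norm_triangle_ineq4[of "G x" "t k *\<^sub>R grad \<phi> x"] by linarith
      have "norm (A x (u x) (G x - t k *\<^sub>R grad \<phi> x)) \<le> C2 * norm (G x - t k *\<^sub>R grad \<phi> x) powr (p - 1)" using elim by blast
      also have "\<dots> \<le> C2 * H x powr (p - 1)" using gH C2 p by (intro mult_left_mono powr_mono2) auto
      finally have "norm (A x (u x) (G x - t k *\<^sub>R grad \<phi> x)) * norm (grad \<phi> x) \<le> C2 * H x powr (p - 1) * norm (grad \<phi> x)"
        by (rule mult_right_mono) simp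
      then show ?case using Cauchy_Schwarz_ineq2[of "A x (u x) (G x - t k *\<^sub>R grad \<phi> x)" "grad \<phi> x"] by (simp add: mult.assoc)
    qed
  qed
  then show ?thesis
    by (rule tendsto_upperbound) (use minty_inequality[OF \<phi> t(1)] in \<open>auto intro!: always_eventually\<close>)
qed

lemma weak_equation:
  assumes \<phi>: "test_fun \<phi>"
  shows "(\<integral>x. A x (u x) (G x) \<bullet> grad \<phi> x \<partial>lebesgue) = (\<integral>x. f x * \<phi> x \<partial>lebesgue)"
proof (rule antisym)
  \<comment> \<open>The negative of \<open>\<phi>\<close> is written as a linear combination so that
    \<open>grad_lincomb\<close> gives its gradient.\<close>
  have t: "test_fun (\<lambda>x. (-1) * \<phi> x + 0 * \<phi> x)" by (rule test_fun_lincomb[OF \<phi> \<phi>])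
  have "(\<integral>x. A x (u x) (G x) \<bullet> grad (\<lambda>x. (-1) * \<phi> x + 0 * \<phi> x) x \<partial>lebesgue) \<le> (\<integral>x. f x * ((-1) * \<phi> x + 0 * \<phi> x) \<partial>lebesgue)"
    by (rule weak_equation_le[OF t])
  then show "(\<integral>x. f x * \<phi> x \<partial>lebesgue) \<le> (\<integral>x. A x (u x) (G x) \<bullet> grad \<phi> x \<partial>lebesgue)"
    unfolding grad_lincomb[OF \<phi> \<phi>] by simp
qed (rule weak_equation_le[OF \<phi>])

end

section \<open>Sign and infimum of the solution\<close>

lemma indicator_cball_measurable: "indicat_real (cball (0::'a::euclidean_space) R) \<in> borel_measurable lebesgue"
  by (rule borel_measurable_indicator) simp

text \<open>\<open>Z\<close> is what the chain rule predicts as the gradient of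
  \<open>eta k (u x)\<close>. The equation is tested with \<open>eta k\<close> composed with
  \<open>w l\<close>, which is a test function, and \<open>l\<close> is sent to infinity; coercivity
  of the flux at \<open>G\<close> then bounds \<open>Z\<close>.\<close>

lemma (in leray_lions_limit) eta_flux:
  assumes k: "k > 0"
  defines "Z \<equiv> (\<lambda>x. refl_logistic (k * u x) *\<^sub>R G x)"
  shows "Lp p lebesgue Z"
    "(\<lambda>l. pint p lebesgue (\<lambda>x. refl_logistic (k * w l x) *\<^sub>R grad (w l) x - Z x)) \<longlonglongrightarrow> 0"
    "C1 * pint p lebesgue Z \<le> (\<integral>x. f x * eta k (u x) \<partial>lebesgue)"
proof -
  have lm[measurable]: "refl_logistic \<in> borel_measurable borel" by (rule borel_measurable_continuous_onI[OF continuous_refl_logistic])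
  note [measurable] = um LpD(1)[OF G1] test_meas[OF wt] LpD(1)[OF Lw]
  have ab: "\<bar>refl_logistic s\<bar> \<le> 1" for s using refl_logistic_bounds[of s] by simp
  have nl: "norm (refl_logistic s *\<^sub>R y) \<le> norm y" for s and y :: "real^'n"
    using ab[of s] by (simp add: mult_left_le_one_le)
  show LZ: "Lp p lebesgue Z"
    unfolding Z_def by (rule Lp_bound(1)[OF G1 _ _ p0(1)]) (use nl in \<open>auto intro!: always_eventually\<close>)
  define Y where "Y l x = refl_logistic (k * w l x) *\<^sub>R grad (w l) x" for l x
  have LY: "Lp p lebesgue (Y l)" for l
    unfolding Y_def[abs_def] by (rule Lp_bound(1)[OF Lw _ _ p0(1)]) (use nl in \<open>auto intro!: always_eventually\<close>)
  \<comment> \<open>The product is split: in \<open>a\<close> the bounded factor multiplies a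
    strongly convergent gradient, in \<open>b\<close> the factor converges almost everywhere while
    \<open>G\<close> stays fixed and dominates.\<close>
  define a where "a l x = refl_logistic (k * w l x) *\<^sub>R (grad (w l) x - G x)" for l x
  define b where "b l x = (refl_logistic (k * w l x) - refl_logistic (k * u x)) *\<^sub>R G x" for l x
  have Ld: "Lp p lebesgue (\<lambda>x. grad (w l) x - G x)" for l by (rule Lp_diff(1)[OF Lw G1 p0(1)])
  have La: "Lp p lebesgue (a l)" "pint p lebesgue (a l) \<le> pint p lebesgue (\<lambda>x. grad (w l) x - G x)" for l
    unfolding a_def[abs_def] by (rule Lp_bound[OF Ld _ _ p0(1)]; use nl in \<open>auto intro!: always_eventually\<close>)+
  have nb: "norm (b l x) \<le> norm (G x)" for l x
  proof -
    have "\<bar>refl_logistic (k * w l x) - refl_logistic (k * u x)\<bar> \<le> 1"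
      using refl_logistic_bounds[of "k * w l x"] refl_logistic_bounds[of "k * u x"] by linarith
    then show ?thesis by (simp add: b_def mult_left_le_one_le)
  qed
  have bm[measurable]: "b l \<in> borel_measurable lebesgue" for l unfolding b_def[abs_def] by measurable
  have Lb: "Lp p lebesgue (b l)" for l
    by (rule Lp_bound(1)[OF G1 bm _ p0(1)]) (use nb in \<open>auto intro!: always_eventually\<close>)
  have b0: "(\<lambda>l. pint p lebesgue (b l)) \<longlonglongrightarrow> 0"
  proof -
    have "(\<lambda>l. \<integral>x. norm (b l x) powr p \<partial>lebesgue) \<longlonglongrightarrow> (\<integral>x. 0 \<partial>(lebesgue :: (real^'n) measure))"
    proof (rule integral_dominated_convergence[where w = "\<lambda>x. norm (G x) powr p"])
      show "integrable lebesgue (\<lambda>x. norm (G x) powr p)" by (rule LpD(2)[OF G1])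
      show "AE x in lebesgue. norm (norm (b l x) powr p) \<le> norm (G x) powr p" for l
        using nb p by (intro always_eventually allI) (auto intro!: powr_mono2)
      show "AE x in lebesgue. (\<lambda>l. norm (b l x) powr p) \<longlonglongrightarrow> 0"
        using wu
      proof eventually_elim
        case (elim x)
        have "isCont refl_logistic (k * u x)" using continuous_refl_logistic[of UNIV] by (simp add: continuous_on_eq_continuous_at)
        then have "(\<lambda>l. refl_logistic (k * w l x)) \<longlonglongrightarrow> refl_logistic (k * u x)"
          by (rule isCont_tendsto_compose) (intro tendsto_intros elim)
        then have "(\<lambda>l. norm (b l x) powr p) \<longlonglongrightarrow> norm ((refl_logistic (k * u x) - refl_logistic (k * u x)) *\<^sub>R G x) powr p"
          unfolding b_def by (intro tendsto_powr2 tendsto_norm tendsto_intros) (use p in auto)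
        then show ?case using p by simp
      qed
    qed auto
    then show ?thesis by (simp add: pint_def)
  qed
  have YZ: "Y l x - Z x = a l x + b l x" for l x
    by (simp add: Y_def Z_def a_def b_def algebra_simps)
  have YZ0: "(\<lambda>l. pint p lebesgue (\<lambda>x. Y l x - Z x)) \<longlonglongrightarrow> 0"
  proof (rule tendsto_sandwich[OF _ _ tendsto_const])
    show "\<forall>\<^sub>F l in sequentially. 0 \<le> pint p lebesgue (\<lambda>x. Y l x - Z x)" by simp
    have "pint p lebesgue (\<lambda>x. Y l x - Z x) \<le> 2 powr p * (pint p lebesgue (\<lambda>x. grad (w l) x - G x) + pint p lebesgue (b l))" for l
    proof -
      have "pint p lebesgue (\<lambda>x. Y l x - Z x) \<le> 2 powr p * (pint p lebesgue (a l) + pint p lebesgue (b l))"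
        unfolding YZ by (rule Lp_add(2)[OF La(1) Lb p0(1)])
      also have "\<dots> \<le> 2 powr p * (pint p lebesgue (\<lambda>x. grad (w l) x - G x) + pint p lebesgue (b l))"
        using La(2) by (intro mult_left_mono add_mono) auto
      finally show ?thesis .
    qed
    then show "\<forall>\<^sub>F l in sequentially. pint p lebesgue (\<lambda>x. Y l x - Z x) \<le> 2 powr p * (pint p lebesgue (\<lambda>x. grad (w l) x - G x) + pint p lebesgue (b l))"
      by (intro always_eventually allI)
    have "(\<lambda>l. 2 powr p * (pint p lebesgue (\<lambda>x. grad (w l) x - G x) + pint p lebesgue (b l))) \<longlonglongrightarrow> 2 powr p * (0 + 0)"
      by (intro tendsto_intros G2 b0)
    then show "(\<lambda>l. 2 powr p * (pint p lebesgue (\<lambda>x. grad (w l) x - G x) + pint p lebesgue (b l))) \<longlonglongrightarrow> 0" by simp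
  qed
  then show "(\<lambda>l. pint p lebesgue (\<lambda>x. refl_logistic (k * w l x) *\<^sub>R grad (w l) x - Z x)) \<longlonglongrightarrow> 0" by (simp add: Y_def)
  define S where "S x = A x (u x) (G x)" for x
  have LS': "Lp q lebesgue S" unfolding S_def[abs_def] by (rule LS)
  have 1: "(\<lambda>l. \<integral>x. Y l x \<bullet> S x \<partial>lebesgue) \<longlonglongrightarrow> (\<integral>x. Z x \<bullet> S x \<partial>lebesgue)"
    by (rule holder_tendsto[OF pqs LZ LY LS' YZ0])
  have eqn: "(\<integral>x. Y l x \<bullet> S x \<partial>lebesgue) = (\<integral>x. f x * eta k (w l x) \<partial>lebesgue)" for l
    using weak_equation[OF test_fun_eta[OF k wt[of l]]] unfolding grad_eta[OF k wt] Y_def S_def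
    by (simp add: inner_commute)
  have em: "(\<lambda>x. eta k (u x)) \<in> borel_measurable lebesgue"
  proof -
    have "eta k \<in> borel_measurable borel"
      by (rule borel_measurable_continuous_onI, rule DERIV_continuous_on) (use eta_deriv[OF k] in auto)
    then show ?thesis by measurable
  qed
  note [measurable] = em fml
  have ie: "integrable lebesgue (\<lambda>x. f x * eta k (u x))"
    by (rule Bochner_Integration.integrable_bound[OF f_limit(2)])
       (use eta_abs_le[OF k] in \<open>auto simp: abs_mult intro!: mult_left_mono always_eventually\<close>)
  have 2: "(\<lambda>l. \<integral>x. f x * eta k (w l x) \<partial>lebesgue) \<longlonglongrightarrow> (\<integral>x. f x * eta k (u x) \<partial>lebesgue)"
  proof (rule LIM_zero_cancel, rule Lim_null_comparison[OF _ f_limit(3)], rule always_eventually, rule allI)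
    fix l
    have ie': "integrable lebesgue (\<lambda>x. f x * eta k (w l x))" by (rule f_hardy(1)[OF test_fun_eta[OF k wt]])
    have "norm ((\<integral>x. f x * eta k (w l x) \<partial>lebesgue) - (\<integral>x. f x * eta k (u x) \<partial>lebesgue)) = \<bar>\<integral>x. f x * eta k (w l x) - f x * eta k (u x) \<partial>lebesgue\<bar>"
      using ie ie' by simp
    also have "\<dots> \<le> (\<integral>x. \<bar>f x * eta k (w l x) - f x * eta k (u x)\<bar> \<partial>lebesgue)" by (rule integral_abs_bound)
    also have "\<dots> \<le> (\<integral>x. \<bar>f x\<bar> * \<bar>w l x - u x\<bar> \<partial>lebesgue)"
    proof (rule integral_mono)
      show "\<bar>f x * eta k (w l x) - f x * eta k (u x)\<bar> \<le> \<bar>f x\<bar> * \<bar>w l x - u x\<bar>" for x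
        unfolding right_diff_distrib[symmetric] abs_mult by (rule mult_left_mono[OF eta_diff_le[OF k]]) simp
    qed (use ie ie' f_limit(4) in auto)
    finally show "norm ((\<integral>x. f x * eta k (w l x) \<partial>lebesgue) - (\<integral>x. f x * eta k (u x) \<partial>lebesgue)) \<le> (\<integral>x. \<bar>f x\<bar> * \<bar>w l x - u x\<bar> \<partial>lebesgue)" .
  qed
  have eq: "(\<integral>x. Z x \<bullet> S x \<partial>lebesgue) = (\<integral>x. f x * eta k (u x) \<partial>lebesgue)"
    using 1 2 unfolding eqn by (rule LIMSEQ_unique)
  have "C1 * pint p lebesgue Z = (\<integral>x. C1 * norm (Z x) powr p \<partial>lebesgue)" by (simp add: pint_def)
  also have "\<dots> \<le> (\<integral>x. Z x \<bullet> S x \<partial>lebesgue)"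
  proof (rule integral_mono_AE)
    show "integrable lebesgue (\<lambda>x. C1 * norm (Z x) powr p)" using LpD(2)[OF LZ] by simp
    show "integrable lebesgue (\<lambda>x. Z x \<bullet> S x)" by (rule holder_inner(1)[OF pqs LZ LS'])
    show "AE x in lebesgue. C1 * norm (Z x) powr p \<le> Z x \<bullet> S x"
      using struct
    proof eventually_elim
      case (elim x)
      define s where "s = refl_logistic (k * u x)"
      have s: "0 < s" "s < 1" using refl_logistic_bounds by (auto simp: s_def)
      \<comment> \<open>The truncation factor occurs once in the tested equation but with power
        \<open>p\<close> in the energy; a factor in \<open>(0, 1)\<close> and \<open>p > 1\<close>
        make this harmless.\<close>
      have sp: "s powr p \<le> s" using powr_mono'[of 1 p s] s p by simp
      have "C1 * norm (Z x) powr p = s powr p * (C1 * norm (G x) powr p)"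
        using s by (simp add: Z_def s_def[symmetric] powr_mult)
      also have "\<dots> \<le> s * (C1 * norm (G x) powr p)" using sp C1 by (intro mult_right_mono) auto
      also have "\<dots> \<le> s * (G x \<bullet> S x)" using elim s unfolding S_def by (intro mult_left_mono) auto
      also have "\<dots> = Z x \<bullet> S x" by (simp add: Z_def s_def)
      finally show ?case .
    qed
  qed
  finally show "C1 * pint p lebesgue Z \<le> (\<integral>x. f x * eta k (u x) \<partial>lebesgue)" unfolding eq .
qed

lemma (in leray_lions_limit) local_bound:
  assumes R: "R \<ge> 0"
  shows "(\<integral>\<^sup>+x. ennreal (indicat_real (cball 0 R) x * \<bar>u x\<bar>) \<partial>lebesgue)
     \<le> ennreal (p / (real CARD('n) - p) * (R * measure lebesgue (cball (0::real^'n) R) powr (1/q)) * M powr (1/p))"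
proof -
  define c where "c = p / (real CARD('n) - p) * (R * measure lebesgue (cball (0::real^'n) R) powr (1/q))"
  have c: "c \<ge> 0" using n p R by (simp add: c_def)
  have "(\<integral>\<^sup>+x. ennreal (\<bar>indicat_real (cball 0 R) x\<bar> * \<bar>u x\<bar>) \<partial>lebesgue) \<le> ennreal (c * M powr (1/p))"
    by (rule weighted_strong_limit(1)[OF p _ c _ wt um wu wM w2])
       (use hardy_ball[OF pqs n _ R] indicator_cball_measurable in \<open>simp_all add: c_def\<close>)
  then show ?thesis by (simp add: c_def)
qed

text \<open>
  Testing with \<open>\<eta>\<^sub>k(w\<^sub>l)\<close>, a smooth approximation of the negative part, gives
  \<open>C1 \<integral>\<bar>\<nabla>\<eta>\<^sub>k(u)\<bar>\<^sup>p \<le> \<integral>f \<eta>\<^sub>k(u)\<close>, whose right side tends to \<open>\<integral>f min(u,0) \<le> 0\<close>.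
\<close>

lemma (in leray_lions_limit) nonneg: "AE x in lebesgue. 0 \<le> u x"
proof -
  define Z where "Z k x = refl_logistic (real (Suc k) * u x) *\<^sub>R G x" for k x
  define z where "z k = pint p lebesgue (Z k)" for k
  note E = eta_flux[of "real (Suc _)", folded Z_def]
  have Spos: "real (Suc k) > 0" for k by simp
  note [measurable] = um fml
  have em[measurable]: "(\<lambda>x. eta (real (Suc k)) (u x)) \<in> borel_measurable lebesgue" for k
  proof -
    have "eta (real (Suc k)) \<in> borel_measurable borel"
      by (rule borel_measurable_continuous_onI, rule DERIV_continuous_on) (use eta_deriv[OF Spos] in auto)
    then show ?thesis by measurable
  qed
  have lim: "(\<lambda>k. \<integral>x. f x * eta (real (Suc k)) (u x) \<partial>lebesgue) \<longlonglongrightarrow> (\<integral>x. f x * min (u x) 0 \<partial>lebesgue)"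
  proof (rule integral_dominated_convergence[where w = "\<lambda>x. \<bar>f x * u x\<bar>"])
    show "integrable lebesgue (\<lambda>x. \<bar>f x * u x\<bar>)" using f_limit(2) by (rule integrable_abs)
    show "AE x in lebesgue. (\<lambda>k. f x * eta (real (Suc k)) (u x)) \<longlonglongrightarrow> f x * min (u x) 0"
      by (intro always_eventually allI tendsto_mult tendsto_const eta_tendsto)
    show "AE x in lebesgue. norm (f x * eta (real (Suc k)) (u x)) \<le> \<bar>f x * u x\<bar>" for k
      using eta_abs_le[OF Spos] by (intro always_eventually allI) (simp add: abs_mult mult_left_mono del: of_nat_Suc)
    show "(\<lambda>x. f x * eta (real (Suc k)) (u x)) \<in> borel_measurable lebesgue" for k
      by (intro borel_measurable_times fml em)
  qed measurable
  have neg: "(\<integral>x. f x * min (u x) 0 \<partial>lebesgue) \<le> 0"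
  proof -
    have "0 \<le> (\<integral>x. - (f x * min (u x) 0) \<partial>lebesgue)"
      using f0 by (intro integral_nonneg_AE always_eventually allI) (simp add: mult_nonneg_nonpos)
    then show ?thesis by simp
  qed
  have zle: "z k \<le> (\<integral>x. f x * eta (real (Suc k)) (u x) \<partial>lebesgue) / C1" for k
    using E(3)[OF Spos, of k] C1 by (simp add: z_def pos_le_divide_eq mult.commute del: of_nat_Suc)
  \<comment> \<open>The energies \<open>z k\<close> are nonnegative, while their upper bounds
    converge to a nonpositive number; so that number is 0 and the energies vanish in the
    limit.\<close>
  have z0: "z \<longlonglongrightarrow> 0"
  proof -
    have d: "(\<lambda>k. (\<integral>x. f x * eta (real (Suc k)) (u x) \<partial>lebesgue) / C1) \<longlonglongrightarrow> (\<integral>x. f x * min (u x) 0 \<partial>lebesgue) / C1"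
      by (intro tendsto_divide lim tendsto_const) (use C1 in simp)
    have zn: "0 \<le> z k" for k by (simp add: z_def)
    have "0 \<le> (\<integral>x. f x * min (u x) 0 \<partial>lebesgue) / C1"
      by (rule tendsto_lowerbound[OF d]) (use order.trans[OF zn zle] in \<open>auto intro!: always_eventually simp del: of_nat_Suc\<close>)
    moreover have "(\<integral>x. f x * min (u x) 0 \<partial>lebesgue) / C1 \<le> 0" using neg C1 by (simp add: divide_le_0_iff)
    ultimately have "(\<integral>x. f x * min (u x) 0 \<partial>lebesgue) / C1 = 0" by linarith
    with d have d': "(\<lambda>k. (\<integral>x. f x * eta (real (Suc k)) (u x) \<partial>lebesgue) / C1) \<longlonglongrightarrow> 0" by simp
    show ?thesis
      by (rule tendsto_sandwich[OF _ _ tendsto_const d']) (use zn zle in \<open>auto intro!: always_eventually simp del: of_nat_Suc\<close>)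
  qed
  have ball: "AE x in lebesgue. norm x \<le> real R \<longrightarrow> 0 \<le> u x" for R :: nat
  proof -
    define I where "I x = indicat_real (cball 0 (real R)) x" for x :: "real^'n"
    have [measurable]: "I \<in> borel_measurable lebesgue" unfolding I_def[abs_def] by (rule indicator_cball_measurable)
    have I0: "I x \<ge> 0" for x by (simp add: I_def)
    define c where "c = p / (real CARD('n) - p) * (real R * measure lebesgue (cball (0::real^'n) (real R)) powr (1/q))"
    have c: "c \<ge> 0" using n p by (simp add: c_def)
    \<comment> \<open>Hardy's inequality is available for test functions, hence for
      \<open>eta\<close> composed with \<open>w l\<close>; Fatou's lemma in \<open>l\<close>
      transfers it to \<open>u\<close>. The error \<open>y l\<close> measures the strong convergence
      from \<open>eta_flux\<close>.\<close>
    have step: "(\<integral>\<^sup>+x. ennreal (I x * \<bar>eta (real (Suc k)) (u x)\<bar>) \<partial>lebesgue) \<le> ennreal (c * (2 powr p * z k) powr (1/p))" for k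
    proof -
      define y where "y l = pint p lebesgue (\<lambda>x. refl_logistic (real (Suc k) * w l x) *\<^sub>R grad (w l) x - Z k x)" for l
      have y0: "y \<longlonglongrightarrow> 0" unfolding y_def by (rule E(2)[OF Spos])
      have cont: "isCont (eta (real (Suc k))) s" for s by (rule DERIV_isCont[OF eta_deriv[OF Spos]])
      have wl: "(\<integral>\<^sup>+x. ennreal (I x * \<bar>eta (real (Suc k)) (w l x)\<bar>) \<partial>lebesgue) \<le> ennreal (c * (2 powr p * (y l + z k)) powr (1/p))" for l
      proof -
        have t: "test_fun (\<lambda>x. eta (real (Suc k)) (w l x))" by (rule test_fun_eta[OF Spos wt])
        have g: "grad (\<lambda>x. eta (real (Suc k)) (w l x)) = (\<lambda>x. refl_logistic (real (Suc k) * w l x) *\<^sub>R grad (w l) x)"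
          by (rule ext, rule grad_eta[OF Spos wt])
        have Lg: "Lp p lebesgue (\<lambda>x. refl_logistic (real (Suc k) * w l x) *\<^sub>R grad (w l) x)"
          using Lp_grad[OF t p0(1)] unfolding g .
        have "pint p lebesgue (\<lambda>x. (refl_logistic (real (Suc k) * w l x) *\<^sub>R grad (w l) x - Z k x) + Z k x) \<le> 2 powr p * (y l + z k)"
          unfolding y_def z_def by (rule Lp_add(2)[OF Lp_diff(1)[OF Lg E(1)[OF Spos] p0(1)] E(1)[OF Spos] p0(1)])
        then have "pint p lebesgue (grad (\<lambda>x. eta (real (Suc k)) (w l x))) \<le> 2 powr p * (y l + z k)" unfolding g by simp
        then have "c * pint p lebesgue (grad (\<lambda>x. eta (real (Suc k)) (w l x))) powr (1/p) \<le> c * (2 powr p * (y l + z k)) powr (1/p)"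
          using c p by (intro mult_left_mono powr_mono2) auto
        with hardy_ball[OF pqs n t, of "real R"] show ?thesis
          unfolding I_def c_def[symmetric] by (meson ennreal_leI order.trans of_nat_0_le_iff)
      qed
      have "(\<integral>\<^sup>+x. ennreal (I x * \<bar>eta (real (Suc k)) (u x)\<bar>) \<partial>lebesgue) = (\<integral>\<^sup>+x. liminf (\<lambda>l. ennreal (I x * \<bar>eta (real (Suc k)) (w l x)\<bar>)) \<partial>lebesgue)"
      proof (intro nn_integral_cong_AE, use wu in eventually_elim)
        case (elim x)
        have "(\<lambda>l. ennreal (I x * \<bar>eta (real (Suc k)) (w l x)\<bar>)) \<longlonglongrightarrow> ennreal (I x * \<bar>eta (real (Suc k)) (u x)\<bar>)"
          by (intro tendsto_ennrealI tendsto_mult tendsto_const tendsto_rabs isCont_tendsto_compose[OF cont] elim)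
        from lim_imp_Liminf[OF _ this] show ?case by simp
      qed
      also have "\<dots> \<le> liminf (\<lambda>l. \<integral>\<^sup>+x. ennreal (I x * \<bar>eta (real (Suc k)) (w l x)\<bar>) \<partial>lebesgue)"
        by (rule nn_integral_liminf) (use test_meas[OF test_fun_eta[OF Spos wt]] in measurable)
      also have "\<dots> \<le> liminf (\<lambda>l. ennreal (c * (2 powr p * (y l + z k)) powr (1/p)))"
        by (rule Liminf_mono, rule always_eventually, rule allI, rule wl)
      also have "\<dots> = ennreal (c * (2 powr p * (0 + z k)) powr (1/p))"
      proof (rule lim_imp_Liminf)
        show "(\<lambda>l. ennreal (c * (2 powr p * (y l + z k)) powr (1/p))) \<longlonglongrightarrow> ennreal (c * (2 powr p * (0 + z k)) powr (1/p))"
        proof (intro tendsto_ennrealI tendsto_mult tendsto_const tendsto_powr2 tendsto_add y0)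
          show "\<forall>\<^sub>F l in sequentially. 0 \<le> 2 powr p * (y l + z k)"
            by (intro always_eventually allI mult_nonneg_nonneg add_nonneg_nonneg) (auto simp: y_def z_def)
        qed (use p in simp)
      qed simp
      finally show ?thesis by simp
    qed
    \<comment> \<open>Fatou's lemma once more, now in \<open>k\<close>: the negative part has
      integral 0 over every ball.\<close>
    have "(\<integral>\<^sup>+x. ennreal (I x * \<bar>min (u x) 0\<bar>) \<partial>lebesgue) = (\<integral>\<^sup>+x. liminf (\<lambda>k. ennreal (I x * \<bar>eta (real (Suc k)) (u x)\<bar>)) \<partial>lebesgue)"
    proof (rule nn_integral_cong)
      fix x
      have "(\<lambda>k. ennreal (I x * \<bar>eta (real (Suc k)) (u x)\<bar>)) \<longlonglongrightarrow> ennreal (I x * \<bar>min (u x) 0\<bar>)"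
        by (intro tendsto_ennrealI tendsto_mult tendsto_const tendsto_rabs eta_tendsto)
      from lim_imp_Liminf[OF _ this] show "ennreal (I x * \<bar>min (u x) 0\<bar>) = liminf (\<lambda>k. ennreal (I x * \<bar>eta (real (Suc k)) (u x)\<bar>))" by simp
    qed
    also have "\<dots> \<le> liminf (\<lambda>k. \<integral>\<^sup>+x. ennreal (I x * \<bar>eta (real (Suc k)) (u x)\<bar>) \<partial>lebesgue)"
      by (rule nn_integral_liminf) measurable
    also have "\<dots> \<le> liminf (\<lambda>k. ennreal (c * (2 powr p * z k) powr (1/p)))"
      by (rule Liminf_mono, rule always_eventually, rule allI, rule step)
    also have "\<dots> = ennreal (c * (2 powr p * 0) powr (1/p))"
    proof (rule lim_imp_Liminf)
      show "(\<lambda>k. ennreal (c * (2 powr p * z k) powr (1/p))) \<longlonglongrightarrow> ennreal (c * (2 powr p * 0) powr (1/p))"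
      proof (intro tendsto_ennrealI tendsto_mult tendsto_const tendsto_powr2 z0)
        show "\<forall>\<^sub>F k in sequentially. 0 \<le> 2 powr p * z k"
          by (intro always_eventually allI mult_nonneg_nonneg) (auto simp: z_def)
      qed (use p in simp)
    qed simp
    also have "\<dots> = 0" using p by simp
    finally have "(\<integral>\<^sup>+x. ennreal (I x * \<bar>min (u x) 0\<bar>) \<partial>lebesgue) = 0" by simp
    then have "AE x in lebesgue. ennreal (I x * \<bar>min (u x) 0\<bar>) = 0"
      by (subst (asm) nn_integral_0_iff_AE) auto
    then show ?thesis
    proof eventually_elim
      case (elim x)
      show ?case
      proof
        assume "norm x \<le> real R"
        then have "\<bar>min (u x) 0\<bar> = 0" using elim by (simp add: I_def)
        then show "0 \<le> u x" by (simp add: min_def split: if_splits)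
      qed
    qed
  qed
  then have "AE x in lebesgue. \<forall>R::nat. norm x \<le> real R \<longrightarrow> 0 \<le> u x" unfolding AE_all_countable by (intro allI)
  then show ?thesis
  proof eventually_elim
    case (elim x)
    obtain R :: nat where "norm x \<le> real R" using real_arch_simple by blast
    then show ?case using elim by blast
  qed
qed

text \<open>A lower bound \<open>c\<close> would give
  \<open>c * m \<le> k * R * m powr (1/q) * M powr (1/p)\<close> for the volume \<open>m\<close> of
  the ball of radius \<open>R\<close>. After cancellation the left side grows like
  \<open>R powr (N / p)\<close> and the right side like \<open>R\<close>, which is impossible for
  large \<open>R\<close> because \<open>N > p\<close>.\<close>

lemma (in leray_lions_limit) not_bounded_below:
  assumes c: "c > 0" "AE x in lebesgue. c \<le> u x" shows False
proof -
  define N where "N = real CARD('n)"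
  have Np: "N > p" using n by (simp add: N_def)
  define V where "V = unit_ball_vol N"
  have V: "V > 0" using Np p by (simp add: V_def)
  define k where "k = p / (N - p)"
  have k: "k > 0" using Np p by (simp add: k_def)
  \<comment> \<open>The ratio of the two constants, plus 1 to make the final comparison strict;
    \<open>R\<close> is chosen so that \<open>R powr (N/p - 1)\<close> equals
    \<open>D\<close>.\<close>
  define D where "D = k * M powr (1/p) / (c * V powr (1/p)) + 1"
  have D: "D > 0" using k c V by (simp add: D_def add_nonneg_pos)
  define R where "R = D powr (1 / (N/p - 1))"
  have e: "N / p - 1 > 0" using Np p by simp
  have R: "R > 0" using D by (simp add: R_def)
  have "1 / y * y = 1" if "y > 0" for y :: real using that by simp
  from this[OF e] have "1 / (N/p - 1) * (N/p - 1) = 1" .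
  then have RD: "R powr (N/p - 1) = D" unfolding R_def powr_powr using D by simp
  define m where "m = measure lebesgue (cball (0::real^'n) R)"
  have emR: "emeasure lborel (cball (0::real^'n) R) = ennreal (V * R ^ CARD('n))"
    using emeasure_cball[of R "0::real^'n"] R by (simp add: V_def N_def)
  have m: "m = V * R powr N"
    using emR R V unfolding m_def by (simp add: measure_def N_def powr_realpow)
  have m0: "m > 0" using m V R by simp
  have "ennreal (c * m) = (\<integral>\<^sup>+x. ennreal c * indicator (cball 0 R) x \<partial>(lebesgue :: (real^'n) measure))"
    using emR m R V c by (subst nn_integral_cmult_indicator) (auto simp: ennreal_mult N_def powr_realpow)
  also have "\<dots> \<le> (\<integral>\<^sup>+x. ennreal (indicat_real (cball 0 R) x * \<bar>u x\<bar>) \<partial>lebesgue)"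
    by (rule nn_integral_mono_AE, use c(2) in eventually_elim) (auto split: split_indicator intro!: ennreal_leI)
  also have "\<dots> \<le> ennreal (k * (R * m powr (1/q)) * M powr (1/p))"
    using local_bound[of R] R unfolding k_def N_def m_def by simp
  finally have "c * m \<le> k * (R * m powr (1/q)) * M powr (1/p)"
    using k R by (subst (asm) ennreal_le_iff) auto
  moreover have "m = m powr (1/p) * m powr (1/q)" using m0 pq by (simp add: powr_add[symmetric])
  ultimately have "(c * m powr (1/p)) * m powr (1/q) \<le> (k * R * M powr (1/p)) * m powr (1/q)" by (simp add: mult_ac)
  then have "c * m powr (1/p) \<le> k * R * M powr (1/p)" using m0 by (simp add: mult_le_cancel_right)
  moreover have "m powr (1/p) = V powr (1/p) * (R * R powr (N/p - 1))"
  proof -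
    have "m powr (1/p) = V powr (1/p) * R powr (N / p)" using m V R by (simp add: powr_mult powr_powr)
    also have "R powr (N / p) = R powr (1 + (N/p - 1))" by simp
    also have "\<dots> = R * R powr (N/p - 1)" using R by (subst powr_add) simp
    finally show ?thesis .
  qed
  ultimately have "(c * V powr (1/p) * D) * R \<le> (k * M powr (1/p)) * R" by (simp add: RD mult_ac)
  then have "c * V powr (1/p) * D \<le> k * M powr (1/p)" using R by (simp add: mult_le_cancel_right)
  moreover have "c * V powr (1/p) * D = k * M powr (1/p) + c * V powr (1/p)"
    using c V by (simp add: D_def distrib_left)
  ultimately show False using c V by (simp add: mult_le_0_iff not_le)
qed

lemma (in leray_lions_limit) ess_inf_u: "ess_inf u = 0"
  unfolding ess_inf_def
proof (rule antisym)
  show "0 \<le> Sup {z. AE x in lebesgue. z \<le> ereal (u x)}"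
    by (rule Sup_upper) (use nonneg in simp)
  show "Sup {z. AE x in lebesgue. z \<le> ereal (u x)} \<le> 0"
  proof (rule Sup_least, rule ccontr)
    fix z assume z: "z \<in> {z. AE x in lebesgue. z \<le> ereal (u x)}" "\<not> z \<le> 0"
    then have "0 < z" by simp
    \<comment> \<open>A real number below \<open>z\<close> is taken because \<open>z\<close> may be
      infinite.\<close>
    from ereal_dense2[OF this] obtain c where c: "0 < ereal c" "ereal c < z" by blast
    have "AE x in lebesgue. c \<le> u x"
      using z(1) unfolding mem_Collect_eq
    proof eventually_elim
      case (elim x)
      then have "ereal c \<le> ereal (u x)" using c(2) by (meson less_imp_le order.trans)
      then show ?case by simp
    qed
    then show False using not_bounded_below c(1) by simp
  qed
qed

text \<open>Integration by parts holds for each \<open>w k\<close>. The side with \<open>u\<close>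
  passes to the limit by the weighted convergence with weight \<open>grad \<phi> x $ i\<close>, the
  side with \<open>G\<close> by pairing \<open>L^p\<close> convergence with a fixed function in
  \<open>L^q\<close>.\<close>

lemma (in leray_lions_limit) weak_gradient_u: "weak_gradient u G"
  unfolding weak_gradient_def
proof (intro allI impI)
  fix \<phi> :: "real^'n \<Rightarrow> real" and i assume \<phi>: "test_fun \<phi>"
  obtain R where R: "\<And>x. norm x \<ge> R \<Longrightarrow> \<phi> x = 0" "\<And>x. norm x \<ge> R \<Longrightarrow> grad \<phi> x = 0"
    by (rule test_fun_bounds[OF \<phi>]) (rule that)
  have hc: "continuous_on UNIV (\<lambda>x. grad \<phi> x $ i)" by (intro continuous_on_component test_fun_C1(3)[OF \<phi>])
  have h0: "grad \<phi> x $ i = 0" if "norm x \<ge> R" for x using R(2)[OF that] by simp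
  obtain C where C: "C \<ge> 0" "\<And>g :: real^'n \<Rightarrow> real. test_fun g \<Longrightarrow> (\<integral>\<^sup>+x. ennreal (\<bar>grad \<phi> x $ i\<bar> * \<bar>g x\<bar>) \<partial>lebesgue) \<le> ennreal (C * pint p lebesgue (grad g) powr (1/p))"
    by (rule hardy_compact_weight[where R = R, OF pqs n hc h0]) (assumption, rule that)
  have hm: "(\<lambda>x. grad \<phi> x $ i) \<in> borel_measurable lebesgue"
    using hc by (intro measurable_completion) (simp add: borel_measurable_continuous_onI)
  note W = weighted_strong_limit[OF p hm C(1) C(2) wt um wu wM w2]
  define e where "e x = \<phi> x *\<^sub>R (axis i 1 :: real^'n)" for x
  have Le: "Lp q lebesgue e"
    unfolding e_def[abs_def] by (rule Lp_compact_support[where R = R])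
      (use R test_fun_C1(2)[OF \<phi>] q in \<open>auto intro!: continuous_intros\<close>)
  have ge: "y \<bullet> e x = y $ i * \<phi> x" for x y by (simp add: e_def inner_axis)
  have "(\<lambda>k. \<integral>x. grad (w k) x \<bullet> e x \<partial>lebesgue) \<longlonglongrightarrow> (\<integral>x. G x \<bullet> e x \<partial>lebesgue)"
    by (rule holder_tendsto[OF pqs G1 Lw Le G2])
  then have l1: "(\<lambda>k. - (\<integral>x. grad (w k) x $ i * \<phi> x \<partial>lebesgue)) \<longlonglongrightarrow> - (\<integral>x. G x $ i * \<phi> x \<partial>lebesgue)"
    unfolding ge by (rule tendsto_minus)
  have l2: "(\<lambda>k. \<integral>x. grad \<phi> x $ i * w k x \<partial>lebesgue) \<longlonglongrightarrow> (\<integral>x. grad \<phi> x $ i * u x \<partial>lebesgue)" by (rule W(5))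
  have eq: "(\<integral>x. grad \<phi> x $ i * w k x \<partial>lebesgue) = - (\<integral>x. grad (w k) x $ i * \<phi> x \<partial>lebesgue)" for k
    using integration_by_parts[OF wt \<phi>, of k i] by (simp add: partial_deriv_eq_grad mult.commute)
  have eqlim: "(\<integral>x. grad \<phi> x $ i * u x \<partial>lebesgue) = - (\<integral>x. G x $ i * \<phi> x \<partial>lebesgue)"
    using l2 l1 unfolding eq by (rule LIMSEQ_unique)
  show "integrable lebesgue (\<lambda>x. u x * partial_deriv i \<phi> x) \<and>
      integrable lebesgue (\<lambda>x. G x $ i * \<phi> x) \<and>
      (\<integral>x. u x * partial_deriv i \<phi> x \<partial>lebesgue) = - (\<integral>x. G x $ i * \<phi> x \<partial>lebesgue)"
  proof (intro conjI)
    show "integrable lebesgue (\<lambda>x. u x * partial_deriv i \<phi> x)"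
      using W(2) by (simp add: partial_deriv_eq_grad mult.commute)
    show "integrable lebesgue (\<lambda>x. G x $ i * \<phi> x)"
      using holder_inner(1)[OF pqs G1 Le] unfolding ge .
    show "(\<integral>x. u x * partial_deriv i \<phi> x \<partial>lebesgue) = - (\<integral>x. G x $ i * \<phi> x \<partial>lebesgue)"
      using eqlim by (simp add: partial_deriv_eq_grad mult.commute)
  qed
qed

text \<open>The gradient is in \<open>L^p\<close> globally; for \<open>u\<close> the Hardy bound on
  a ball containing the compact set is uniform along \<open>w\<close> and passes to the limit by
  Fatou's lemma.\<close>

lemma (in leray_lions_limit) W1p_u: "W1p_loc_grad p u G"
  unfolding W1p_loc_grad_def
proof (intro conjI weak_gradient_u)
  show "Lp_loc_vec p G"
    unfolding Lp_loc_vec_def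
  proof (intro conjI allI impI)
    show "G \<in> borel_measurable lebesgue" by (rule LpD(1)[OF G1])
    fix S :: "(real^'n) set"
    have "(\<integral>\<^sup>+x\<in>S. ennreal (norm (G x) powr p) \<partial>lebesgue) \<le> (\<integral>\<^sup>+x. ennreal (norm (G x) powr p) \<partial>lebesgue)"
      by (rule nn_integral_mono) (auto split: split_indicator)
    also have "\<dots> = ennreal (pint p lebesgue G)"
      unfolding pint_def by (rule nn_integral_eq_integral[OF LpD(2)[OF G1]]) simp
    also have "\<dots> < \<infinity>" by simp
    finally show "(\<integral>\<^sup>+x\<in>S. ennreal (norm (G x) powr p) \<partial>lebesgue) < \<infinity>" .
  qed
  show "Lp_loc p u"
    unfolding Lp_loc_def
  proof (intro conjI allI impI um)
    fix S :: "(real^'n) set" assume "compact S"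
    then obtain R where R: "R > 0" "\<And>x. x \<in> S \<Longrightarrow> norm x \<le> R"
      using compact_imp_bounded bounded_pos by metis
    note H = hardy_ball_Lp[OF pqs n wt less_imp_le[OF R(1)]]
    define C where "C = (p / (real CARD('n) - p) * R) powr p * M"
    have L: "Lp p lebesgue (\<lambda>x. indicat_real (cball 0 R) x *\<^sub>R u x)"
    proof (rule pint_fatou(1)[OF H(1)])
      show "(\<lambda>x. indicat_real (cball 0 R) x *\<^sub>R u x) \<in> borel_measurable lebesgue"
        by (intro borel_measurable_scaleR indicator_cball_measurable um)
      show "AE x in lebesgue. (\<lambda>k. indicat_real (cball 0 R) x *\<^sub>R w k x) \<longlonglongrightarrow> indicat_real (cball 0 R) x *\<^sub>R u x"
        using wu by eventually_elim (intro tendsto_intros)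
      have "pint p lebesgue (\<lambda>x. indicat_real (cball 0 R) x *\<^sub>R w k x) \<le> C" for k
        using H(2)[of k] mult_left_mono[OF wM[of k], of "(p / (real CARD('n) - p) * R) powr p"] unfolding C_def by simp
      then show "\<forall>\<^sub>F k in sequentially. pint p lebesgue (\<lambda>x. indicat_real (cball 0 R) x *\<^sub>R w k x) \<le> C"
        by (intro always_eventually allI)
    qed (rule p0(2))
    have "(\<integral>\<^sup>+x\<in>S. ennreal (\<bar>u x\<bar> powr p) \<partial>lebesgue) \<le> (\<integral>\<^sup>+x. ennreal (norm (indicat_real (cball 0 R) x *\<^sub>R u x) powr p) \<partial>lebesgue)"
      by (rule nn_integral_mono) (use R(2) in \<open>auto split: split_indicator\<close>)
    also have "\<dots> = ennreal (pint p lebesgue (\<lambda>x. indicat_real (cball 0 R) x *\<^sub>R u x))"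
      unfolding pint_def by (rule nn_integral_eq_integral[OF LpD(2)[OF L]]) simp
    also have "\<dots> < \<infinity>" by simp
    finally show "(\<integral>\<^sup>+x\<in>S. ennreal (\<bar>u x\<bar> powr p) \<partial>lebesgue) < \<infinity>" .
  qed
qed

lemma (in leray_lions_limit) solution_u: "is_solution p A f u"
  unfolding is_solution_def
  using W1p_u weak_equation f_hardy(1) holder_inner(1)[OF qps LS Lp_grad[OF _ p0(1)]] by blast

theorem (in leray_lions) exists_solution: "\<exists>u. is_solution p A f u \<and> ess_inf u = 0"
proof -
  obtain v' where v': "\<And>m. test_fun (v' m)" "\<And>m. pint p lebesgue (grad (v' m)) \<le> M"
    "\<And>m. (\<integral>x. A x (v' m x) (grad (v' m) x) \<bullet> grad (v' m) x \<partial>lebesgue) \<le> (\<integral>x. f x * v' m x \<partial>lebesgue)"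
    "\<And>\<psi>. test_fun \<psi> \<Longrightarrow> (\<lambda>m. \<integral>x. A x (v' m x) (grad (v' m) x) \<bullet> grad \<psi> x \<partial>lebesgue) \<longlonglongrightarrow> (\<integral>x. f x * \<psi> x \<partial>lebesgue)"
    by (rule galerkin_sequence) (rule that)
  obtain r u where r: "strict_mono r" "u \<in> borel_measurable lebesgue" "AE x in lebesgue. (\<lambda>k. v' (r k) x) \<longlonglongrightarrow> u x"
    by (rule rellich_AE[where w = v', OF p n v'(1,2)]) (rule that)
  \<comment> \<open>The almost everywhere convergent subsequence is extracted before forming
    midpoint combinations, so that combinations of its tails inherit the limit
    \<open>u\<close>.\<close>
  define v where "v k = v' (r k)" for k
  have v1: "test_fun (v m)" and v2: "pint p lebesgue (grad (v m)) \<le> M" for m unfolding v_def by (rule v')+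
  \<comment> \<open>The sets are made of gradients, since energy and closeness are measured there;
    the functions themselves are recovered by choice afterwards.\<close>
  define KK where "KK k = {grad a | a. midhull v k a}" for k
  obtain g where g: "\<And>k. g k \<in> KK k"
    "\<And>e. e > 0 \<Longrightarrow> \<exists>N. \<forall>m\<ge>N. \<forall>l\<ge>N. pint p lebesgue (\<lambda>x. g m x - g l x) \<le> e"
  proof (rule Lp_Cauchy_of_midpoint_convex[where K = KK and M = lebesgue and B = M and p = p])
    show "p > 1" by (rule p)
    show "KK l \<subseteq> KK k" if "k \<le> l" for k l unfolding KK_def using midhull_antimono[OF _ that] by blast
    show "KK k \<noteq> {}" for k unfolding KK_def using midhull.base[of k k v] by blast
    show "(\<lambda>x. (1/2) *\<^sub>R (a x + b x)) \<in> KK k" if a: "a \<in> KK k" and b: "b \<in> KK k" for k a b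
    proof -
      obtain a' where a': "a = grad a'" "midhull v k a'" using a unfolding KK_def by blast
      obtain b' where b': "b = grad b'" "midhull v k b'" using b unfolding KK_def by blast
      have "grad (\<lambda>x. (1/2) * a' x + (1/2) * b' x) = (\<lambda>x. (1/2) *\<^sub>R (a x + b x))"
        unfolding a'(1) b'(1) by (rule midhull_grad[OF midhull_test_fun[OF a'(2) v1] midhull_test_fun[OF b'(2) v1]])
      then show ?thesis unfolding KK_def using midhull.mid[OF a'(2) b'(2)] by (metis (mono_tags, lifting) mem_Collect_eq)
    qed
    show "Lp p lebesgue a" if a: "a \<in> KK k" for k a
    proof -
      obtain a' where a': "a = grad a'" "midhull v k a'" using a unfolding KK_def by blast
      show ?thesis unfolding a'(1) by (rule Lp_grad[OF midhull_test_fun[OF a'(2) v1]]) (use p in simp)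
    qed
    show "pint p lebesgue a \<le> M" if a: "a \<in> KK k" for k a
    proof -
      obtain a' where a': "a = grad a'" "midhull v k a'" using a unfolding KK_def by blast
      show ?thesis unfolding a'(1) by (rule midhull_pint[OF a'(2) v1 v2 p])
    qed
  qed (rule that)
  have "\<forall>k. \<exists>a. g k = grad a \<and> midhull v k a" using g(1) unfolding KK_def by blast
  from choice[OF this] obtain w where w: "\<forall>k. g k = grad (w k) \<and> midhull v k (w k)" ..
  have gw: "g k = grad (w k)" and wh: "midhull v k (w k)" for k using w by auto
  have Lg: "Lp p lebesgue (g k)" for k
    unfolding gw by (rule Lp_grad[OF midhull_test_fun[OF wh v1]]) (use p in simp)
  obtain G s where G: "Lp p lebesgue G" "(\<lambda>k. pint p lebesgue (\<lambda>x. g k x - G x)) \<longlonglongrightarrow> 0"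
    and "strict_mono (s :: nat \<Rightarrow> nat)" "AE x in lebesgue. (\<lambda>k. g (s k) x) \<longlonglongrightarrow> G x"
    by (rule Lp_complete[where f = g, OF p Lg g(2)]) (assumption, rule that)
  interpret leray_lions_limit p q A f C1 C2 v w u G
  proof
    show "(\<integral>x. A x (v m x) (grad (v m) x) \<bullet> grad (v m) x \<partial>lebesgue) \<le> (\<integral>x. f x * v m x \<partial>lebesgue)" for m
      unfolding v_def by (rule v'(3))
    show "(\<lambda>m. \<integral>x. A x (v m x) (grad (v m) x) \<bullet> grad \<psi> x \<partial>lebesgue) \<longlonglongrightarrow> (\<integral>x. f x * \<psi> x \<partial>lebesgue)" if "test_fun \<psi>" for \<psi>
      using LIMSEQ_subseq_LIMSEQ[OF v'(4)[OF that] r(1)] by (simp add: o_def v_def)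
    show "AE x in lebesgue. (\<lambda>m. v m x) \<longlonglongrightarrow> u x" using r(3) unfolding v_def .
    show "\<exists>N. \<forall>m\<ge>N. \<forall>l\<ge>N. pint p lebesgue (\<lambda>x. grad (w m) x - grad (w l) x) \<le> e" if "e > 0" for e
      using g(2)[OF that] unfolding gw .
    show "(\<lambda>k. pint p lebesgue (\<lambda>x. grad (w k) x - G x)) \<longlonglongrightarrow> 0" using G(2) unfolding gw .
  qed (rule v1 v2 r(2) wh G(1))+
  show ?thesis using solution_u ess_inf_u by blast
qed

theorem theorem2p2:
  fixes p :: real and A :: "real^'n::finite \<Rightarrow> real \<Rightarrow> real^'n \<Rightarrow> real^'n"
    and F :: "real \<Rightarrow> real" and C1 C2 :: real
  assumes n2: "CARD('n) \<ge> 2"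
    and p1: "p > 1" and np: "real CARD('n) > p"
    and car: "caratheodory A"
    and C1: "C1 > 0" and C2: "C2 > 0"
    and struct: "AE x in lebesgue. \<forall>s \<zeta> \<xi>.
        (A x s \<zeta> - A x s \<xi>) \<bullet> (\<zeta> - \<xi>) \<ge> 0 \<and>
        C1 * norm \<xi> powr p \<le> \<xi> \<bullet> A x s \<xi> \<and>
        norm (A x s \<xi>) \<le> C2 * norm \<xi> powr (p - 1)"
    and F_nonneg: "\<forall>r\<ge>0. F r \<ge> 0"
    and F_noninc: "\<forall>r t. 0 \<le> r \<longrightarrow> r \<le> t \<longrightarrow> F t \<le> F r"
    and F_int: "(\<integral>\<^sup>+r\<in>{0..}. ennreal (r powr (real CARD('n) * (p - 1) / p) * F r) \<partial>lborel) < \<infinity>"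
  shows "\<exists>u. is_solution p A (\<lambda>x. F (norm x)) u \<and> ess_inf u = 0"
proof -
  define q where "q = p / (p - 1)"
  have pq: "p > 1" "q > 1" "1/p + 1/q = 1" using p1 by (auto simp: q_def field_simps)
  \<comment> \<open>The integral condition on \<open>F\<close> enters here, in the form of the
    weight condition of the locale.\<close>
  interpret leray_lions p q A "\<lambda>x. F (norm x)" C1 C2
    by unfold_locales
       (use pq np car C1 C2 struct F_nonneg borel_measurable_radial_antimono(2)[OF F_noninc]
          radial_weight_integrable[OF pq F_nonneg F_noninc F_int] in auto)
  show ?thesis by (rule exists_solution)
qed

end
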